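(* Let $\mathcal{S}$ be any one of the following subsets of $\mathcal{M}$: $\mathcal{X}(u,v,w)$ for some $(u,v,w)\in\{0,1,2\}^3$, or $\mathcal{I}(\mathcal{D})$ for some dimensional function $\mathcal{D}$, or $\mathcal{CA}$. Then for every non-empty open subset $O$ of $\mathcal{M}$, the set $\mathcal{S}\cap O$ is infinite-dimensional.
   Context: $\mathcal{M}$ is the set of all isometry classes of non-empty compact metric spaces, equipped with the Gromov--Hausdorff distance $d_{GH}$; subsets carry the restricted metric. A metric space is called infinite-dimensional if its covering dimension is infinite. $B(x,r)$ denotes the closed ball and $\delta_d(X)$ the diameter. A metric space $(X,d)$ is $N$-doubling ($N\in\mathbb{N}$) if for all $x\in X$, $r\in(0,\infty)$ there is $F\subset X$ with $B(x,r)\subset\bigcup_{y\in F}B(y,r/2)$ and $\mathrm{Card}(F)\le N$; it is doubling if it is $N$-doubling for some $N$. It is $\delta$-uniformly disconnected ($\delta\in(0,\infty)$) if for every non-constant finite sequence $\{z_i\}_{i=1}^N$ in $X$ we have $\delta d(z_1,z_N)\le\max_{1\le i\le N-1}d(z_i,z_{i+1})$; it is uniformly disconnected if this holds for some $\delta\in(0,\infty)$. It is $c$-uniformly perfect ($c\in(0,1)$) if for every $x\in X$ and every $r\in(0,\delta_d(X))$ there is $y\in X$ with $c\cdot r\le d(x,y)\le r$; it is uniformly perfect if this holds for some $c\in(0,1)$. Let $\mathcal{Q}_1,\mathcal{Q}_2,\mathcal{Q}_3\subset\mathcal{M}$ be the sets of all doubling, all uniformly disconnected, and all uniformly perfect spaces,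 respectively. For $k\in\{1,2,3\}$ put $\mathcal{E}_k(0)=\mathcal{M}\setminus\mathcal{Q}_k$, $\mathcal{E}_k(1)=\mathcal{Q}_k$, $\mathcal{E}_k(2)=\mathcal{M}$, and $\mathcal{X}(u,v,w)=\mathcal{E}_1(u)\cap\mathcal{E}_2(v)\cap\mathcal{E}_3(w)$. A map $\mathcal{D}:\mathcal{M}\to[0,\infty]$ is a dimensional function if (i) for every $(X,d)\in\mathcal{M}$ and every (non-empty) closed subset $A$ of $X$ we have $\mathcal{D}(A,d)\le\mathcal{D}(X,d)$, and (ii) for all $\epsilon\in(0,\infty)$ there is a compact metric space $(Y,e)$ with $\mathcal{D}(Y,e)=\infty$ and $\delta_e(Y)\le\epsilon$. Put $\mathcal{I}(\mathcal{D})=\{(X,d)\in\mathcal{M}:\mathcal{D}(X,d)=\infty\}$. $\mathcal{CA}\subset\mathcal{M}$ is the set of all compact metric spaces homeomorphic to the Cantor set. *)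

theory Defs
  imports "HOL-Analysis.Analysis"
begin

section \<open>Isometries and the Gromov--Hausdorff distance\<close>

definition compact_metric :: "'a metric \<Rightarrow> bool" where
  "compact_metric m \<longleftrightarrow> mspace m \<noteq> {} \<and> compact_space (mtopology_of m)"

definition isometric_embedding :: "'a metric \<Rightarrow> 'b metric \<Rightarrow> ('a \<Rightarrow> 'b) \<Rightarrow> bool" where
  "isometric_embedding m1 m2 f \<longleftrightarrow> f \<in> mspace m1 \<rightarrow> mspace m2 \<and>
     (\<forall>x\<in>mspace m1. \<forall>y\<in>mspace m1. mdist m2 (f x) (f y) = mdist m1 x y)"

definition isometric :: "'a metric \<Rightarrow> 'b metric \<Rightarrow> bool" where
  "isometric m1 m2 \<longleftrightarrow> (\<exists>f. isometric_embedding m1 m2 f \<and> f ` mspace m1 = mspace m2)"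

definition hausdorff_dist :: "'a metric \<Rightarrow> 'a set \<Rightarrow> 'a set \<Rightarrow> real" where
  "hausdorff_dist m A B =
     max (SUP a\<in>A. INF b\<in>B. mdist m a b) (SUP b\<in>B. INF a\<in>A. mdist m a b)"

text \<open>
  The ambient spaces \<open>Z\<close> range over metric spaces carried by sets of reals. A compact metric space
  has at most continuum many points (see \<open>isometric_real_metric\<close> below), and only the subspace
  \<open>i(X) \<union> j(Y)\<close> of \<open>Z\<close> matters, so this restriction does not change the infimum.
\<close>

definition gh_dist :: "'a metric \<Rightarrow> 'b metric \<Rightarrow> real" where
  "gh_dist m1 m2 = Inf {hausdorff_dist Z (i ` mspace m1) (j ` mspace m2) | (Z :: real metric) i j.
     isometric_embedding m1 Z i \<and> isometric_embedding m2 Z j}"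

lemma isometric_embedding_mem: "isometric_embedding m1 m2 f \<Longrightarrow> x \<in> mspace m1 \<Longrightarrow> f x \<in> mspace m2"
  by (auto simp: isometric_embedding_def)

lemma isometric_embedding_mdist:
  "isometric_embedding m1 m2 f \<Longrightarrow> x \<in> mspace m1 \<Longrightarrow> y \<in> mspace m1 \<Longrightarrow>
     mdist m2 (f x) (f y) = mdist m1 x y"
  by (simp add: isometric_embedding_def)

lemma isometric_embedding_inj_on:
  assumes f: "isometric_embedding m1 m2 f"
  shows "inj_on f (mspace m1)"
proof (rule inj_onI)
  fix x y assume xy: "x \<in> mspace m1" "y \<in> mspace m1" "f x = f y"
  have "mdist m2 (f x) (f y) = 0" using xy isometric_embedding_mem[OF f] by simp
  then show "x = y" using isometric_embedding_mdist[OF f xy(1,2)] xy by simp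
qed

lemma isometric_embedding_compose:
  "isometric_embedding m1 m2 f \<Longrightarrow> isometric_embedding m2 m3 g \<Longrightarrow> isometric_embedding m1 m3 (g \<circ> f)"
  unfolding isometric_embedding_def by (auto simp: Pi_iff)

lemma isometric_refl: "isometric m m"
  unfolding isometric_def isometric_embedding_def by (rule exI[of _ id]) auto

lemma isometric_inv_into:
  assumes f: "isometric_embedding m1 m2 f" "f ` mspace m1 = mspace m2"
  shows "isometric_embedding m2 m1 (inv_into (mspace m1) f)"
    and "inv_into (mspace m1) f ` mspace m2 = mspace m1"
proof -
  let ?g = "inv_into (mspace m1) f"
  have g: "?g y \<in> mspace m1" "f (?g y) = y" if "y \<in> mspace m2" for y
  proof -
    have "y \<in> f ` mspace m1" using that f(2) by simp
    then show "?g y \<in> mspace m1" "f (?g y) = y" by (rule inv_into_into, rule f_inv_into_f)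
  qed
  have "mdist m1 (?g x) (?g y) = mdist m2 x y" if "x \<in> mspace m2" "y \<in> mspace m2" for x y
    using isometric_embedding_mdist[OF f(1) g(1)[OF that(1)] g(1)[OF that(2)]]
      g(2)[OF that(1)] g(2)[OF that(2)] by simp
  then show "isometric_embedding m2 m1 ?g"
    using g(1) by (simp add: isometric_embedding_def)
  have "?g ` f ` mspace m1 = mspace m1"
    by (rule inv_into_image_cancel[OF isometric_embedding_inj_on[OF f(1)] order_refl])
  then show "?g ` mspace m2 = mspace m1" by (simp only: f(2))
qed

lemma isometric_sym:
  assumes "isometric m1 m2"
  shows "isometric m2 m1"
proof -
  obtain f where f: "isometric_embedding m1 m2 f" "f ` mspace m1 = mspace m2"
    using assms by (auto simp: isometric_def)
  from isometric_inv_into[OF f] show ?thesis unfolding isometric_def by blast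
qed

lemma isometric_trans:
  assumes "isometric m1 m2" "isometric m2 m3"
  shows "isometric m1 m3"
proof -
  obtain f g where "isometric_embedding m1 m2 f" "f ` mspace m1 = mspace m2"
    "isometric_embedding m2 m3 g" "g ` mspace m2 = mspace m3"
    using assms by (auto simp: isometric_def)
  then show ?thesis unfolding isometric_def
    by (intro exI[of _ "g \<circ> f"] conjI isometric_embedding_compose) (simp_all only: image_comp[symmetric])
qed

lemma isometric_real_metric:
  fixes m :: "'a metric"
  assumes "compact_metric m"
  shows "\<exists>m' :: real metric. isometric m m'"
proof -
  interpret Metric_space "mspace m" "mdist m" by simp
  have c: "compact_space mtopology"
    using assms by (simp add: compact_metric_def mtopology_of_def)
  have "\<exists>K. finite K \<and> K \<subseteq> mspace m \<and> mspace m \<subseteq> (\<Union>x\<in>K. mball x (1 / Suc n))" for n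
    using c unfolding compact_space_eq_mcomplete_mtotally_bounded mtotally_bounded_def by auto
  then obtain K where K: "\<And>n. finite (K n)" "\<And>n. K n \<subseteq> mspace m"
      "\<And>n. mspace m \<subseteq> (\<Union>x\<in>K n. mball x (1 / Suc n))"
    by metis
  let ?I = "SIGMA n:UNIV. K n"
  have "countable ?I" using K(1) by (intro countable_SIGMA) (auto intro: countable_finite)
  then obtain e :: "nat \<times> 'a \<Rightarrow> nat" where e: "inj_on e ?I"
    by (auto simp: countable_def)
  define h where "h x = e ` {(n, k). k \<in> K n \<and> mdist m k x < 1 / Suc n}" for x
  have h: "inj_on h (mspace m)"
  proof (rule inj_onI, rule ccontr)
    fix x y assume xy: "x \<in> mspace m" "y \<in> mspace m" "h x = h y" "x \<noteq> y"
    let ?S = "\<lambda>x. {(n, k). k \<in> K n \<and> mdist m k x < 1 / Suc n}"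
    have "?S x = ?S y"
      using xy(3) unfolding h_def by (subst (asm) inj_on_image_eq_iff[OF e]) auto
    moreover have "mdist m x y > 0" using xy by simp
    then obtain n where n: "1 / Suc n < mdist m x y / 2"
      by (metis half_gt_zero nat_approx_posE)
    obtain k where k: "k \<in> K n" "mdist m k x < 1 / Suc n" using K(3)[of n] xy(1) by auto
    ultimately have "mdist m k y < 1 / Suc n" by blast
    moreover have "k \<in> mspace m" using k K(2) by auto
    ultimately show False using triangle''[of x k y] k n xy by auto
  qed
  obtain b :: "nat set \<Rightarrow> real" where b: "inj b"
    using nat_sets_eqpoll_reals by (auto simp: eqpoll_def bij_betw_def)
  define f where "f = b \<circ> h"
  have f: "inj_on f (mspace m)"
    unfolding f_def using h b by (simp add: comp_inj_on inj_on_subset)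
  let ?g = "inv_into (mspace m) f"
  interpret N: Metric_space "f ` mspace m" "\<lambda>u v. mdist m (?g u) (?g v)"
    by unfold_locales (auto simp: f commute triangle)
  have "isometric_embedding m (metric (f ` mspace m, \<lambda>u v. mdist m (?g u) (?g v))) f"
    by (auto simp: isometric_embedding_def f)
  then show ?thesis unfolding isometric_def by (metis N.mspace_metric)
qed

lemma compact_metric_isometric:
  assumes "isometric m1 m2" "compact_metric m1"
  shows "compact_metric m2"
proof -
  obtain f where f: "isometric_embedding m1 m2 f" "f ` mspace m1 = mspace m2"
    using assms(1) by (auto simp: isometric_def)
  interpret Metric_space12 "mspace m1" "mdist m1" "mspace m2" "mdist m2"
    by (simp add: Metric_space12_def)
  have "homeomorphic_map M1.mtopology M2.mtopology f"
    using f by (intro isometry_imp_homeomorphic_map) (auto simp: isometric_embedding_def)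
  then have "compact_space M2.mtopology"
    using assms(2) unfolding compact_metric_def mtopology_of_def
    by (metis homeomorphic_compact_space homeomorphic_map_imp_homeomorphic_space)
  then show ?thesis using f assms(2) by (auto simp: compact_metric_def mtopology_of_def)
qed

lemma compact_metric_bound:
  assumes "compact_metric m"
  obtains B where "B > 0" "\<And>x y. x \<in> mspace m \<Longrightarrow> y \<in> mspace m \<Longrightarrow> mdist m x y \<le> B"
proof -
  interpret Metric_space "mspace m" "mdist m" by simp
  have "compactin mtopology (mspace m)"
    using assms by (simp add: compact_metric_def mtopology_of_def compact_space_def)
  from compactin_imp_mbounded[OF this] show ?thesis
    unfolding mbounded_alt_pos using that by auto
qed

text \<open>Couplings: the distances between the points of two isometrically embedded spaces.\<close>

definition coupling :: "'a metric \<Rightarrow> 'b metric \<Rightarrow> ('a \<Rightarrow> 'b \<Rightarrow> real) \<Rightarrow> bool" where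
  "coupling m1 m2 c \<longleftrightarrow>
     (\<forall>x\<in>mspace m1. \<forall>y\<in>mspace m2. 0 \<le> c x y) \<and>
     (\<forall>x\<in>mspace m1. \<forall>x'\<in>mspace m1. \<forall>y\<in>mspace m2.
        c x y \<le> mdist m1 x x' + c x' y \<and> mdist m1 x x' \<le> c x y + c x' y) \<and>
     (\<forall>x\<in>mspace m1. \<forall>y\<in>mspace m2. \<forall>y'\<in>mspace m2.
        c x y \<le> c x y' + mdist m2 y' y \<and> mdist m2 y y' \<le> c x y + c x y')"

definition coupling_within :: "'a metric \<Rightarrow> 'b metric \<Rightarrow> ('a \<Rightarrow> 'b \<Rightarrow> real) \<Rightarrow> real \<Rightarrow> bool" where
  "coupling_within m1 m2 c r \<longleftrightarrow>
     (\<forall>x\<in>mspace m1. \<exists>y\<in>mspace m2. c x y < r) \<and> (\<forall>y\<in>mspace m2. \<exists>x\<in>mspace m1. c x y < r)"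

lemma hausdorff_dist_nonneg:
  assumes "compact_metric m1" "compact_metric m2"
    and "isometric_embedding m1 Z i" "isometric_embedding m2 Z j"
  shows "0 \<le> hausdorff_dist Z (i ` mspace m1) (j ` mspace m2)"
    and "bdd_above ((\<lambda>a. INF b\<in>j ` mspace m2. mdist Z a b) ` i ` mspace m1)"
    and "bdd_above ((\<lambda>b. INF a\<in>i ` mspace m1. mdist Z a b) ` j ` mspace m2)"
proof -
  let ?A = "i ` mspace m1" and ?B = "j ` mspace m2"
  have bb: "bdd_below ((\<lambda>b. mdist Z a b) ` S)" "bdd_below ((\<lambda>b. mdist Z b a) ` S)" for a S
    by (auto intro!: bdd_belowI[of _ 0])
  obtain x0 y0 where xy: "x0 \<in> mspace m1" "y0 \<in> mspace m2"
    using assms by (auto simp: compact_metric_def)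
  have mem: "\<And>x. x \<in> mspace m1 \<Longrightarrow> i x \<in> mspace Z" "\<And>y. y \<in> mspace m2 \<Longrightarrow> j y \<in> mspace Z"
    using assms by (auto simp: isometric_embedding_def)
  obtain B1 where B1: "\<And>x y. x \<in> mspace m1 \<Longrightarrow> y \<in> mspace m1 \<Longrightarrow> mdist m1 x y \<le> B1"
    using compact_metric_bound assms(1) by metis
  obtain B2 where B2: "\<And>x y. x \<in> mspace m2 \<Longrightarrow> y \<in> mspace m2 \<Longrightarrow> mdist m2 x y \<le> B2"
    using compact_metric_bound assms(2) by metis
  have "(INF b\<in>?B. mdist Z a b) \<le> B1 + mdist Z (i x0) (j y0)" if a: "a \<in> ?A" for a
  proof -
    obtain x where x: "a = i x" "x \<in> mspace m1" using a by auto
    have "(INF b\<in>?B. mdist Z a b) \<le> mdist Z a (j y0)"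
      using xy bb by (auto intro: cINF_lower)
    also have "\<dots> \<le> mdist Z (i x) (i x0) + mdist Z (i x0) (j y0)"
      using x xy mem by (auto intro: mdist_triangle)
    also have "mdist Z (i x) (i x0) \<le> B1"
      using x xy assms(3) B1 by (simp add: isometric_embedding_def)
    finally show ?thesis by simp
  qed
  then show 1: "bdd_above ((\<lambda>a. INF b\<in>?B. mdist Z a b) ` ?A)" by (auto intro!: bdd_aboveI)
  have "(INF a\<in>?A. mdist Z a b) \<le> B2 + mdist Z (i x0) (j y0)" if b: "b \<in> ?B" for b
  proof -
    obtain y where y: "b = j y" "y \<in> mspace m2" using b by auto
    have "(INF a\<in>?A. mdist Z a b) \<le> mdist Z (i x0) b"
      using xy bb by (auto intro: cINF_lower)
    also have "\<dots> \<le> mdist Z (i x0) (j y0) + mdist Z (j y0) (j y)"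
      using y xy mem by (auto intro: mdist_triangle)
    also have "mdist Z (j y0) (j y) \<le> B2"
      using y xy assms(4) B2 by (simp add: isometric_embedding_def)
    finally show ?thesis by simp
  qed
  then show 2: "bdd_above ((\<lambda>b. INF a\<in>?A. mdist Z a b) ` ?B)" by (auto intro!: bdd_aboveI)
  have "0 \<le> (INF b\<in>?B. mdist Z (i x0) b)" using xy by (intro cINF_greatest) auto
  also have "\<dots> \<le> (SUP a\<in>?A. INF b\<in>?B. mdist Z a b)" using xy by (intro cSUP_upper 1) auto
  finally show "0 \<le> hausdorff_dist Z ?A ?B" by (simp add: hausdorff_dist_def)
qed

lemma gh_dist_bdd_below:
  assumes "compact_metric m1" "compact_metric m2"
  shows "bdd_below {hausdorff_dist Z (i ` mspace m1) (j ` mspace m2) | (Z :: real metric) i j.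
     isometric_embedding m1 Z i \<and> isometric_embedding m2 Z j}"
  using hausdorff_dist_nonneg(1)[OF assms] by (auto intro!: bdd_belowI[of _ 0])

lemma coupling_realize:
  fixes m1 m2 :: "real metric"
  assumes c: "coupling m1 m2 c" and pos: "\<And>x y. x \<in> mspace m1 \<Longrightarrow> y \<in> mspace m2 \<Longrightarrow> 0 < c x y"
  obtains Z :: "real metric" and i j where
    "isometric_embedding m1 Z i" "isometric_embedding m2 Z j"
    "\<And>x y. x \<in> mspace m1 \<Longrightarrow> y \<in> mspace m2 \<Longrightarrow> mdist Z (i x) (j y) = c x y"
proof -
  define D where "D u v = (if 0 < u then (if 0 < v then mdist m1 (ln u) (ln v) else c (ln u) (ln (-v)))
     else if 0 < v then c (ln v) (ln (-u)) else mdist m2 (ln (-u)) (ln (-v)))" for u v :: real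
  define M where "M = exp ` mspace m1 \<union> (\<lambda>y. - exp y) ` mspace m2"
  have D1: "D (exp x) (exp x') = mdist m1 x x'" "D (exp x) (- exp y) = c x y"
     "D (- exp y) (exp x) = c x y" "D (- exp y) (- exp y') = mdist m2 y y'" for x x' y y'
    by (auto simp: D_def not_less order.strict_implies_order less_imp_le)
  have M: "u \<in> M \<longleftrightarrow> (\<exists>x\<in>mspace m1. u = exp x) \<or> (\<exists>y\<in>mspace m2. u = - exp y)" for u
    by (auto simp: M_def)
  have ne: "exp x \<noteq> - exp y" "- exp y \<noteq> exp x" for x y :: real
    by (metis exp_gt_zero less_asym neg_0_less_iff_less neg_less_0_iff_less)+
  define E where "E u v = (if u \<in> M \<and> v \<in> M then D u v else 0)" for u v
  have E: "E u v = D u v" if "u \<in> M" "v \<in> M" for u v using that by (simp add: E_def)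
  interpret Z: Metric_space M E
  proof
    fix u v w
    show "0 \<le> E u v" using c by (auto simp: E_def M D1 coupling_def)
    show "E u v = E v u" by (auto simp: E_def M D1 mdist_commute)
    show "E u v = 0 \<longleftrightarrow> u = v" if "u \<in> M" "v \<in> M"
      using that pos unfolding E[OF that] by (auto simp: M D1 ne) (metis less_irrefl)+
    show "E u w \<le> E u v + E v w" if uvw: "u \<in> M" "v \<in> M" "w \<in> M"
      unfolding E[OF uvw(1,3)] E[OF uvw(1,2)] E[OF uvw(2,3)]
    proof -
      note c' = c[unfolded coupling_def]
      have c1: "c x y \<le> mdist m1 x x' + c x' y" "mdist m1 x x' \<le> c x y + c x' y"
        if "x \<in> mspace m1" "x' \<in> mspace m1" "y \<in> mspace m2" for x x' y
        using c' that by blast+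
      have c2: "c x y \<le> c x y' + mdist m2 y' y" "mdist m2 y y' \<le> c x y + c x y'"
        if "x \<in> mspace m1" "y \<in> mspace m2" "y' \<in> mspace m2" for x y y'
        using c' that by blast+
      have t: "D (exp x) w \<le> D (exp x) v + D v w" if x: "x \<in> mspace m1" for x
        using uvw(2,3) x c1[OF x] c2[OF x] unfolding M
        by (elim disjE bexE) (simp_all add: D1 mdist_triangle add.commute mdist_commute)
      have t': "D (- exp y) w \<le> D (- exp y) v + D v w" if y: "y \<in> mspace m2" for y
        using uvw(2,3) y c1[OF _ _ y] c2[OF _ y] unfolding M
        by (elim disjE bexE) (simp_all add: D1 mdist_triangle add.commute mdist_commute)
      show "D u w \<le> D u v + D v w"
        using uvw(1) t t' unfolding M by blast
    qed
  qed
  have "exp x \<in> M" if "x \<in> mspace m1" for x using that by (auto simp: M)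
  moreover have "- exp y \<in> M" if "y \<in> mspace m2" for y using that by (auto simp: M)
  ultimately have "isometric_embedding m1 (metric (M, E)) exp"
    "isometric_embedding m2 (metric (M, E)) (\<lambda>y. - exp y)"
    "\<And>x y. x \<in> mspace m1 \<Longrightarrow> y \<in> mspace m2 \<Longrightarrow> mdist (metric (M, E)) (exp x) (- exp y) = c x y"
    by (simp_all add: isometric_embedding_def E D1)
  then show thesis by (rule that)
qed

lemma gh_dist_le:
  fixes m1 m2 :: "real metric"
  assumes m: "compact_metric m1" "compact_metric m2"
    and c: "coupling m1 m2 c" and r: "coupling_within m1 m2 c r"
  shows "gh_dist m1 m2 \<le> r"
proof (rule field_le_epsilon)
  fix e :: real assume e: "e > 0"
  let ?c = "\<lambda>x y. c x y + e"
  have "coupling m1 m2 ?c"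
    unfolding coupling_def
  proof (intro conjI ballI)
    fix x y assume xy: "x \<in> mspace m1" "y \<in> mspace m2"
    show "0 \<le> ?c x y" using c e xy unfolding coupling_def by (simp add: add_nonneg_nonneg)
    fix x' assume "x' \<in> mspace m1"
    then have "c x y \<le> mdist m1 x x' + c x' y" "mdist m1 x x' \<le> c x y + c x' y"
      using c xy unfolding coupling_def by blast+
    then show "?c x y \<le> mdist m1 x x' + ?c x' y" "mdist m1 x x' \<le> ?c x y + ?c x' y"
      using e by linarith+
  next
    fix x y y' assume "x \<in> mspace m1" "y \<in> mspace m2" "y' \<in> mspace m2"
    then have "c x y \<le> c x y' + mdist m2 y' y" "mdist m2 y y' \<le> c x y + c x y'"
      using c unfolding coupling_def by blast+
    then show "?c x y \<le> ?c x y' + mdist m2 y' y" "mdist m2 y y' \<le> ?c x y + ?c x y'"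
      using e by linarith+
  qed
  moreover have "\<And>x y. x \<in> mspace m1 \<Longrightarrow> y \<in> mspace m2 \<Longrightarrow> 0 < ?c x y"
    using c e unfolding coupling_def by (simp add: add_nonneg_pos)
  ultimately obtain Z :: "real metric" and i j where
    ij: "isometric_embedding m1 Z i" "isometric_embedding m2 Z j"
    and Z: "\<And>x y. x \<in> mspace m1 \<Longrightarrow> y \<in> mspace m2 \<Longrightarrow> mdist Z (i x) (j y) = ?c x y"
    using coupling_realize by blast
  have bb: "bdd_below ((\<lambda>b. mdist Z a b) ` S)" "bdd_below ((\<lambda>b. mdist Z b a) ` S)" for a S
    by (auto intro!: bdd_belowI[of _ 0])
  have "(SUP a\<in>i ` mspace m1. INF b\<in>j ` mspace m2. mdist Z a b) \<le> r + e"
  proof (rule cSUP_least)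
    fix a assume "a \<in> i ` mspace m1"
    then obtain x where x: "x \<in> mspace m1" "a = i x" by auto
    then obtain y where y: "y \<in> mspace m2" "c x y < r" using r by (auto simp: coupling_within_def)
    have "(INF b\<in>j ` mspace m2. mdist Z a b) \<le> mdist Z a (j y)"
      using y bb by (auto intro: cINF_lower)
    then show "(INF b\<in>j ` mspace m2. mdist Z a b) \<le> r + e" using x y Z by simp
  qed (use m in \<open>auto simp: compact_metric_def\<close>)
  moreover have "(SUP b\<in>j ` mspace m2. INF a\<in>i ` mspace m1. mdist Z a b) \<le> r + e"
  proof (rule cSUP_least)
    fix b assume "b \<in> j ` mspace m2"
    then obtain y where y: "y \<in> mspace m2" "b = j y" by auto
    then obtain x where x: "x \<in> mspace m1" "c x y < r" using r by (auto simp: coupling_within_def)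
    have "(INF a\<in>i ` mspace m1. mdist Z a b) \<le> mdist Z (i x) b"
      using x bb by (auto intro: cINF_lower)
    then show "(INF a\<in>i ` mspace m1. mdist Z a b) \<le> r + e" using x y Z by simp
  qed (use m in \<open>auto simp: compact_metric_def\<close>)
  ultimately have "hausdorff_dist Z (i ` mspace m1) (j ` mspace m2) \<le> r + e"
    by (simp add: hausdorff_dist_def)
  moreover have "gh_dist m1 m2 \<le> hausdorff_dist Z (i ` mspace m1) (j ` mspace m2)"
    unfolding gh_dist_def using ij by (intro cInf_lower gh_dist_bdd_below m) auto
  ultimately show "gh_dist m1 m2 \<le> r + e" by simp
qed

lemma gh_dist_set_nonempty:
  fixes m1 m2 :: "real metric"
  assumes m: "compact_metric m1" "compact_metric m2"
  shows "{hausdorff_dist Z (i ` mspace m1) (j ` mspace m2) | (Z :: real metric) i j.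
     isometric_embedding m1 Z i \<and> isometric_embedding m2 Z j} \<noteq> {}"
proof -
  obtain B1 where B1: "B1 > 0" "\<And>x y. x \<in> mspace m1 \<Longrightarrow> y \<in> mspace m1 \<Longrightarrow> mdist m1 x y \<le> B1"
    using compact_metric_bound assms(1) by metis
  obtain B2 where B2: "B2 > 0" "\<And>x y. x \<in> mspace m2 \<Longrightarrow> y \<in> mspace m2 \<Longrightarrow> mdist m2 x y \<le> B2"
    using compact_metric_bound assms(2) by metis
  have "coupling m1 m2 (\<lambda>x y. B1 + B2)"
    unfolding coupling_def
  proof (intro conjI ballI)
    fix x x' assume "x \<in> mspace m1" "x' \<in> mspace m1"
    then show "mdist m1 x x' \<le> B1 + B2 + (B1 + B2)" using B1(1) B1(2)[of x x'] B2(1) by linarith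
  next
    fix y y' assume "y \<in> mspace m2" "y' \<in> mspace m2"
    then show "mdist m2 y y' \<le> B1 + B2 + (B1 + B2)" using B2(1) B2(2)[of y y'] B1(1) by linarith
  qed (use B1(1) B2(1) in simp_all)
  moreover have "0 < B1 + B2" using B1(1) B2(1) by simp
  ultimately obtain Z :: "real metric" and i j
    where "isometric_embedding m1 Z i" "isometric_embedding m2 Z j"
    using coupling_realize by metis
  then show ?thesis by blast
qed

lemma gh_dist_nonneg:
  fixes m1 m2 :: "real metric"
  assumes m: "compact_metric m1" "compact_metric m2"
  shows "0 \<le> gh_dist m1 m2"
  unfolding gh_dist_def
  by (rule cInf_greatest[OF gh_dist_set_nonempty[OF m]]) (use hausdorff_dist_nonneg(1)[OF m] in auto)

lemma gh_dist_less_imp_coupling: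
  fixes m1 m2 :: "real metric"
  assumes m: "compact_metric m1" "compact_metric m2" and r: "gh_dist m1 m2 < r"
  obtains c where "coupling m1 m2 c" "coupling_within m1 m2 c r"
proof -
  from cInf_lessD[OF gh_dist_set_nonempty[OF m] r[unfolded gh_dist_def]]
  obtain Z :: "real metric" and i j where
    ij: "isometric_embedding m1 Z i" "isometric_embedding m2 Z j"
    and lt: "hausdorff_dist Z (i ` mspace m1) (j ` mspace m2) < r" by auto
  let ?A = "i ` mspace m1" and ?B = "j ` mspace m2"
  let ?c = "\<lambda>x y. mdist Z (i x) (j y)"
  have mem: "\<And>x. x \<in> mspace m1 \<Longrightarrow> i x \<in> mspace Z" "\<And>y. y \<in> mspace m2 \<Longrightarrow> j y \<in> mspace Z"
    using ij by (auto simp: isometric_embedding_def)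
  have 1: "coupling m1 m2 ?c"
  proof -
    have "?c x y \<le> mdist m1 x x' + ?c x' y" "mdist m1 x x' \<le> ?c x y + ?c x' y"
      if "x \<in> mspace m1" "x' \<in> mspace m1" "y \<in> mspace m2" for x x' y
      using that ij mem mdist_triangle[of "i x" Z "i x'" "j y"] mdist_triangle[of "i x" Z "j y" "i x'"]
      by (auto simp: isometric_embedding_def mdist_commute)
    moreover have "?c x y \<le> ?c x y' + mdist m2 y' y" "mdist m2 y y' \<le> ?c x y + ?c x y'"
      if "x \<in> mspace m1" "y \<in> mspace m2" "y' \<in> mspace m2" for x y y'
      using that ij mem mdist_triangle[of "i x" Z "j y'" "j y"] mdist_triangle[of "j y" Z "i x" "j y'"]
      by (auto simp: isometric_embedding_def mdist_commute)
    ultimately show ?thesis unfolding coupling_def by simp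
  qed
  note bdd = hausdorff_dist_nonneg(2,3)[OF m ij]
  have ne: "?A \<noteq> {}" "?B \<noteq> {}" using m by (auto simp: compact_metric_def)
  have "\<exists>y\<in>mspace m2. ?c x y < r" if "x \<in> mspace m1" for x
  proof -
    have "(INF b\<in>?B. mdist Z (i x) b) \<le> (SUP a\<in>?A. INF b\<in>?B. mdist Z a b)"
      using that by (intro cSUP_upper bdd) auto
    also have "\<dots> < r" using lt by (simp add: hausdorff_dist_def)
    finally have "\<exists>z\<in>mdist Z (i x) ` ?B. z < r" using ne by (intro cInf_lessD) auto
    then show ?thesis by auto
  qed
  moreover have "\<exists>x\<in>mspace m1. ?c x y < r" if "y \<in> mspace m2" for y
  proof -
    have "(INF a\<in>?A. mdist Z a (j y)) \<le> (SUP b\<in>?B. INF a\<in>?A. mdist Z a b)"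
      using that by (intro cSUP_upper bdd) auto
    also have "\<dots> < r" using lt by (simp add: hausdorff_dist_def)
    finally have "\<exists>z\<in>(\<lambda>a. mdist Z a (j y)) ` ?A. z < r" using ne by (intro cInf_lessD) auto
    then show ?thesis by auto
  qed
  ultimately show thesis using that 1 by (auto simp: coupling_within_def)
qed

lemma gh_dist_cong:
  assumes "isometric m1 m1'" "isometric m2 m2'"
  shows "gh_dist m1 m2 = gh_dist m1' m2'"
proof -
  let ?S = "\<lambda>m1 m2. {hausdorff_dist Z (i ` mspace m1) (j ` mspace m2) | (Z :: real metric) i j.
     isometric_embedding m1 Z i \<and> isometric_embedding m2 Z j}"
  have "?S m1' m2' \<subseteq> ?S m1 m2" if iso: "isometric m1 m1'" "isometric m2 m2'"
    for m1 :: "'x metric" and m2 :: "'y metric" and m1' :: "'z metric" and m2' :: "'w metric"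
  proof -
    obtain f g where fg: "isometric_embedding m1 m1' f" "f ` mspace m1 = mspace m1'"
      "isometric_embedding m2 m2' g" "g ` mspace m2 = mspace m2'"
      using iso by (auto simp: isometric_def)
    show ?thesis
    proof clarify
      fix Z :: "real metric" and i j
      assume ij: "isometric_embedding m1' Z i" "isometric_embedding m2' Z j"
      show "\<exists>Z' i' j'. hausdorff_dist Z (i ` mspace m1') (j ` mspace m2') =
          hausdorff_dist Z' (i' ` mspace m1) (j' ` mspace m2) \<and>
          isometric_embedding m1 (Z' :: real metric) i' \<and> isometric_embedding m2 Z' j'"
        using ij isometric_embedding_compose[OF fg(1) ij(1)] isometric_embedding_compose[OF fg(3) ij(2)]
        unfolding fg(2)[symmetric] fg(4)[symmetric] image_comp by blast
    qed
  qed
  from this[OF assms] this[OF assms[THEN isometric_sym]] show ?thesis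
    unfolding gh_dist_def by simp
qed

lemma gh_dist_self:
  fixes m :: "real metric"
  assumes "compact_metric m"
  shows "gh_dist m m = 0"
proof (rule antisym)
  show "gh_dist m m \<le> 0"
  proof (rule field_le_epsilon)
    fix e :: real assume "e > 0"
    have "coupling m m (mdist m)"
      unfolding coupling_def
    proof (intro conjI ballI)
      fix x x' y assume "x \<in> mspace m" "x' \<in> mspace m" "y \<in> mspace m"
      then show "mdist m x x' \<le> mdist m x y + mdist m x' y"
        using mdist_triangle[of x m y x'] by (simp add: mdist_commute)
    next
      fix x y y' assume "x \<in> mspace m" "y \<in> mspace m" "y' \<in> mspace m"
      then show "mdist m x y \<le> mdist m x y' + mdist m y' y" "mdist m y y' \<le> mdist m x y + mdist m x y'"
        using mdist_triangle[of x m y' y] mdist_triangle[of y m x y'] by (simp_all add: mdist_commute)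
    qed (auto simp: mdist_triangle)
    moreover have "coupling_within m m (mdist m) e"
      using \<open>e > 0\<close> unfolding coupling_within_def by (metis mdist_zero)
    ultimately show "gh_dist m m \<le> 0 + e" using gh_dist_le[OF assms assms] by simp
  qed
qed (rule gh_dist_nonneg[OF assms assms])

lemma gh_dist_commute: "gh_dist m1 m2 = gh_dist m2 m1"
proof -
  have "hausdorff_dist Z A B = hausdorff_dist Z B A" for Z :: "real metric" and A B
    by (simp add: hausdorff_dist_def max.commute mdist_commute)
  then show ?thesis unfolding gh_dist_def by (intro arg_cong[where f = Inf]) blast
qed

lemma gh_dist_triangle:
  fixes m1 m2 m3 :: "real metric"
  assumes m: "compact_metric m1" "compact_metric m2" "compact_metric m3"
  shows "gh_dist m1 m3 \<le> gh_dist m1 m2 + gh_dist m2 m3"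
proof (rule field_le_epsilon)
  fix e :: real assume e: "e > 0"
  obtain c where c: "coupling m1 m2 c" "coupling_within m1 m2 c (gh_dist m1 m2 + e / 2)"
    using gh_dist_less_imp_coupling[OF m(1,2), of "gh_dist m1 m2 + e / 2"] e by auto
  obtain d where d: "coupling m2 m3 d" "coupling_within m2 m3 d (gh_dist m2 m3 + e / 2)"
    using gh_dist_less_imp_coupling[OF m(2,3), of "gh_dist m2 m3 + e / 2"] e by auto
  define h where "h x z = (INF y\<in>mspace m2. c x y + d y z)" for x z
  have ne: "mspace m2 \<noteq> {}" using m by (simp add: compact_metric_def)
  have lo: "h x z \<le> c x y + d y z" if "x \<in> mspace m1" "y \<in> mspace m2" "z \<in> mspace m3" for x y z
    unfolding h_def using that c(1) d(1)
    by (intro cINF_lower bdd_belowI[of _ 0]) (auto simp: coupling_def)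
  have gr: "k \<le> h x z" if "\<And>y. y \<in> mspace m2 \<Longrightarrow> k \<le> c x y + d y z" for k x z
    unfolding h_def using that ne by (intro cINF_greatest) auto
  have c0: "0 \<le> c x y" "c x y \<le> mdist m1 x x' + c x' y" "mdist m1 x x' \<le> c x y + c x' y"
     "c x y \<le> c x y' + mdist m2 y' y" "mdist m2 y y' \<le> c x y + c x y'"
    if "x \<in> mspace m1" "x' \<in> mspace m1" "y \<in> mspace m2" "y' \<in> mspace m2" for x x' y y'
    using c(1) that unfolding coupling_def by auto
  have d0: "0 \<le> d x y" "d x y \<le> mdist m2 x x' + d x' y" "mdist m2 x x' \<le> d x y + d x' y"
     "d x y \<le> d x y' + mdist m3 y' y" "mdist m3 y y' \<le> d x y + d x y'"
    if "x \<in> mspace m2" "x' \<in> mspace m2" "y \<in> mspace m3" "y' \<in> mspace m3" for x x' y y'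
    using d(1) that unfolding coupling_def by auto
  have "coupling m1 m3 h"
    unfolding coupling_def
  proof (intro conjI ballI)
    fix x z assume x: "x \<in> mspace m1" and z: "z \<in> mspace m3"
    show "0 \<le> h x z" using c0(1) d0(1) x z by (intro gr add_nonneg_nonneg) auto
    fix x' assume x': "x' \<in> mspace m1"
    have "h x z - mdist m1 x x' \<le> h x' z"
    proof (rule gr)
      fix y assume y: "y \<in> mspace m2"
      show "h x z - mdist m1 x x' \<le> c x' y + d y z"
        using lo[OF x y z] c0(2)[OF x x' y y] by simp
    qed
    then show "h x z \<le> mdist m1 x x' + h x' z" by simp
    have "mdist m1 x x' - h x z \<le> h x' z"
    proof (rule gr)
      fix y assume y: "y \<in> mspace m2"
      have "mdist m1 x x' - (c x' y + d y z) \<le> h x z"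
      proof (rule gr)
        fix w assume w: "w \<in> mspace m2"
        show "mdist m1 x x' - (c x' y + d y z) \<le> c x w + d w z"
          using c0(3)[OF x x' w w] c0(4)[OF x' x' w y] d0(3)[OF y w z z] by simp
      qed
      then show "mdist m1 x x' - h x z \<le> c x' y + d y z" by simp
    qed
    then show "mdist m1 x x' \<le> h x z + h x' z" by simp
  next
    fix x z z' assume x: "x \<in> mspace m1" and z: "z \<in> mspace m3" and z': "z' \<in> mspace m3"
    have "h x z - mdist m3 z' z \<le> h x z'"
    proof (rule gr)
      fix y assume y: "y \<in> mspace m2"
      show "h x z - mdist m3 z' z \<le> c x y + d y z'"
        using lo[OF x y z] d0(4)[OF y y z z'] by simp
    qed
    then show "h x z \<le> h x z' + mdist m3 z' z" by simp
    have "mdist m3 z z' - h x z \<le> h x z'"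
    proof (rule gr)
      fix y assume y: "y \<in> mspace m2"
      have "mdist m3 z z' - (c x y + d y z') \<le> h x z"
      proof (rule gr)
        fix w assume w: "w \<in> mspace m2"
        show "mdist m3 z z' - (c x y + d y z') \<le> c x w + d w z"
          using d0(5)[OF w w z z'] d0(2)[OF w y z' z'] c0(5)[OF x x w y] by simp
      qed
      then show "mdist m3 z z' - h x z \<le> c x y + d y z'" by simp
    qed
    then show "mdist m3 z z' \<le> h x z + h x z'" by simp
  qed
  moreover have "coupling_within m1 m3 h (gh_dist m1 m2 + gh_dist m2 m3 + e)"
    unfolding coupling_within_def
  proof (intro conjI ballI)
    fix x assume x: "x \<in> mspace m1"
    obtain y where y: "y \<in> mspace m2" "c x y < gh_dist m1 m2 + e / 2"
      using c(2) x by (auto simp: coupling_within_def)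
    obtain z where z: "z \<in> mspace m3" "d y z < gh_dist m2 m3 + e / 2"
      using d(2) y by (auto simp: coupling_within_def)
    show "\<exists>z\<in>mspace m3. h x z < gh_dist m1 m2 + gh_dist m2 m3 + e"
      using lo[OF x y(1) z(1)] y z by (intro bexI[of _ z]) auto
  next
    fix z assume z: "z \<in> mspace m3"
    obtain y where y: "y \<in> mspace m2" "d y z < gh_dist m2 m3 + e / 2"
      using d(2) z by (auto simp: coupling_within_def)
    obtain x where x: "x \<in> mspace m1" "c x y < gh_dist m1 m2 + e / 2"
      using c(2) y by (auto simp: coupling_within_def)
    show "\<exists>x\<in>mspace m1. h x z < gh_dist m1 m2 + gh_dist m2 m3 + e"
      using lo[OF x(1) y(1) z] y x by (intro bexI[of _ x]) auto
  qed
  ultimately show "gh_dist m1 m3 \<le> gh_dist m1 m2 + gh_dist m2 m3 + e"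
    by (rule gh_dist_le[OF m(1,3)])
qed

lemma gh_dist_zero_imp_isometric:
  fixes m1 m2 :: "real metric"
  assumes m: "compact_metric m1" "compact_metric m2" and z: "gh_dist m1 m2 = 0"
  shows "isometric m1 m2"
proof -
  let ?I = "Inl ` mspace m1 \<union> Inr ` mspace m2 :: (real + real) set"
  let ?T = "\<lambda>i :: real + real. case i of Inl x \<Rightarrow> mtopology_of m2 | Inr y \<Rightarrow> mtopology_of m1"
  let ?P = "product_topology ?T ?I"
  define S where "S n x y = {F \<in> topspace ?P. \<bar>mdist m2 y (F (Inl x)) - mdist m1 (F (Inr y)) x\<bar> \<le> 2 / Suc n}"
    for n :: nat and x y
  define K where "K n = topspace ?P \<inter> (\<Inter>x\<in>mspace m1. \<Inter>y\<in>mspace m2. S n x y)" for n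
  have cp: "compact_space ?P"
    using m by (auto simp: compact_space_product_topology compact_metric_def)
  have closed: "closedin ?P (S n x y)" if "x \<in> mspace m1" "y \<in> mspace m2" for n x y
  proof -
    have "continuous_map ?P (mtopology_of m2) (\<lambda>F. F (Inl x))"
      using continuous_map_product_projection[of "Inl x" ?I ?T] that by simp
    then have 1: "continuous_map ?P euclideanreal (\<lambda>F. mdist m2 y (F (Inl x)))"
      using that by (intro continuous_map_mdist) auto
    have "continuous_map ?P (mtopology_of m1) (\<lambda>F. F (Inr y))"
      using continuous_map_product_projection[of "Inr y" ?I ?T] that by simp
    then have 2: "continuous_map ?P euclideanreal (\<lambda>F. mdist m1 (F (Inr y)) x)"
      using that by (intro continuous_map_mdist) auto
    have "continuous_map ?P euclideanreal (\<lambda>F. \<bar>mdist m2 y (F (Inl x)) - mdist m1 (F (Inr y)) x\<bar>)"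
      by (intro continuous_map_real_abs continuous_map_diff 1 2)
    from closedin_continuous_map_preimage[OF this, of "{..2 / Suc n}"]
    show ?thesis by (simp add: S_def)
  qed
  have cK: "closedin ?P (K n)" for n
    unfolding K_def using closed m
    by (intro closedin_Int closedin_topspace closedin_INT) (auto simp: compact_metric_def)
  have neK: "K n \<noteq> {}" for n
  proof -
    have "gh_dist m1 m2 < 1 / Suc n" using z by simp
    then obtain c where c: "coupling m1 m2 c" "coupling_within m1 m2 c (1 / Suc n)"
      using gh_dist_less_imp_coupling[OF m] by blast
    obtain f where f: "\<And>x. x \<in> mspace m1 \<Longrightarrow> f x \<in> mspace m2 \<and> c x (f x) < 1 / Suc n"
      using c(2) unfolding coupling_within_def by metis
    obtain g where g: "\<And>y. y \<in> mspace m2 \<Longrightarrow> g y \<in> mspace m1 \<and> c (g y) y < 1 / Suc n"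
      using c(2) unfolding coupling_within_def by metis
    define F where "F = restrict (case_sum f g) ?I"
    have F: "F \<in> topspace ?P" using f g by (auto simp: F_def)
    have "F \<in> S n x y" if "x \<in> mspace m1" "y \<in> mspace m2" for x y
    proof -
      have "c x y \<le> mdist m1 x (g y) + c (g y) y" "mdist m1 x (g y) \<le> c x y + c (g y) y"
           "c x y \<le> c x (f x) + mdist m2 (f x) y" "mdist m2 y (f x) \<le> c x y + c x (f x)"
        using c(1) that f g unfolding coupling_def by auto
      moreover have "c x (f x) < 1 / Suc n" "c (g y) y < 1 / Suc n" using f g that by auto
      ultimately have "\<bar>mdist m2 y (f x) - mdist m1 (g y) x\<bar> \<le> 2 / Suc n"
        by (simp add: mdist_commute[of m2 "f x"] mdist_commute[of m1 "g y"])
      then show ?thesis using F that by (simp add: S_def F_def)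
    qed
    then show ?thesis using F unfolding K_def by blast
  qed
  have "decseq K"
  proof (rule decseq_SucI, rule subsetI)
    fix n F assume F: "F \<in> K (Suc n)"
    have "(2::real) / Suc (Suc n) \<le> 2 / Suc n" by (intro divide_left_mono) auto
    then have "S (Suc n) x y \<subseteq> S n x y" for x y unfolding S_def by force
    then show "F \<in> K n" using F unfolding K_def by blast
  qed
  from compact_space_imp_nest[OF cp cK neK this] obtain F where FK: "\<And>n. F \<in> K n" by blast
  let ?f = "\<lambda>x. F (Inl x)" and ?g = "\<lambda>y. F (Inr y)"
  have F: "F \<in> topspace ?P" using FK[of 0] by (simp add: K_def)
  have f: "?f x \<in> mspace m2" if "x \<in> mspace m1" for x
    using F that by (auto simp: PiE_iff dest: bspec[of _ _ "Inl x"])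
  have g: "?g y \<in> mspace m1" if "y \<in> mspace m2" for y
    using F that by (auto simp: PiE_iff dest: bspec[of _ _ "Inr y"])
  have eq: "mdist m2 y (?f x) = mdist m1 (?g y) x" if "x \<in> mspace m1" "y \<in> mspace m2" for x y
  proof (rule ccontr)
    let ?d = "\<bar>mdist m2 y (?f x) - mdist m1 (?g y) x\<bar>"
    assume "mdist m2 y (?f x) \<noteq> mdist m1 (?g y) x"
    then have "?d / 2 > 0" by simp
    then obtain n where "1 / Suc n < ?d / 2" by (rule nat_approx_posE)
    moreover have "?d \<le> 2 / Suc n" using FK[of n] that unfolding K_def S_def by auto
    ultimately show False by (simp add: field_simps)
  qed
  have gf: "?g (?f x) = x" if "x \<in> mspace m1" for x
    using eq[OF that f[OF that]] f g that by (metis mdist_zero)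
  have fg: "?f (?g y) = y" if "y \<in> mspace m2" for y
    using eq[OF g[OF that] that] f g that by (metis mdist_zero)
  have "isometric_embedding m1 m2 ?f"
    unfolding isometric_embedding_def using eq f gf by auto
  moreover have "?f ` mspace m1 = mspace m2" using f g fg by force
  ultimately show ?thesis unfolding isometric_def by blast
qed


section \<open>The Gromov--Hausdorff space\<close>

definition gh_rel :: "real metric \<Rightarrow> real metric \<Rightarrow> bool" where
  "gh_rel m1 m2 \<longleftrightarrow> compact_metric m1 \<and> compact_metric m2 \<and> isometric m1 m2"

lemma part_equivp_gh_rel: "part_equivp gh_rel"
proof (rule part_equivpI)
  interpret Metric_space "{0 :: real}" dist by unfold_locales (auto simp: dist_commute dist_triangle)
  have "compact_metric (metric ({0 :: real}, dist))"
    by (simp add: compact_metric_def compact_space_def finite_imp_compactin)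
  then show "\<exists>m. gh_rel m m" unfolding gh_rel_def using isometric_refl by blast
  show "symp gh_rel" unfolding gh_rel_def by (auto intro!: sympI isometric_sym)
  show "transp gh_rel" unfolding gh_rel_def by (auto intro!: transpI intro: isometric_trans)
qed

text \<open>
  The isometry classes of non-empty compact metric spaces. Representatives are carried by sets of
  reals, which is no restriction by \<open>isometric_real_metric\<close>; for a compact \<open>m :: real metric\<close>, its
  isometry class is \<open>abs_ghspace m\<close>.
\<close>

quotient_type ghspace = "real metric" / partial: gh_rel
  morphisms rep_ghspace abs_ghspace
  by (rule part_equivp_gh_rel)

instantiation ghspace :: metric_space
begin

lift_definition dist_ghspace :: "ghspace \<Rightarrow> ghspace \<Rightarrow> real" is gh_dist
  by (auto simp: gh_rel_def intro: gh_dist_cong)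

definition uniformity_ghspace :: "(ghspace \<times> ghspace) filter" where
  "uniformity_ghspace = (INF e\<in>{0<..}. principal {(x, y). dist x y < e})"

definition open_ghspace :: "ghspace set \<Rightarrow> bool" where
  "open_ghspace U \<longleftrightarrow> (\<forall>x\<in>U. eventually (\<lambda>(x', y). x' = x \<longrightarrow> y \<in> U) uniformity)"

instance
proof
  fix x y z :: ghspace and U :: "ghspace set"
  show "dist x y = 0 \<longleftrightarrow> x = y"
  proof transfer
    fix m1 m2 assume "gh_rel m1 m1" "gh_rel m2 m2"
    then have c: "compact_metric m1" "compact_metric m2" by (auto simp: gh_rel_def)
    have "gh_dist m1 m2 = 0" if "isometric m1 m2"
      using gh_dist_cong[OF isometric_refl[of m1] that] gh_dist_self[OF c(1)] by simp
    then show "(gh_dist m1 m2 = 0) = gh_rel m1 m2"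
      using c gh_dist_zero_imp_isometric by (auto simp: gh_rel_def)
  qed
  show "dist x y \<le> dist x z + dist y z"
  proof transfer
    fix m1 m2 m3 assume "gh_rel m1 m1" "gh_rel m2 m2" "gh_rel m3 m3"
    then show "gh_dist m1 m2 \<le> gh_dist m1 m3 + gh_dist m2 m3"
      using gh_dist_triangle[of m1 m3 m2] by (simp add: gh_rel_def gh_dist_commute[of m3 m2])
  qed
qed (rule uniformity_ghspace_def open_ghspace_def)+

end

section \<open>Classes of compact metric spaces\<close>

definition N_doubling :: "nat \<Rightarrow> 'a metric \<Rightarrow> bool" where
  "N_doubling N m \<longleftrightarrow> (\<forall>x\<in>mspace m. \<forall>r>0. \<exists>F. F \<subseteq> mspace m \<and> finite F \<and> card F \<le> N \<and>
     mcball_of m x r \<subseteq> (\<Union>y\<in>F. mcball_of m y (r / 2)))"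

definition doubling :: "'a metric \<Rightarrow> bool" where
  "doubling m \<longleftrightarrow> (\<exists>N. N_doubling N m)"

definition delta_uniformly_disconnected :: "real \<Rightarrow> 'a metric \<Rightarrow> bool" where
  "delta_uniformly_disconnected \<delta> m \<longleftrightarrow> (\<forall>N. \<forall>z :: nat \<Rightarrow> 'a.
     (\<forall>i\<in>{1..N}. z i \<in> mspace m) \<and> (\<exists>i\<in>{1..N}. \<exists>j\<in>{1..N}. z i \<noteq> z j) \<longrightarrow>
     \<delta> * mdist m (z 1) (z N) \<le> (MAX i\<in>{1..N - 1}. mdist m (z i) (z (i + 1))))"

definition uniformly_disconnected :: "'a metric \<Rightarrow> bool" where
  "uniformly_disconnected m \<longleftrightarrow> (\<exists>\<delta>>0. delta_uniformly_disconnected \<delta> m)"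

definition mdiameter :: "'a metric \<Rightarrow> real" where
  "mdiameter m = (SUP (x, y)\<in>mspace m \<times> mspace m. mdist m x y)"

definition c_uniformly_perfect :: "real \<Rightarrow> 'a metric \<Rightarrow> bool" where
  "c_uniformly_perfect c m \<longleftrightarrow> (\<forall>x\<in>mspace m. \<forall>r\<in>{0<..<mdiameter m}. \<exists>y\<in>mspace m.
     c * r \<le> mdist m x y \<and> mdist m x y \<le> r)"

definition uniformly_perfect :: "'a metric \<Rightarrow> bool" where
  "uniformly_perfect m \<longleftrightarrow> (\<exists>c\<in>{0<..<1}. c_uniformly_perfect c m)"

definition cantor_set :: "real set" where
  "cantor_set = {x. \<exists>a. (\<forall>n. a n \<in> {0, 2}) \<and> (\<lambda>n. a n / 3 ^ Suc n) sums x}"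

definition cantor_metric :: "'a metric \<Rightarrow> bool" where
  "cantor_metric m \<longleftrightarrow> mtopology_of m homeomorphic_space top_of_set cantor_set"

lemma doubling_isometric:
  assumes "isometric m1 m2" "doubling m1"
  shows "doubling m2"
proof -
  obtain f where f: "isometric_embedding m1 m2 f" "f ` mspace m1 = mspace m2"
    using assms(1) by (auto simp: isometric_def)
  obtain N where N: "N_doubling N m1" using assms(2) by (auto simp: doubling_def)
  have "\<exists>G. G \<subseteq> mspace m2 \<and> finite G \<and> card G \<le> N \<and>
     mcball_of m2 x r \<subseteq> (\<Union>y\<in>G. mcball_of m2 y (r / 2))" if x: "x \<in> mspace m2" and r: "r > 0" for x r
  proof -
    obtain x' where x': "x' \<in> mspace m1" "x = f x'" using x f(2) by blast
    obtain F where F: "F \<subseteq> mspace m1" "finite F" "card F \<le> N"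
      "mcball_of m1 x' r \<subseteq> (\<Union>y\<in>F. mcball_of m1 y (r / 2))"
      using N[unfolded N_doubling_def, rule_format, OF x'(1) r] by auto
    have "mcball_of m2 x r \<subseteq> (\<Union>y\<in>f ` F. mcball_of m2 y (r / 2))"
    proof
      fix w assume w: "w \<in> mcball_of m2 x r"
      then have "w \<in> f ` mspace m1" unfolding f(2) by simp
      then obtain w' where w': "w' \<in> mspace m1" "w = f w'" by blast
      have "w' \<in> mcball_of m1 x' r"
        using w w' x' isometric_embedding_mdist[OF f(1) x'(1) w'(1)] by simp
      then obtain y where y: "y \<in> F" "w' \<in> mcball_of m1 y (r / 2)" using F(4) by blast
      have y1: "y \<in> mspace m1" using y F by blast
      have "f w' \<in> mcball_of m2 (f y) (r / 2)"
        using y w' isometric_embedding_mdist[OF f(1) y1 w'(1)] isometric_embedding_mem[OF f(1)] y1 by simp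
      then show "w \<in> (\<Union>y\<in>f ` F. mcball_of m2 y (r / 2))" using y w' by blast
    qed
    moreover have "f ` F \<subseteq> mspace m2" using F(1) isometric_embedding_mem[OF f(1)] by blast
    moreover have "card (f ` F) \<le> N" using card_image_le[OF F(2), of f] F(3) by simp
    ultimately show ?thesis using F(2) by (intro exI[of _ "f ` F"] conjI finite_imageI)
  qed
  then have "N_doubling N m2" unfolding N_doubling_def by simp
  then show ?thesis unfolding doubling_def by blast
qed

lemma uniformly_disconnected_isometric:
  assumes "isometric m1 m2" "uniformly_disconnected m1"
  shows "uniformly_disconnected m2"
proof -
  obtain g where g: "isometric_embedding m2 m1 g"
    using isometric_sym[OF assms(1)] by (auto simp: isometric_def)
  obtain \<delta> where \<delta>: "\<delta> > 0" "delta_uniformly_disconnected \<delta> m1"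
    using assms(2) by (auto simp: uniformly_disconnected_def)
  have "\<delta> * mdist m2 (z 1) (z N) \<le> (MAX i\<in>{1..N - 1}. mdist m2 (z i) (z (i + 1)))"
    if z: "\<forall>i\<in>{1..N}. z i \<in> mspace m2" "\<exists>i\<in>{1..N}. \<exists>j\<in>{1..N}. z i \<noteq> z j" for N :: nat and z
  proof -
    obtain i j where ij: "i \<in> {1..N}" "j \<in> {1..N}" "z i \<noteq> z j" using z(2) by blast
    have N: "1 \<le> N" using ij(1) by (auto intro: order_trans)
    have "g (z i) \<noteq> g (z j)"
      using inj_onD[OF isometric_embedding_inj_on[OF g], of "z i" "z j"] ij z(1) by blast
    then have "\<exists>i\<in>{1..N}. \<exists>j\<in>{1..N}. g (z i) \<noteq> g (z j)" using ij by blast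
    moreover have "\<forall>i\<in>{1..N}. g (z i) \<in> mspace m1" using z(1) isometric_embedding_mem[OF g] by blast
    ultimately have "\<delta> * mdist m1 (g (z 1)) (g (z N)) \<le> (MAX i\<in>{1..N - 1}. mdist m1 (g (z i)) (g (z (i + 1))))"
      using \<delta>(2)[unfolded delta_uniformly_disconnected_def, rule_format, of N "\<lambda>i. g (z i)"] by simp
    moreover have "mdist m1 (g (z 1)) (g (z N)) = mdist m2 (z 1) (z N)"
      using z(1) N by (intro isometric_embedding_mdist[OF g]) auto
    moreover have "(\<lambda>i. mdist m1 (g (z i)) (g (z (i + 1)))) ` {1..N - 1} =
        (\<lambda>i. mdist m2 (z i) (z (i + 1))) ` {1..N - 1}"
      using z(1) by (intro image_cong isometric_embedding_mdist[OF g]) auto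
    ultimately show ?thesis by simp
  qed
  then have "delta_uniformly_disconnected \<delta> m2" unfolding delta_uniformly_disconnected_def by simp
  then show ?thesis using \<delta>(1) unfolding uniformly_disconnected_def by blast
qed

lemma mdiameter_isometric:
  assumes "isometric m1 m2"
  shows "mdiameter m1 = mdiameter m2"
proof -
  obtain f where f: "isometric_embedding m1 m2 f" "f ` mspace m1 = mspace m2"
    using assms(1) by (auto simp: isometric_def)
  have "(\<lambda>(x, y). mdist m2 x y) ` (mspace m2 \<times> mspace m2) =
      (\<lambda>(x, y). mdist m2 x y) ` (map_prod f f ` (mspace m1 \<times> mspace m1))"
    by (simp only: map_prod_surj_on[OF f(2) f(2)])
  also have "\<dots> = (\<lambda>p. mdist m2 (f (fst p)) (f (snd p))) ` (mspace m1 \<times> mspace m1)"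
    by (simp only: image_image split_beta fst_map_prod snd_map_prod)
  also have "\<dots> = (\<lambda>(x, y). mdist m1 x y) ` (mspace m1 \<times> mspace m1)"
    by (rule image_cong) (auto simp only: isometric_embedding_mdist[OF f(1)] split_beta mem_Times_iff)
  finally show ?thesis unfolding mdiameter_def by simp
qed

lemma uniformly_perfect_isometric:
  assumes "isometric m1 m2" "uniformly_perfect m1"
  shows "uniformly_perfect m2"
proof -
  obtain f where f: "isometric_embedding m1 m2 f" "f ` mspace m1 = mspace m2"
    using assms(1) by (auto simp: isometric_def)
  obtain c where c: "c \<in> {0<..<1}" "c_uniformly_perfect c m1"
    using assms(2) by (auto simp: uniformly_perfect_def)
  have "\<exists>y\<in>mspace m2. c * r \<le> mdist m2 x y \<and> mdist m2 x y \<le> r"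
    if x: "x \<in> mspace m2" and r: "r \<in> {0<..<mdiameter m2}" for x r
  proof -
    obtain x' where x': "x' \<in> mspace m1" "x = f x'" using x f(2) by blast
    have "r \<in> {0<..<mdiameter m1}" using r mdiameter_isometric[OF assms(1)] by simp
    then obtain y where y: "y \<in> mspace m1" "c * r \<le> mdist m1 x' y" "mdist m1 x' y \<le> r"
      using c(2) x'(1) unfolding c_uniformly_perfect_def by blast
    then show ?thesis
      using x' isometric_embedding_mem[OF f(1) y(1)] isometric_embedding_mdist[OF f(1) x'(1) y(1)]
      by (intro bexI[of _ "f y"]) auto
  qed
  then have "c_uniformly_perfect c m2" unfolding c_uniformly_perfect_def by simp
  then show ?thesis using c(1) unfolding uniformly_perfect_def by blast
qed

lemma isometric_imp_homeomorphic_space: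
  assumes "isometric m1 m2"
  shows "mtopology_of m1 homeomorphic_space mtopology_of m2"
proof -
  obtain f where f: "isometric_embedding m1 m2 f" "f ` mspace m1 = mspace m2"
    using assms by (auto simp: isometric_def)
  interpret Metric_space12 "mspace m1" "mdist m1" "mspace m2" "mdist m2"
    by (simp add: Metric_space12_def)
  have "homeomorphic_map M1.mtopology M2.mtopology f"
    using f by (intro isometry_imp_homeomorphic_map) (auto simp: isometric_embedding_def)
  then show ?thesis
    unfolding mtopology_of_def by (rule homeomorphic_map_imp_homeomorphic_space)
qed

lemma cantor_metric_isometric:
  assumes "isometric m1 m2" "cantor_metric m1"
  shows "cantor_metric m2"
  using homeomorphic_space_trans[OF isometric_imp_homeomorphic_space[OF isometric_sym[OF assms(1)]]
    assms(2)[unfolded cantor_metric_def]]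
  by (simp add: cantor_metric_def)

lift_definition gh_doubling :: "ghspace \<Rightarrow> bool" is doubling
proof -
  fix m1 m2 assume "gh_rel m1 m2"
  then have i: "isometric m1 m2" by (simp add: gh_rel_def)
  show "doubling m1 = doubling m2"
    using doubling_isometric[OF i] doubling_isometric[OF isometric_sym[OF i]] by blast
qed

lift_definition gh_uniformly_disconnected :: "ghspace \<Rightarrow> bool" is uniformly_disconnected
proof -
  fix m1 m2 assume "gh_rel m1 m2"
  then have i: "isometric m1 m2" by (simp add: gh_rel_def)
  show "uniformly_disconnected m1 = uniformly_disconnected m2"
    using uniformly_disconnected_isometric[OF i] uniformly_disconnected_isometric[OF isometric_sym[OF i]] by blast
qed

lift_definition gh_uniformly_perfect :: "ghspace \<Rightarrow> bool" is uniformly_perfect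
proof -
  fix m1 m2 assume "gh_rel m1 m2"
  then have i: "isometric m1 m2" by (simp add: gh_rel_def)
  show "uniformly_perfect m1 = uniformly_perfect m2"
    using uniformly_perfect_isometric[OF i] uniformly_perfect_isometric[OF isometric_sym[OF i]] by blast
qed

lift_definition gh_cantor :: "ghspace \<Rightarrow> bool" is cantor_metric
proof -
  fix m1 m2 assume "gh_rel m1 m2"
  then have i: "isometric m1 m2" by (simp add: gh_rel_def)
  show "cantor_metric m1 = cantor_metric m2"
    using cantor_metric_isometric[OF i] cantor_metric_isometric[OF isometric_sym[OF i]] by blast
qed

definition E_class :: "ghspace set \<Rightarrow> nat \<Rightarrow> ghspace set" where
  "E_class Q u = (if u = 0 then - Q else if u = 1 then Q else UNIV)"

definition X_class :: "nat \<Rightarrow> nat \<Rightarrow> nat \<Rightarrow> ghspace set" where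
  "X_class u v w = E_class {X. gh_doubling X} u \<inter> E_class {X. gh_uniformly_disconnected X} v \<inter>
     E_class {X. gh_uniformly_perfect X} w"

definition dimensional_function :: "(ghspace \<Rightarrow> ennreal) \<Rightarrow> bool" where
  "dimensional_function D \<longleftrightarrow>
     (\<forall>m A. compact_metric m \<and> A \<noteq> {} \<and> closedin (mtopology_of m) A \<longrightarrow>
        D (abs_ghspace (submetric m A)) \<le> D (abs_ghspace m)) \<and>
     (\<forall>\<epsilon>>0. \<exists>m. compact_metric m \<and> D (abs_ghspace m) = \<infinity> \<and> mdiameter m \<le> \<epsilon>)"

definition I_class :: "(ghspace \<Rightarrow> ennreal) \<Rightarrow> ghspace set" where
  "I_class D = {X. D X = \<infinity>}"

definition CA_class :: "ghspace set" where
  "CA_class = {X. gh_cantor X}"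

section \<open>Covering dimension\<close>

text \<open>
  Every finite open cover has an open refinement of order at most \<open>n\<close>, i.e. no point lies in more
  than \<open>n + 1\<close> of its members. On metrizable spaces, covers of arbitrary cardinality give the same
  dimension.
\<close>

definition covering_dim_le :: "'a topology \<Rightarrow> nat \<Rightarrow> bool" where
  "covering_dim_le X n \<longleftrightarrow>
     (\<forall>\<U>. finite \<U> \<and> (\<forall>U\<in>\<U>. openin X U) \<and> \<Union>\<U> = topspace X \<longrightarrow>
        (\<exists>\<V>. (\<forall>V\<in>\<V>. openin X V) \<and> \<Union>\<V> = topspace X \<and> (\<forall>V\<in>\<V>. \<exists>U\<in>\<U>. V \<subseteq> U) \<and>
          (\<forall>x\<in>topspace X. finite {V\<in>\<V>. x \<in> V} \<and> card {V\<in>\<V>. x \<in> V} \<le> n + 1)))"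

definition infinite_dimensional :: "'a topology \<Rightarrow> bool" where
  "infinite_dimensional X \<longleftrightarrow> (\<forall>n. \<not> covering_dim_le X n)"

end

theory Submission
  imports Defs
begin

text \<open>
  Every ball of the Gromov--Hausdorff space contains the class of a finite space \<open>E\<close>. Add to one point
  of \<open>E\<close> a tiny ultrametric cluster whose points have pairwise distances \<open>max t\<^sub>i t\<^sub>j\<close>, where
  each \<open>t\<^sub>i\<close> ranges over an interval of its own, and replace every point of the result by a far
  smaller compact piece. The pieces decide whether the space lies in \<open>S\<close>: doubling, uniform
  disconnectedness and uniform perfectness are inherited from the pieces, and each of them is destroyed
  by one bad piece. The space depends continuously on the parameters \<open>t\<^sub>i\<close>, and its isometry class
  determines them, because they can be read off the set of distances. So \<open>S \<inter> U\<close> contains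
  continuous injective images of cubes of every dimension, and Kuhn's combinatorial lemma, which is the
  core of Brouwer's theorem, bounds the covering dimension from below.
\<close>

text \<open>The lower bound on the dimension is proved directly for any set \<open>T\<close> that
  contains the image of a cube, with no passage to a subspace: the faces are compact, hence closed
  in \<open>T\<close>, and the open sets built from their complements cover all of \<open>T\<close>.

  A single number \<open>h\<close> separates the scales: pieces have diameter below
  \<open>h\<close>, different pieces are at least \<open>h\<close> apart. So a property tested at
  small radii can be checked piece by piece, and the large radii change only a constant, since the
  space is bounded and has finitely many pieces.

  Distances of the form \<open>max\<close> satisfy the triangle inequality for every choice of
  nonnegative heights, which lets the parameters vary independently. An isometry may permute the
  points, so a parameter has to be recognised by its value alone: its interval is kept apart from
  those of the other parameters, from the distances inside the pieces and from the distances between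
  the points of \<open>E\<close>.\<close>

section \<open>Cubes and covering dimension\<close>

text \<open>One domain for all dimensions: the families of spaces below depend only on the first
  \<open>N\<close> coordinates, and \<open>N\<close> varies with the dimension to be
  excluded.\<close>

definition hilbert_cube :: "(nat \<Rightarrow> real) set" where
  "hilbert_cube = (\<Pi>\<^sub>E i\<in>UNIV. {0..1})"

lemma mem_hilbert_cube: "x \<in> hilbert_cube \<longleftrightarrow> (\<forall>i. 0 \<le> x i \<and> x i \<le> 1)"
  by (auto simp: hilbert_cube_def)

lemma compact_PiE_UNIV:
  fixes S :: "'a \<Rightarrow> ('b :: topological_space) set"
  assumes "\<And>i. compact (S i)"
  shows "compact (\<Pi>\<^sub>E i\<in>UNIV. S i)"
proof -
  have "compactin (product_topology (\<lambda>i. euclidean) UNIV) (\<Pi>\<^sub>E i\<in>UNIV. S i)"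
    using assms by (simp add: compactin_PiE)
  then show ?thesis by (simp add: euclidean_product_topology)
qed

text \<open>
  The faces of the image cube give the cover all of whose refinements have order at least \<open>N\<close>: a
  member of a refinement misses one of any two opposite faces, so labelling it by the first \<open>j\<close>
  such that it misses the face \<open>x j = 0\<close> satisfies the boundary conditions of Kuhn's lemma on a fine
  grid. The members chosen at the vertices of a completely labelled simplex are then distinct, and by
  the choice of the mesh they share a point.
\<close>

lemma cube_image_not_covering_dim_le:
  fixes f :: "(nat \<Rightarrow> real) \<Rightarrow> 'a :: metric_space"
  assumes lip: "\<And>x y. x \<in> hilbert_cube \<Longrightarrow> y \<in> hilbert_cube \<Longrightarrow>
      dist (f x) (f y) \<le> L * (\<Sum>i<N. \<bar>x i - y i\<bar>)"
    and inj: "\<And>x y i. x \<in> hilbert_cube \<Longrightarrow> y \<in> hilbert_cube \<Longrightarrow> f x = f y \<Longrightarrow> i < N \<Longrightarrow> x i = y i"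
    and sub: "f ` hilbert_cube \<subseteq> T" and n: "n < N"
  shows "\<not> covering_dim_le (top_of_set T) n"
proof
  assume dim: "covering_dim_le (top_of_set T) n"
  let ?C = hilbert_cube
  have C: "compact ?C" unfolding hilbert_cube_def by (rule compact_PiE_UNIV) simp
  have cont: "continuous_on ?C f"
    unfolding continuous_on
  proof
    fix x assume x: "x \<in> ?C"
    \<comment> \<open>The Lipschitz bound involves finitely many coordinates, so it is continuous
      for the product topology and squeezes the distance to 0.\<close>
    have "continuous_on ?C (\<lambda>y :: nat \<Rightarrow> real. L * (\<Sum>i<N. \<bar>y i - x i\<bar>))"
      by (intro continuous_intros continuous_on_subset[OF continuous_on_product_coordinates]) auto
    then have "((\<lambda>y. L * (\<Sum>i<N. \<bar>y i - x i\<bar>)) \<longlongrightarrow> L * (\<Sum>i<N. \<bar>x i - x i\<bar>)) (at x within ?C)"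
      using x unfolding continuous_on by (rule bspec)
    then have "((\<lambda>y. L * (\<Sum>i<N. \<bar>y i - x i\<bar>)) \<longlongrightarrow> 0) (at x within ?C)" by simp
    moreover have "\<forall>\<^sub>F y in at x within ?C. norm (dist (f y) (f x)) \<le> L * (\<Sum>i<N. \<bar>y i - x i\<bar>)"
      unfolding eventually_at_filter by (rule always_eventually) (use lip[OF _ x] in auto)
    ultimately have "((\<lambda>y. dist (f y) (f x)) \<longlongrightarrow> 0) (at x within ?C)"
      by (rule Lim_null_comparison[rotated])
    then show "(f \<longlongrightarrow> f x) (at x within ?C)" by (rule tendsto_dist_iff[THEN iffD2])
  qed
  define F where "F j e = f ` (?C \<inter> {x. x j = e})" for j e
  have F: "compact (F j e)" for j e
  proof -
    have "closed {x :: nat \<Rightarrow> real. x j = e}"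
      by (intro closed_Collect_eq continuous_intros continuous_on_product_coordinates)
    then have "compact (?C \<inter> {x. x j = e})" using C by (rule compact_Int_closed[rotated])
    then show ?thesis unfolding F_def by (intro compact_continuous_image continuous_on_subset[OF cont]) auto
  qed
  have F01: "F j 0 \<inter> F j 1 = {}" if "j < N" for j
  proof (rule ccontr)
    assume "F j 0 \<inter> F j 1 \<noteq> {}"
    then obtain z where "z \<in> F j 0" "z \<in> F j 1" by blast
    then obtain x y where "x \<in> ?C" "y \<in> ?C" "f x = f y" "x j = 0" "y j = 1" unfolding F_def by blast
    then show False using inj[OF _ _ _ that, of x y] by simp
  qed
  \<comment> \<open>One face of each opposite pair is removed: \<open>F j 0\<close> for
    \<open>j\<close> in \<open>s\<close>, and \<open>F j 1\<close> otherwise. A point lies in at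
    most one face of each pair, so every point of \<open>T\<close> is in some
    \<open>W s\<close>.\<close>
  define W where "W s = T - (\<Union>j<N. F j (if j \<in> s then 0 else 1))" for s
  have "openin (top_of_set T) (W s)" for s
  proof -
    have "closed (\<Union>j<N. F j (if j \<in> s then 0 else 1))" using F by (intro closed_UN) (auto intro: compact_imp_closed)
    then have "openin (top_of_set T) (T \<inter> - (\<Union>j<N. F j (if j \<in> s then 0 else 1)))"
      by (intro openin_open_Int open_Compl)
    then show ?thesis unfolding W_def by (simp only: Diff_eq)
  qed
  moreover have "\<Union>(W ` Pow {..<N}) = T"
  proof (intro equalityI subsetI)
    fix y assume y: "y \<in> T"
    define s where "s = {j\<in>{..<N}. y \<notin> F j 0}"
    have s: "y \<notin> F j (if j \<in> s then 0 else 1)" if "j < N" for j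
      using F01[OF that] that by (auto simp: s_def)
    have "y \<in> W s"
      unfolding W_def
    proof (intro DiffI y notI)
      assume "y \<in> (\<Union>j<N. F j (if j \<in> s then 0 else 1))"
      then obtain j where "j \<in> {..<N}" "y \<in> F j (if j \<in> s then 0 else 1)" by (rule UN_E)
      with s[of j] show False by simp
    qed
    moreover have "s \<subseteq> {..<N}" by (auto simp: s_def)
    ultimately show "y \<in> \<Union>(W ` Pow {..<N})" by blast
  qed (auto simp: W_def)
  ultimately have cover: "finite (W ` Pow {..<N}) \<and> (\<forall>U\<in>W ` Pow {..<N}. openin (top_of_set T) U) \<and>
      \<Union>(W ` Pow {..<N}) = topspace (top_of_set T)" by auto
  obtain \<V> where "(\<forall>V\<in>\<V>. openin (top_of_set T) V) \<and> \<Union>\<V> = topspace (top_of_set T) \<and>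
      (\<forall>V\<in>\<V>. \<exists>U\<in>W ` Pow {..<N}. V \<subseteq> U) \<and>
      (\<forall>x\<in>topspace (top_of_set T). finite {V\<in>\<V>. x \<in> V} \<and> card {V\<in>\<V>. x \<in> V} \<le> n + 1)"
    using dim[unfolded covering_dim_le_def, rule_format, OF cover] by (rule exE)
  then have V: "\<And>V. V \<in> \<V> \<Longrightarrow> openin (top_of_set T) V" "\<Union>\<V> = T"
      "\<And>V. V \<in> \<V> \<Longrightarrow> \<exists>U\<in>W ` Pow {..<N}. V \<subseteq> U"
      "\<And>x. x \<in> T \<Longrightarrow> finite {V\<in>\<V>. x \<in> V}" "\<And>x. x \<in> T \<Longrightarrow> card {V\<in>\<V>. x \<in> V} \<le> n + 1"
    by simp_all
  have V01: "V \<inter> F j 0 = {} \<or> V \<inter> F j 1 = {}" if j: "V \<in> \<V>" "j < N" for V j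
  proof -
    obtain s where "V \<subseteq> W s" using V(3)[OF j(1)] by auto
    moreover have "W s \<inter> F j (if j \<in> s then 0 else 1) = {}" using j(2) unfolding W_def by blast
    ultimately show ?thesis by (cases "j \<in> s") auto
  qed
  have K: "compact (f ` ?C)" using C cont by (rule compact_continuous_image[rotated])
  have C0: "(\<lambda>i. 0) \<in> ?C" by (simp add: mem_hilbert_cube)
  \<comment> \<open>Lebesgue's number lemma asks for open sets of the ambient space, so the members
    of the refinement are replaced by open sets that have them as traces on
    \<open>T\<close>.\<close>
  let ?O = "{G. open G \<and> T \<inter> G \<in> \<V>}"
  have KO: "f ` ?C \<subseteq> \<Union>?O"
  proof
    fix y assume "y \<in> f ` ?C"
    then obtain V where "V \<in> \<V>" "y \<in> V" using sub V(2) by blast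
    then show "y \<in> \<Union>?O" using V(1) by (auto simp: openin_open)
  qed
  then have "?O \<noteq> {}" using C0 by blast
  with K obtain \<delta> where \<delta>: "\<delta> > 0" "\<And>S. S \<subseteq> f ` ?C \<Longrightarrow> diameter S < \<delta> \<Longrightarrow> \<exists>G\<in>?O. S \<subseteq> G"
    using KO by (rule Lebesgue_number_lemma[where \<C> = ?O]) auto
  \<comment> \<open>The sets \<open>S x\<close> below have diameter at most
    \<open>2 * \<bar>L\<bar> * N / p\<close>; the summand 1 keeps the denominator positive when
    \<open>L\<close> is 0.\<close>
  have "\<delta> / (2 * \<bar>L\<bar> * N + 1) > 0" using \<delta>(1) by (intro divide_pos_pos add_nonneg_pos) auto
  then obtain p0 where "1 / Suc p0 < \<delta> / (2 * \<bar>L\<bar> * N + 1)" by (rule nat_approx_posE)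
  then obtain p :: nat where p: "p > 0" "1 / p < \<delta> / (2 * \<bar>L\<bar> * N + 1)" by blast
  have "2 * \<bar>L\<bar> * N * (1 / p) \<le> (2 * \<bar>L\<bar> * N + 1) * (1 / p)" by (intro mult_right_mono) auto
  also have "\<dots> < \<delta>"
    using p(2) by (subst (asm) pos_less_divide_eq) (auto simp: mult.commute intro: add_nonneg_pos)
  finally have mesh: "2 * \<bar>L\<bar> * N * (1 / p) < \<delta>" .
  define pt where "pt x i = real (x i) / p" for x :: "nat \<Rightarrow> nat" and i
  have pt: "pt x \<in> ?C" if "\<forall>j. x j \<le> p" for x
    using that p by (auto simp: mem_hilbert_cube pt_def)
  \<comment> \<open>The image of a whole box around the grid point, so that one member of the
    refinement also contains the images of all neighbouring grid points.\<close>
  define S where "S x = f ` {y\<in>?C. \<forall>i<N. \<bar>y i - pt x i\<bar> \<le> 1 / p}" for x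
  have S: "\<exists>V\<in>\<V>. S x \<subseteq> V" if "\<forall>j. x j \<le> p" for x
  proof -
    have "f (pt x) \<in> S x" using pt[OF that] by (auto simp: S_def)
    moreover have "dist u v \<le> 2 * \<bar>L\<bar> * N * (1 / p)" if uv: "u \<in> S x" "v \<in> S x" for u v
    proof -
      obtain y z where yz: "y \<in> ?C" "z \<in> ?C" "u = f y" "v = f z"
        "\<And>i. i < N \<Longrightarrow> \<bar>y i - pt x i\<bar> \<le> 1 / p" "\<And>i. i < N \<Longrightarrow> \<bar>z i - pt x i\<bar> \<le> 1 / p"
        using uv by (auto simp: S_def)
      have "(\<Sum>i<N. \<bar>y i - z i\<bar>) \<le> (\<Sum>i<N. 2 / p)"
      proof (rule sum_mono)
        fix i assume "i \<in> {..<N}"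
        then show "\<bar>y i - z i\<bar> \<le> 2 / p" using yz(5)[of i] yz(6)[of i] by (simp add: abs_le_iff field_simps)
      qed
      then have "\<bar>L\<bar> * (\<Sum>i<N. \<bar>y i - z i\<bar>) \<le> \<bar>L\<bar> * (\<Sum>i<N. 2 / p)" by (intro mult_left_mono) auto
      moreover have "dist u v \<le> \<bar>L\<bar> * (\<Sum>i<N. \<bar>y i - z i\<bar>)"
        using order_trans[OF lip[OF yz(1,2)] mult_right_mono[OF abs_ge_self]] yz(3,4)
        by (simp add: sum_nonneg)
      ultimately show ?thesis by (simp add: mult_ac)
    qed
    ultimately have "diameter (S x) \<le> 2 * \<bar>L\<bar> * N * (1 / p)"
      unfolding diameter_def by (auto intro!: cSUP_least)
    then have "diameter (S x) < \<delta>" using mesh by simp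
    then obtain G where "open G" "T \<inter> G \<in> \<V>" "S x \<subseteq> G" using \<delta>(2)[of "S x"] by (auto simp: S_def)
    moreover have "S x \<subseteq> T" using sub by (auto simp: S_def)
    ultimately show ?thesis by blast
  qed
  then obtain Vx where Vx: "\<And>x. \<forall>j. x j \<le> p \<Longrightarrow> Vx x \<in> \<V> \<and> S x \<subseteq> Vx x" by metis
  have fV: "f (pt x) \<in> Vx x" if "\<forall>j. x j \<le> p" for x
    using Vx[OF that] pt[OF that] by (auto simp: S_def)
  \<comment> \<open>The value 1 marks a missed face. At \<open>x j = 0\<close> the set
    \<open>Vx x\<close> meets \<open>F j 0\<close>; at \<open>x j = p\<close> it meets
    \<open>F j 1\<close> and must therefore miss \<open>F j 0\<close>.\<close>
  define lab where "lab x j = (if Vx x \<inter> F j 0 = {} then 1 else 0 :: nat)" for x j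
  have "odd (card {s. ksimplex p N s \<and> (reduced N \<circ> lab) ` s = {..N}})"
  proof (rule kuhn_combinatorial[OF p(1)]; intro allI impI; elim conjE)
    fix x :: "nat \<Rightarrow> nat" and j assume x: "\<forall>j. x j \<le> p" and j: "j < N"
    show "lab x j = 0" if "x j = 0"
    proof -
      have "f (pt x) \<in> F j 0" using pt[OF x] that by (auto simp: F_def pt_def)
      then show ?thesis using fV[OF x] by (auto simp: lab_def)
    qed
    show "lab x j = 1" if "x j = p"
    proof -
      have "f (pt x) \<in> F j 1" using pt[OF x] that p by (auto simp: F_def pt_def)
      then show ?thesis using fV[OF x] V01[OF _ j] Vx[OF x] by (auto simp: lab_def)
    qed
  qed
  then have "{s. ksimplex p N s \<and> (reduced N \<circ> lab) ` s = {..N}} \<noteq> {}" by (rule odd_card_imp_not_empty)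
  then obtain s b u where s: "kuhn_simplex p N b u s" and lab: "(reduced N \<circ> lab) ` s = {..N}"
    by (auto elim: ksimplex.cases)
  interpret kuhn_simplex p N b u s by fact
  have sp: "\<forall>j. x j \<le> p" if "x \<in> s" for x using s_le_p[OF that] by blast
  have "s \<noteq> {}" using lab by auto
  then obtain x0 where x0: "x0 \<in> s" by blast
  let ?y = "f (pt x0)"
  have y: "?y \<in> Vx x" if "x \<in> s" for x
  proof -
    have "\<bar>pt x0 i - pt x i\<bar> \<le> 1 / p" for i
    proof -
      \<comment> \<open>Each coordinate of a vertex of a Kuhn simplex equals that of the base vertex
        or exceeds it by one, so two vertices differ by at most 1 in every coordinate.\<close>
      have "\<bar>real (x0 i) - real (x i)\<bar> \<le> 1"
        using base_le[OF that, of i] le_Suc_base[OF that, of i] base_le[OF x0, of i] le_Suc_base[OF x0, of i]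
        by linarith
      then show ?thesis using p(1) by (simp add: pt_def divide_right_mono flip: diff_divide_distrib)
    qed
    then have "?y \<in> S x" using pt[OF sp[OF x0]] by (auto simp: S_def)
    then show ?thesis using Vx[OF sp[OF that]] by blast
  qed
  have yT: "?y \<in> T" using pt[OF sp[OF x0]] sub by auto
  have Vs: "Vx ` s \<subseteq> {V\<in>\<V>. ?y \<in> V}" using Vx[OF sp] y by auto
  \<comment> \<open>The reduced label of a vertex depends only on its set \<open>Vx x\<close>, so
    \<open>N + 1\<close> labels require \<open>N + 1\<close> different sets, all of which contain
    \<open>?y\<close>.\<close>
  define g where "g V = reduced N (\<lambda>j. if V \<inter> F j 0 = {} then 1 else 0)" for V
  have "g ` Vx ` s = {..N}" using lab by (simp add: image_image g_def lab_def[abs_def] comp_def)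
  then have "Suc N \<le> card (Vx ` s)"
    by (metis Vs V(4)[OF yT] card_atMost card_image_le finite_subset)
  also have "\<dots> \<le> n + 1" using card_mono[OF V(4)[OF yT] Vs] V(5)[OF yT] by simp
  finally show False using n by simp
qed

section \<open>Gromov--Hausdorff classes of metrics on arbitrary types\<close>

lemma mdist_self [simp]: "x \<in> mspace m \<Longrightarrow> mdist m x x = 0"
  by simp

text \<open>\<open>gh_dist_le\<close> speaks of metrics on sets of reals, while blow-ups are carried
  by pairs; the coupling is pulled back along isometries from real copies.\<close>

lemma gh_dist_le_coupling:
  assumes m: "compact_metric m1" "compact_metric m2"
    and c: "coupling m1 m2 c" and r: "coupling_within m1 m2 c r"
  shows "gh_dist m1 m2 \<le> r"
proof -
  obtain m1' m2' :: "real metric" where iso: "isometric m1 m1'" "isometric m2 m2'"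
    using isometric_real_metric[OF m(1)] isometric_real_metric[OF m(2)] by blast
  obtain f where f: "isometric_embedding m1' m1 f" "f ` mspace m1' = mspace m1"
    using isometric_sym[OF iso(1)] by (auto simp: isometric_def)
  obtain g where g: "isometric_embedding m2' m2 g" "g ` mspace m2' = mspace m2"
    using isometric_sym[OF iso(2)] by (auto simp: isometric_def)
  have "coupling m1' m2' (\<lambda>x y. c (f x) (g y))"
    using c isometric_embedding_mem[OF f(1)] isometric_embedding_mem[OF g(1)]
      isometric_embedding_mdist[OF f(1)] isometric_embedding_mdist[OF g(1)]
    unfolding coupling_def by metis
  moreover have "coupling_within m1' m2' (\<lambda>x y. c (f x) (g y)) r"
    using r unfolding coupling_within_def f(2)[symmetric] g(2)[symmetric] by auto
  ultimately have "gh_dist m1' m2' \<le> r"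
    by (rule gh_dist_le[OF compact_metric_isometric[OF iso(1) m(1)] compact_metric_isometric[OF iso(2) m(2)]])
  then show ?thesis using gh_dist_cong[OF iso] by simp
qed

lemma compact_metric_submetric:
  assumes "compact_metric m" "closedin (mtopology_of m) E" "E \<noteq> {}"
  shows "compact_metric (submetric m E)"
proof -
  have "E \<subseteq> mspace m" using closedin_subset[OF assms(2)] by simp
  moreover have "compactin (mtopology_of m) E"
    using assms closedin_compact_space by (auto simp: compact_metric_def)
  ultimately show ?thesis
    using assms(3) by (simp add: compact_metric_def mtopology_of_submetric compact_space_subtopology Int_absorb2)
qed

text \<open>The metric of \<open>m\<close>, with one argument restricted to \<open>E\<close>, is
  itself a coupling.\<close>

lemma gh_dist_submetric_le:
  assumes m: "compact_metric m" and E: "closedin (mtopology_of m) E" "E \<noteq> {}"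
    and net: "\<And>x. x \<in> mspace m \<Longrightarrow> \<exists>y\<in>E. mdist m x y < r"
  shows "gh_dist m (submetric m E) \<le> r"
proof (rule gh_dist_le_coupling[OF m compact_metric_submetric[OF m E]])
  have sub: "E \<subseteq> mspace m" using closedin_subset[OF E(1)] by simp
  show "coupling m (submetric m E) (mdist m)"
    unfolding coupling_def
  proof (intro conjI ballI)
    fix x x' y assume "x \<in> mspace m" "x' \<in> mspace m" "y \<in> mspace (submetric m E)"
    then show "mdist m x x' \<le> mdist m x y + mdist m x' y" "mdist m x y \<le> mdist m x x' + mdist m x' y"
      using mdist_triangle[of x m y x'] mdist_triangle[of x m x' y] by (simp_all add: mdist_commute)
  next
    fix x y y' assume "x \<in> mspace m" "y \<in> mspace (submetric m E)" "y' \<in> mspace (submetric m E)"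
    then show "mdist m x y \<le> mdist m x y' + mdist (submetric m E) y' y"
      "mdist (submetric m E) y y' \<le> mdist m x y + mdist m x y'"
      using mdist_triangle[of x m y' y] mdist_triangle[of y m x y'] by (simp_all add: mdist_commute)
  qed simp
  show "coupling_within m (submetric m E) (mdist m) r"
    unfolding coupling_within_def
  proof (intro conjI ballI)
    fix x assume "x \<in> mspace m"
    then show "\<exists>y\<in>mspace (submetric m E). mdist m x y < r" using net sub by auto
  next
    fix y assume "y \<in> mspace (submetric m E)"
    then have y: "y \<in> mspace m" by simp
    then have "r > 0" using net[OF y] mdist_nonneg[of m y] by (meson le_less_trans)
    then show "\<exists>x\<in>mspace m. mdist m x y < r" using y by (metis mdist_zero)
  qed
qed

lemma gh_dist_le_of_mdist_le:
  assumes m: "compact_metric m1" "compact_metric m2" and eq: "mspace m1 = mspace m2"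
    and le: "\<And>x y. x \<in> mspace m1 \<Longrightarrow> y \<in> mspace m1 \<Longrightarrow> mdist m1 x y \<le> mdist m2 x y"
      "\<And>x y. x \<in> mspace m1 \<Longrightarrow> y \<in> mspace m1 \<Longrightarrow> mdist m2 x y \<le> mdist m1 x y + 2 * s"
    and s: "0 \<le> s"
  shows "gh_dist m1 m2 \<le> s"
proof (rule field_le_epsilon)
  fix e :: real assume e: "e > 0"
  \<comment> \<open>A path from one copy of the space to the other and back pays \<open>s\<close>
    twice, which makes up for the deficit \<open>2 * s\<close> of \<open>mdist m1\<close> against
    \<open>mdist m2\<close>.\<close>
  let ?c = "\<lambda>x y. mdist m1 x y + s"
  have "coupling m1 m2 ?c"
    unfolding coupling_def eq[symmetric]
  proof (intro conjI ballI)
    fix x y assume "x \<in> mspace m1" "y \<in> mspace m1"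
    show "0 \<le> ?c x y" using s by simp
  next
    fix x x' y assume xy: "x \<in> mspace m1" "x' \<in> mspace m1" "y \<in> mspace m1"
    show "?c x y \<le> mdist m1 x x' + ?c x' y" "mdist m1 x x' \<le> ?c x y + ?c x' y"
      using mdist_triangle[of x m1 y x'] mdist_triangle[of x m1 x' y] xy s by (simp_all add: mdist_commute)
  next
    fix x y y' assume xy: "x \<in> mspace m1" "y \<in> mspace m1" "y' \<in> mspace m1"
    show "?c x y \<le> ?c x y' + mdist m2 y' y"
      using mdist_triangle[of x m1 y' y] le(1)[of y' y] xy by simp
    show "mdist m2 y y' \<le> ?c x y + ?c x y'"
      using mdist_triangle[of y m1 x y'] le(2)[of y y'] xy by (simp add: mdist_commute)
  qed
  moreover have "\<exists>y\<in>mspace m1. ?c x y < s + e" "\<exists>y\<in>mspace m1. ?c y x < s + e" if "x \<in> mspace m1" for x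
    using e that by (auto intro!: bexI[of _ x] simp: mdist_zero[OF that that, THEN iffD2])
  then have "coupling_within m1 m2 ?c (s + e)" unfolding coupling_within_def eq[symmetric] by blast
  ultimately show "gh_dist m1 m2 \<le> s + e" by (rule gh_dist_le_coupling[OF m])
qed

text \<open>\<open>abs_ghspace\<close> takes metrics on sets of reals. For a compact metric of any
  type a real copy exists, and all real copies have the same class.\<close>

definition gh_class :: "'a metric \<Rightarrow> ghspace" where
  "gh_class m = abs_ghspace (SOME m'. isometric m m')"

lemma gh_class_rep:
  assumes "compact_metric m"
  obtains m' :: "real metric" where "isometric m m'" "compact_metric m'" "gh_rel m' m'"
    "gh_class m = abs_ghspace m'"
proof -
  have "isometric m (SOME m' :: real metric. isometric m m')"
    using isometric_real_metric[OF assms] by (rule someI_ex)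
  then show thesis
    using that compact_metric_isometric[OF _ assms] isometric_refl unfolding gh_rel_def gh_class_def by blast
qed

lemma abs_ghspace_eq_iff:
  "compact_metric m1 \<Longrightarrow> compact_metric m2 \<Longrightarrow> abs_ghspace m1 = abs_ghspace m2 \<longleftrightarrow> isometric m1 m2"
  using Quotient3_rel[OF Quotient3_ghspace, of m1 m2] isometric_refl by (auto simp: gh_rel_def)

lemma gh_class_real:
  fixes m :: "real metric"
  assumes "compact_metric m"
  shows "gh_class m = abs_ghspace m"
  using gh_class_rep[OF assms] abs_ghspace_eq_iff assms by metis

lemma gh_class_eqI:
  assumes "compact_metric m1" "isometric m1 m2"
  shows "gh_class m1 = gh_class m2"
proof -
  obtain m1' :: "real metric" where 1: "isometric m1 m1'" "compact_metric m1'" "gh_class m1 = abs_ghspace m1'"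
    using gh_class_rep[OF assms(1)] by blast
  obtain m2' :: "real metric" where 2: "isometric m2 m2'" "compact_metric m2'" "gh_class m2 = abs_ghspace m2'"
    using gh_class_rep[OF compact_metric_isometric[OF assms(2,1)]] by blast
  show ?thesis
    using 1 2 abs_ghspace_eq_iff isometric_trans[OF isometric_trans[OF isometric_sym[OF 1(1)] assms(2)] 2(1)]
    by simp
qed

lemma dist_gh_class:
  assumes "compact_metric m1" "compact_metric m2"
  shows "dist (gh_class m1) (gh_class m2) = gh_dist m1 m2"
proof -
  obtain m1' :: "real metric" where 1: "isometric m1 m1'" "gh_rel m1' m1'" "gh_class m1 = abs_ghspace m1'"
    using gh_class_rep[OF assms(1)] by blast
  obtain m2' :: "real metric" where 2: "isometric m2 m2'" "gh_rel m2' m2'" "gh_class m2 = abs_ghspace m2'"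
    using gh_class_rep[OF assms(2)] by blast
  show ?thesis using dist_ghspace.abs_eq[OF 1(2) 2(2)] gh_dist_cong[OF 1(1) 2(1)] 1 2 by simp
qed

lemma gh_class_eq_iff:
  assumes "compact_metric m1" "compact_metric m2"
  shows "gh_class m1 = gh_class m2 \<longleftrightarrow> isometric m1 m2"
proof
  assume eq: "gh_class m1 = gh_class m2"
  obtain m1' :: "real metric" where 1: "isometric m1 m1'" "compact_metric m1'" "gh_class m1 = abs_ghspace m1'"
    using gh_class_rep[OF assms(1)] by blast
  obtain m2' :: "real metric" where 2: "isometric m2 m2'" "compact_metric m2'" "gh_class m2 = abs_ghspace m2'"
    using gh_class_rep[OF assms(2)] by blast
  have "isometric m1' m2'" using eq 1 2 abs_ghspace_eq_iff by simp
  then show "isometric m1 m2" using isometric_trans[OF isometric_trans[OF 1(1)] isometric_sym[OF 2(1)]] by blast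
qed (rule gh_class_eqI[OF assms(1)])

lemma gh_class_properties:
  assumes "compact_metric m"
  shows "gh_doubling (gh_class m) \<longleftrightarrow> doubling m"
    and "gh_uniformly_disconnected (gh_class m) \<longleftrightarrow> uniformly_disconnected m"
    and "gh_uniformly_perfect (gh_class m) \<longleftrightarrow> uniformly_perfect m"
    and "gh_cantor (gh_class m) \<longleftrightarrow> cantor_metric m"
proof -
  obtain m' :: "real metric" where m': "isometric m m'" "gh_rel m' m'" "gh_class m = abs_ghspace m'"
    using gh_class_rep[OF assms] by blast
  note s = isometric_sym[OF m'(1)]
  show "gh_doubling (gh_class m) \<longleftrightarrow> doubling m"
    using doubling_isometric[OF m'(1)] doubling_isometric[OF s] gh_doubling.abs_eq[OF m'(2)] m'(3) by auto
  show "gh_uniformly_disconnected (gh_class m) \<longleftrightarrow> uniformly_disconnected m"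
    using uniformly_disconnected_isometric[OF m'(1)] uniformly_disconnected_isometric[OF s]
      gh_uniformly_disconnected.abs_eq[OF m'(2)] m'(3) by auto
  show "gh_uniformly_perfect (gh_class m) \<longleftrightarrow> uniformly_perfect m"
    using uniformly_perfect_isometric[OF m'(1)] uniformly_perfect_isometric[OF s]
      gh_uniformly_perfect.abs_eq[OF m'(2)] m'(3) by auto
  show "gh_cantor (gh_class m) \<longleftrightarrow> cantor_metric m"
    using cantor_metric_isometric[OF m'(1)] cantor_metric_isometric[OF s] gh_cantor.abs_eq[OF m'(2)] m'(3) by auto
qed

lemma gh_class_surj:
  obtains m :: "real metric" where "compact_metric m" "X = gh_class m"
proof -
  have "gh_rel (rep_ghspace X) (rep_ghspace X)" "abs_ghspace (rep_ghspace X) = X"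
    using Quotient3_rep_reflp[OF Quotient3_ghspace] Quotient3_abs_rep[OF Quotient3_ghspace] by auto
  then show thesis using that[of "rep_ghspace X"] gh_class_real by (simp add: gh_rel_def)
qed

lemma isometric_imp_mdist_image_eq:
  assumes "isometric m1 m2"
  shows "{mdist m1 x y | x y. x \<in> mspace m1 \<and> y \<in> mspace m1} = {mdist m2 x y | x y. x \<in> mspace m2 \<and> y \<in> mspace m2}"
proof -
  obtain f where f: "isometric_embedding m1 m2 f" "f ` mspace m1 = mspace m2"
    using assms by (auto simp: isometric_def)
  show ?thesis
    unfolding f(2)[symmetric]
  proof (intro equalityI subsetI)
    fix t assume "t \<in> {mdist m1 x y | x y. x \<in> mspace m1 \<and> y \<in> mspace m1}"
    then obtain x y where "t = mdist m1 x y" "x \<in> mspace m1" "y \<in> mspace m1" by blast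
    then have "t = mdist m2 (f x) (f y)" "f x \<in> f ` mspace m1" "f y \<in> f ` mspace m1"
      using isometric_embedding_mdist[OF f(1)] by auto
    then show "t \<in> {mdist m2 x y | x y. x \<in> f ` mspace m1 \<and> y \<in> f ` mspace m1}" by blast
  next
    fix t assume "t \<in> {mdist m2 x y | x y. x \<in> f ` mspace m1 \<and> y \<in> f ` mspace m1}"
    then obtain x y where "t = mdist m2 (f x) (f y)" "x \<in> mspace m1" "y \<in> mspace m1" by blast
    then have "t = mdist m1 x y" using isometric_embedding_mdist[OF f(1)] by auto
    then show "t \<in> {mdist m1 x y | x y. x \<in> mspace m1 \<and> y \<in> mspace m1}"
      using \<open>x \<in> mspace m1\<close> \<open>y \<in> mspace m1\<close> by blast
  qed
qed

lemma compact_metric_finite_net: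
  assumes "compact_metric m" "r > 0"
  obtains E where "finite E" "E \<subseteq> mspace m" "E \<noteq> {}" "\<And>x. x \<in> mspace m \<Longrightarrow> \<exists>y\<in>E. mdist m x y < r"
proof -
  interpret Metric_space "mspace m" "mdist m" by simp
  have "mtotally_bounded (mspace m)"
    using assms(1) by (simp add: compact_metric_def mtopology_of_def compact_space_eq_mcomplete_mtotally_bounded)
  then obtain E where E: "finite E" "E \<subseteq> mspace m" "mspace m \<subseteq> (\<Union>x\<in>E. mball x r)"
    using assms(2) unfolding mtotally_bounded_def by metis
  have "\<exists>y\<in>E. mdist m x y < r" if "x \<in> mspace m" for x
    using E(3) that by (fastforce simp: commute)
  moreover have "E \<noteq> {}" using E(3) assms(1) by (auto simp: compact_metric_def)
  ultimately show thesis using that E by blast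
qed

section \<open>Criteria, and blow-ups of finite metric spaces\<close>

lemma isometric_embedding_continuous_map:
  assumes "isometric_embedding m1 m2 f"
  shows "continuous_map (mtopology_of m1) (mtopology_of m2) f"
proof -
  have "Lipschitz_continuous_map m1 m2 f"
    using assms unfolding Lipschitz_continuous_map_def isometric_embedding_def by (auto intro!: exI[of _ 1])
  then show ?thesis by (intro uniformly_continuous_imp_continuous_map Lipschitz_imp_uniformly_continuous_map)
qed

lemma mdist_le_mdiameter:
  assumes m: "compact_metric m" and "x \<in> mspace m" "y \<in> mspace m"
  shows "mdist m x y \<le> mdiameter m"
proof -
  obtain D where "\<And>x y. x \<in> mspace m \<Longrightarrow> y \<in> mspace m \<Longrightarrow> mdist m x y \<le> D"
    using compact_metric_bound[OF m] by metis
  then have "bdd_above ((\<lambda>(x, y). mdist m x y) ` (mspace m \<times> mspace m))"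
    by (intro bdd_aboveI[of _ D]) auto
  then have "(\<lambda>(x, y). mdist m x y) (x, y) \<le> mdiameter m"
    unfolding mdiameter_def by (rule cSUP_upper[rotated]) (use assms in auto)
  then show ?thesis by simp
qed

text \<open>If all jumps of a chain stay below \<open>h\<close>, the ultrametric inequality bounds
  the distance of its ends by the largest jump. Otherwise some jump is at least \<open>h\<close>,
  while the ends are at most \<open>D\<close> apart; this gives the constant
  \<open>h / D\<close>.\<close>

lemma uniformly_disconnectedI:
  assumes m: "compact_metric m" and h: "h > 0"
    and ultra: "\<And>x y z. \<lbrakk>x \<in> mspace m; y \<in> mspace m; z \<in> mspace m; mdist m x y < h; mdist m y z < h\<rbrakk>
      \<Longrightarrow> mdist m x z \<le> max (mdist m x y) (mdist m y z)"
  shows "uniformly_disconnected m"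
proof -
  obtain D0 where D0: "D0 > 0" "\<And>x y. x \<in> mspace m \<Longrightarrow> y \<in> mspace m \<Longrightarrow> mdist m x y \<le> D0"
    using compact_metric_bound[OF m] by metis
  \<comment> \<open>The maximum with \<open>h\<close> ensures \<open>h / D \<le> 1\<close>, as the
    ultrametric case requires.\<close>
  define D where "D = max D0 h"
  have D: "D > 0" "h \<le> D" "\<And>x y. x \<in> mspace m \<Longrightarrow> y \<in> mspace m \<Longrightarrow> mdist m x y \<le> D"
    using D0 unfolding D_def by (auto simp: le_max_iff_disj)
  have "h / D * mdist m (z 1) (z N) \<le> (MAX i\<in>{1..N - 1}. mdist m (z i) (z (i + 1)))"
    if z: "\<forall>i\<in>{1..N}. z i \<in> mspace m" "\<exists>i\<in>{1..N}. \<exists>j\<in>{1..N}. z i \<noteq> z j" for N :: nat and z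
  proof -
    have N: "2 \<le> N"
    proof (rule ccontr)
      assume "\<not> 2 \<le> N"
      then have "i = 1" if "i \<in> {1..N}" for i using that by auto
      then show False using z(2) by metis
    qed
    define s where "s = (MAX i\<in>{1..N - 1}. mdist m (z i) (z (i + 1)))"
    have s: "mdist m (z i) (z (Suc i)) \<le> s" if "1 \<le> i" "i < N" for i
      unfolding s_def using that by (intro Max_ge) auto
    have s0: "0 \<le> s" using s[of 1] N mdist_nonneg[of m "z 1" "z (Suc 1)"] by linarith
    have z1N: "z 1 \<in> mspace m" "z N \<in> mspace m" using z(1) N by auto
    show ?thesis
    proof (cases "s < h")
      case True
      have "mdist m (z 1) (z (Suc j)) \<le> s" if "j < N" for j
        using that
      proof (induction j)
        case 0
        then show ?case using s0 z1N by simp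
      next
        case (Suc j)
        have mem: "z (Suc j) \<in> mspace m" "z (Suc (Suc j)) \<in> mspace m" using z(1) Suc.prems by auto
        have "mdist m (z 1) (z (Suc j)) \<le> s" "mdist m (z (Suc j)) (z (Suc (Suc j))) \<le> s"
          using Suc s[of "Suc j"] by auto
        then show ?case using ultra[OF z1N(1) mem] True by linarith
      qed
      from this[of "N - 1"] have "mdist m (z 1) (z N) \<le> s" using N by simp
      moreover have "h / D * mdist m (z 1) (z N) \<le> 1 * mdist m (z 1) (z N)"
        using D by (intro mult_right_mono) auto
      ultimately show ?thesis unfolding s_def by simp
    next
      case False
      have "h / D * mdist m (z 1) (z N) \<le> h / D * D" using D z1N h by (intro mult_left_mono) auto
      then show ?thesis using False D(1) unfolding s_def by simp
    qed
  qed
  then have "delta_uniformly_disconnected (h / D) m" unfolding delta_uniformly_disconnected_def by blast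
  then show ?thesis unfolding uniformly_disconnected_def using D(1) h by (intro exI[of _ "h / D"]) simp
qed

text \<open>A radius below the diameter is shrunk by a fixed factor \<open>k\<close> to one below
  \<open>h\<close>; the point found there serves the original radius with the constant reduced by
  \<open>k\<close>.\<close>

lemma uniformly_perfectI:
  assumes m: "compact_metric m" and c: "c > 0" and h: "h > 0"
    and perf: "\<And>x r. \<lbrakk>x \<in> mspace m; 0 < r; r < h\<rbrakk> \<Longrightarrow> \<exists>y\<in>mspace m. c * r \<le> mdist m x y \<and> mdist m x y \<le> r"
  shows "uniformly_perfect m"
proof -
  obtain D where D: "D > 0" "\<And>x y. x \<in> mspace m \<Longrightarrow> y \<in> mspace m \<Longrightarrow> mdist m x y \<le> D"
    using compact_metric_bound[OF m] by metis
  have diam: "mdiameter m \<le> D"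
    unfolding mdiameter_def using D m by (intro cSUP_least) (auto simp: compact_metric_def)
  define k where "k = min 1 (h / (2 * D))"
  have k: "k > 0" "k \<le> 1" "k \<le> h / (2 * D)" unfolding k_def using D h by auto
  define c' where "c' = min (1 / 2) (c * k)"
  have c': "c' \<in> {0<..<1}" "c' \<le> c * k" unfolding c'_def using c k by auto
  have "\<exists>y\<in>mspace m. c' * r \<le> mdist m x y \<and> mdist m x y \<le> r"
    if x: "x \<in> mspace m" and r: "r \<in> {0<..<mdiameter m}" for x r
  proof -
    have r': "0 < r" "r < D" using r diam by auto
    have "k * r \<le> h / (2 * D) * D" using k D h r' by (intro mult_mono) auto
    also have "\<dots> < h" using D h by simp
    finally obtain y where y: "y \<in> mspace m" "c * (k * r) \<le> mdist m x y" "mdist m x y \<le> k * r"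
      using perf[OF x, of "k * r"] k r' by auto
    have "c' * r \<le> c * k * r" "k * r \<le> 1 * r" using c' k r' by (auto intro!: mult_right_mono)
    then show ?thesis using y by (intro bexI[of _ y]) (auto simp: mult.assoc)
  qed
  then have "c_uniformly_perfect c' m" unfolding c_uniformly_perfect_def by blast
  then show ?thesis unfolding uniformly_perfect_def using c'(1) by blast
qed

text \<open>Radii are tested only below the diameter, so the isolated point \<open>x\<close> does
  harm only in the presence of a second point \<open>y\<close>.\<close>

lemma not_uniformly_perfectI:
  assumes m: "compact_metric m" and xy: "x \<in> mspace m" "y \<in> mspace m" "x \<noteq> y"
    and h: "h > 0" "\<And>z. z \<in> mspace m \<Longrightarrow> z \<noteq> x \<Longrightarrow> h \<le> mdist m x z"
  shows "\<not> uniformly_perfect m"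
proof
  assume "uniformly_perfect m"
  then obtain c where c: "c > 0" "c_uniformly_perfect c m" by (auto simp: uniformly_perfect_def)
  have diam: "mdiameter m > 0"
    using mdist_le_mdiameter[OF m xy(1,2)] h(2)[of y] xy h(1) by auto
  define r where "r = min (h / 2) (mdiameter m / 2)"
  have r: "0 < r" "r < h" "r < mdiameter m" unfolding r_def using h diam by auto
  then obtain z where z: "z \<in> mspace m" "c * r \<le> mdist m x z" "mdist m x z \<le> r"
    using c(2) xy(1) unfolding c_uniformly_perfect_def by (metis greaterThanLessThan_iff)
  have "z = x" using h(2)[of z] z r by fastforce
  then have "mdist m x z = 0" using xy by simp
  moreover have "c * r > 0" using c r by simp
  ultimately show False using z by linarith
qed

lemma not_uniformly_disconnectedI:
  assumes l: "l > 0" and f: "\<And>t. t \<in> {0..l} \<Longrightarrow> f t \<in> mspace m"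
    and iso: "\<And>s t. s \<in> {0..l} \<Longrightarrow> t \<in> {0..l} \<Longrightarrow> mdist m (f s) (f t) = \<bar>s - t\<bar>"
  shows "\<not> uniformly_disconnected m"
proof
  assume "uniformly_disconnected m"
  then obtain \<delta> where \<delta>: "\<delta> > 0" "delta_uniformly_disconnected \<delta> m" by (auto simp: uniformly_disconnected_def)
  obtain n where n: "1 / Suc n < \<delta>" using \<delta>(1) by (rule nat_approx_posE)
  \<comment> \<open>\<open>Suc n\<close> equal steps from 0 to \<open>l\<close>;
    \<open>i - 1\<close> appears because chains are numbered from 1.\<close>
  define z where "z i = f (real (i - 1) / Suc n * l)" for i
  have t: "real (i - 1) / Suc n * l \<in> {0..l}" if "i \<in> {1..Suc n + 1}" for i
  proof -
    have "real (i - 1) / Suc n \<le> 1" using that by (simp add: field_simps)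
    then have "real (i - 1) / Suc n * l \<le> 1 * l" using l by (intro mult_right_mono) auto
    then show ?thesis using l by simp
  qed
  have dz: "mdist m (z i) (z j) = \<bar>real (i - 1) - real (j - 1)\<bar> / Suc n * l"
    if "i \<in> {1..Suc n + 1}" "j \<in> {1..Suc n + 1}" for i j
  proof -
    have "real (i - 1) / Suc n * l - real (j - 1) / Suc n * l = (real (i - 1) - real (j - 1)) / Suc n * l"
      by (simp add: diff_divide_distrib left_diff_distrib)
    then show ?thesis unfolding z_def iso[OF t[OF that(1)] t[OF that(2)]] using l
      by (simp add: abs_mult del: of_nat_Suc)
  qed
  have last: "mdist m (z 1) (z (Suc n + 1)) = l" using dz[of 1 "Suc n + 1"] by (simp add: field_simps)
  have mem: "\<forall>i\<in>{1..Suc n + 1}. z i \<in> mspace m" unfolding z_def using f t by blast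
  have "z 1 \<noteq> z (Suc n + 1)" using last l mem by force
  then have "\<exists>i\<in>{1..Suc n + 1}. \<exists>j\<in>{1..Suc n + 1}. z i \<noteq> z j"
    by (intro bexI[of _ 1] bexI[of _ "Suc n + 1"]) auto
  with mem have "\<delta> * mdist m (z 1) (z (Suc n + 1)) \<le>
      (MAX i\<in>{1..Suc n + 1 - 1}. mdist m (z i) (z (i + 1)))"
    using \<delta>(2) unfolding delta_uniformly_disconnected_def by blast
  also have "\<dots> \<le> 1 / Suc n * l"
  proof (intro Max.boundedI)
    fix a assume "a \<in> (\<lambda>i. mdist m (z i) (z (i + 1))) ` {1..Suc n + 1 - 1}"
    then obtain i where "i \<in> {1..Suc n}" "a = mdist m (z i) (z (i + 1))" by auto
    then show "a \<le> 1 / Suc n * l" using dz[of i "i + 1"] by simp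
  qed auto
  finally have "\<delta> * l \<le> 1 / Suc n * l" using last by simp
  moreover have "1 / Suc n * l < \<delta> * l" using n l by (rule mult_strict_right_mono)
  ultimately show False by linarith
qed

text \<open>Pigeonhole: a ball of radius \<open>r / 2\<close> covers at most one point of
  \<open>S\<close>, so more than \<open>N\<close> of them are needed.\<close>

lemma not_doublingI:
  assumes "\<And>N. \<exists>x\<in>mspace m. \<exists>r>0. \<exists>S. finite S \<and> N < card S \<and> S \<subseteq> mcball_of m x r \<and>
      (\<forall>y\<in>mspace m. \<forall>u\<in>S. \<forall>v\<in>S. mdist m y u \<le> r / 2 \<longrightarrow> mdist m y v \<le> r / 2 \<longrightarrow> u = v)"
  shows "\<not> doubling m"
proof
  assume "doubling m"
  then obtain N where N: "N_doubling N m" by (auto simp: doubling_def)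
  obtain x r S where x: "x \<in> mspace m" "r > 0" and S: "finite S" "N < card S" "S \<subseteq> mcball_of m x r"
    and sep: "\<forall>y\<in>mspace m. \<forall>u\<in>S. \<forall>v\<in>S. mdist m y u \<le> r / 2 \<longrightarrow> mdist m y v \<le> r / 2 \<longrightarrow> u = v"
    using assms[of N] by (elim bexE exE conjE) (rule that)
  obtain F where F: "F \<subseteq> mspace m" "finite F" "card F \<le> N" "mcball_of m x r \<subseteq> (\<Union>y\<in>F. mcball_of m y (r / 2))"
    using N[unfolded N_doubling_def, rule_format, OF x] by (elim exE conjE) (rule that)
  have "\<forall>u\<in>S. \<exists>y\<in>F. mdist m y u \<le> r / 2" using F(4) S(3) by fastforce
  then obtain g where g: "\<And>u. u \<in> S \<Longrightarrow> g u \<in> F \<and> mdist m (g u) u \<le> r / 2" by metis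
  have "inj_on g S" using g sep F(1) by (metis inj_onI subsetD)
  then have "card S \<le> card F" using g F(2) by (intro card_inj_on_le[of g]) auto
  then show False using S F by simp
qed

section \<open>Blow-ups: the points of a finite space replaced by small pieces\<close>

locale blowup =
  fixes A :: "nat set" and d :: "nat \<Rightarrow> nat \<Rightarrow> real" and B :: "nat \<Rightarrow> 'b metric" and h :: real
  assumes A: "finite A" "A \<noteq> {}" and h: "h > 0"
    and d_sym: "\<And>a b. d a b = d b a" and d_nonneg: "\<And>a b. 0 \<le> d a b"
    and d_ge: "\<And>a b. a \<in> A \<Longrightarrow> b \<in> A \<Longrightarrow> a \<noteq> b \<Longrightarrow> h \<le> d a b"
    and d_triangle: "\<And>a b c. \<lbrakk>a \<in> A; b \<in> A; c \<in> A; a \<noteq> b; b \<noteq> c; a \<noteq> c\<rbrakk> \<Longrightarrow> d a c \<le> d a b + d b c"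
    and B: "\<And>a. a \<in> A \<Longrightarrow> compact_metric (B a)"
    and B_small: "\<And>a x y. \<lbrakk>a \<in> A; x \<in> mspace (B a); y \<in> mspace (B a)\<rbrakk> \<Longrightarrow> mdist (B a) x y < h"
begin

definition pts :: "(nat \<times> 'b) set" where
  "pts = (SIGMA a:A. mspace (B a))"

text \<open>Values below \<open>h\<close> occur exactly inside a piece. Hence the triangle
  inequality also holds when the two end points share a piece and the middle point lies in another
  one.\<close>

definition bdist :: "nat \<times> 'b \<Rightarrow> nat \<times> 'b \<Rightarrow> real" where
  "bdist p q = (if fst p = fst q then mdist (B (fst p)) (snd p) (snd q) else d (fst p) (fst q))"

definition space :: "(nat \<times> 'b) metric" where
  "space = metric (pts, bdist)"

lemma Metric_space_pts: "Metric_space pts bdist"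
proof
  fix p q r
  show "0 \<le> bdist p q" by (simp add: bdist_def d_nonneg)
  show "bdist p q = bdist q p" by (simp add: bdist_def d_sym mdist_commute)
  show "bdist p q = 0 \<longleftrightarrow> p = q" if "p \<in> pts" "q \<in> pts"
    using that h d_ge[of "fst p" "fst q"] by (force simp: bdist_def pts_def)
  show "bdist p r \<le> bdist p q + bdist q r" if "p \<in> pts" "q \<in> pts" "r \<in> pts"
  proof -
    obtain a x b y c z where pqr: "p = (a, x)" "q = (b, y)" "r = (c, z)" by (metis surj_pair)
    have mem: "a \<in> A" "b \<in> A" "c \<in> A" "x \<in> mspace (B a)" "y \<in> mspace (B b)" "z \<in> mspace (B c)"
      using that by (auto simp: pqr pts_def)
    consider "a = b" "b = c" | "a = b" "b \<noteq> c" | "a \<noteq> b" "b = c" | "a = c" "a \<noteq> b" | "a \<noteq> b" "b \<noteq> c" "a \<noteq> c" by blast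
    then show ?thesis
    proof cases
      case 4
      then show ?thesis
        using mem B_small[of a x z] d_ge[of a b] d_nonneg[of b a] by (simp add: pqr bdist_def)
    qed (use mem mdist_triangle[of x "B a" y z] d_triangle[of a b c] in \<open>auto simp: pqr bdist_def\<close>)
  qed
qed

lemma mspace_space [simp]: "mspace space = pts"
  and mdist_space [simp]: "mdist space = bdist"
  unfolding space_def using Metric_space.mspace_metric[OF Metric_space_pts]
    Metric_space.mdist_metric[OF Metric_space_pts] by auto

lemma mem_pts: "(a, x) \<in> pts \<longleftrightarrow> a \<in> A \<and> x \<in> mspace (B a)"
  by (simp add: pts_def)

lemma bdist_same [simp]: "bdist (a, x) (a, y) = mdist (B a) x y"
  by (simp add: bdist_def)

lemma bdist_less_iff:
  assumes "(a, x) \<in> pts" "(b, y) \<in> pts"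
  shows "bdist (a, x) (b, y) < h \<longleftrightarrow> a = b"
  using assms d_ge[of a b] B_small[of a x y] by (auto simp: bdist_def mem_pts)

lemma isometric_embedding_Pair: "a \<in> A \<Longrightarrow> isometric_embedding (B a) space (Pair a)"
  by (simp add: isometric_embedding_def mem_pts)

lemma piece_compactin:
  assumes "a \<in> A"
  shows "compactin (mtopology_of space) (Pair a ` mspace (B a))"
proof -
  have "compactin (mtopology_of (B a)) (mspace (B a))"
    using B[OF assms] by (simp add: compact_metric_def compact_space_def)
  then show ?thesis
    using isometric_embedding_continuous_map[OF isometric_embedding_Pair[OF assms]] by (rule image_compactin)
qed

lemma compact_metric_space: "compact_metric space"
proof -
  have "pts = (\<Union>a\<in>A. Pair a ` mspace (B a))" by (auto simp: pts_def)
  then have "compactin (mtopology_of space) pts"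
    using A(1) piece_compactin by (simp only:) (intro compactin_Union, auto)
  moreover have "pts \<noteq> {}" using A(2) B by (auto simp: pts_def compact_metric_def)
  ultimately show ?thesis by (simp add: compact_metric_def compact_space_def)
qed

text \<open>The pieces are covered separately. If a ball reaches a piece other than that of its
  centre, its radius is at least \<open>h\<close>, so the whole piece lies in a ball of the same
  radius around any of its own points.\<close>

lemma doubling_space:
  assumes "\<And>a. a \<in> A \<Longrightarrow> doubling (B a)"
  shows "doubling space"
proof -
  obtain N where N: "\<And>a. a \<in> A \<Longrightarrow> N_doubling (N a) (B a)" using assms unfolding doubling_def by metis
  have "\<exists>F. F \<subseteq> mspace space \<and> finite F \<and> card F \<le> sum N A \<and>
      mcball_of space p r \<subseteq> (\<Union>q\<in>F. mcball_of space q (r / 2))" if p: "p \<in> mspace space" and r: "r > 0" for p r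
  proof -
    obtain a x where ax: "p = (a, x)" "a \<in> A" "x \<in> mspace (B a)" using p by (auto simp: pts_def)
    have "\<exists>G. G \<subseteq> mspace (B b) \<and> finite G \<and> card G \<le> N b \<and>
        (\<forall>y. (b, y) \<in> mcball_of space p r \<longrightarrow> (\<exists>w\<in>G. mdist (B b) w y \<le> r / 2))" if b: "b \<in> A" for b
    proof -
      obtain c where c: "c \<in> mspace (B b)" "b = a \<longrightarrow> c = x"
        using ax B[OF b] by (cases "b = a") (auto simp: compact_metric_def)
      obtain G where G: "G \<subseteq> mspace (B b)" "finite G" "card G \<le> N b"
          "mcball_of (B b) c r \<subseteq> (\<Union>y\<in>G. mcball_of (B b) y (r / 2))"
        using N[OF b, unfolded N_doubling_def, rule_format, OF c(1) r] by (elim exE conjE) (rule that)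
      have "\<exists>w\<in>G. mdist (B b) w y \<le> r / 2" if y: "(b, y) \<in> mcball_of space p r" for y
      proof -
        have y': "y \<in> mspace (B b)" "bdist p (b, y) \<le> r" using y by (auto simp: mem_pts)
        have "mdist (B b) c y \<le> r"
        proof (cases "b = a")
          case True
          then show ?thesis using y' c ax by simp
        next
          case False
          then have "h \<le> r" using y' ax b d_ge[of a b] by (simp add: bdist_def)
          then show ?thesis using B_small[OF b c(1) y'(1)] by simp
        qed
        then have "y \<in> mcball_of (B b) c r" using y' c by simp
        then have "y \<in> (\<Union>w\<in>G. mcball_of (B b) w (r / 2))" using G(4) by (rule subsetD[rotated])
        then show ?thesis by auto
      qed
      then show ?thesis using G by blast
    qed
    then obtain G where G: "\<And>b. b \<in> A \<Longrightarrow> G b \<subseteq> mspace (B b) \<and> finite (G b) \<and> card (G b) \<le> N b"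
        "\<And>b y. b \<in> A \<Longrightarrow> (b, y) \<in> mcball_of space p r \<Longrightarrow> \<exists>w\<in>G b. mdist (B b) w y \<le> r / 2" by metis
    let ?F = "SIGMA b:A. G b"
    have "card ?F = (\<Sum>b\<in>A. card (G b))" using A(1) G(1) by (intro card_SigmaI) auto
    also have "\<dots> \<le> sum N A" using G(1) by (intro sum_mono) auto
    finally have card: "card ?F \<le> sum N A" .
    have "mcball_of space p r \<subseteq> (\<Union>q\<in>?F. mcball_of space q (r / 2))"
    proof
      fix q assume q: "q \<in> mcball_of space p r"
      obtain b y where by': "q = (b, y)" by (metis surj_pair)
      then have mem: "b \<in> A" "y \<in> mspace (B b)" using q by (auto simp: mem_pts)
      then obtain w where w: "w \<in> G b" "mdist (B b) w y \<le> r / 2" using G(2) q by' by blast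
      then have "q \<in> mcball_of space (b, w) (r / 2)"
        using mem G(1)[OF mem(1)] by (auto simp: by' mem_pts)
      then show "q \<in> (\<Union>q\<in>?F. mcball_of space q (r / 2))" using w mem by blast
    qed
    moreover have "?F \<subseteq> mspace space" using G(1) by (auto simp: pts_def)
    moreover have "finite ?F" using A(1) G(1) by auto
    ultimately show ?thesis using card by blast
  qed
  then have "N_doubling (sum N A) space" unfolding N_doubling_def by blast
  then show ?thesis unfolding doubling_def by blast
qed

lemma uniformly_disconnected_space:
  assumes ultra: "\<And>a x y z. \<lbrakk>a \<in> A; x \<in> mspace (B a); y \<in> mspace (B a); z \<in> mspace (B a)\<rbrakk> \<Longrightarrow>
      mdist (B a) x z \<le> max (mdist (B a) x y) (mdist (B a) y z)"
  shows "uniformly_disconnected space"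
proof (rule uniformly_disconnectedI[OF compact_metric_space h])
  fix p q r assume mem: "p \<in> mspace space" "q \<in> mspace space" "r \<in> mspace space"
    and less: "mdist space p q < h" "mdist space q r < h"
  obtain a x b y c z where pqr: "p = (a, x)" "q = (b, y)" "r = (c, z)" by (metis surj_pair)
  have "a = b" "b = c" using mem less bdist_less_iff by (auto simp: pqr)
  then show "mdist space p r \<le> max (mdist space p q) (mdist space q r)"
    using mem ultra[of a x y z] by (auto simp: pqr mem_pts)
qed

lemma uniformly_perfect_space:
  assumes c: "c > 0" and h': "h' > 0"
    and perf: "\<And>a x r. \<lbrakk>a \<in> A; x \<in> mspace (B a); 0 < r; r < h'\<rbrakk> \<Longrightarrow>
      \<exists>y\<in>mspace (B a). c * r \<le> mdist (B a) x y \<and> mdist (B a) x y \<le> r"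
  shows "uniformly_perfect space"
proof (rule uniformly_perfectI[OF compact_metric_space c h'])
  fix p r assume "p \<in> mspace space" and r: "0 < r" "r < h'"
  then obtain a x where ax: "p = (a, x)" "a \<in> A" "x \<in> mspace (B a)" by (auto simp: pts_def)
  obtain y where "y \<in> mspace (B a)" "c * r \<le> mdist (B a) x y" "mdist (B a) x y \<le> r"
    using perf[OF ax(2,3) r] by blast
  then show "\<exists>q\<in>mspace space. c * r \<le> mdist space p q \<and> mdist space p q \<le> r"
    using ax by (intro bexI[of _ "(a, y)"]) (auto simp: mem_pts)
qed

lemma not_uniformly_perfect_space:
  assumes a: "a \<in> A" "mspace (B a) = {x}" and b: "b \<in> A" "b \<noteq> a"
  shows "\<not> uniformly_perfect space"
proof -
  obtain y where y: "y \<in> mspace (B b)" using B[OF b(1)] by (auto simp: compact_metric_def)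
  show ?thesis
  proof (rule not_uniformly_perfectI[OF compact_metric_space, of "(a, x)" "(b, y)" h])
    fix q assume "q \<in> mspace space" "q \<noteq> (a, x)"
    moreover obtain c z where q: "q = (c, z)" by (metis surj_pair)
    ultimately have "c \<in> A" "c \<noteq> a" using a(2) by (auto simp: mem_pts)
    then show "h \<le> mdist space (a, x) q" using d_ge[OF a(1), of c] by (simp add: q bdist_def)
  qed (use a b y h in \<open>auto simp: mem_pts\<close>)
qed

end

section \<open>The pieces\<close>

lemma continuous_map_mtopology_ofI:
  assumes mem: "\<And>x. x \<in> mspace m1 \<Longrightarrow> f x \<in> mspace m2"
    and lim: "\<And>x \<epsilon>. x \<in> mspace m1 \<Longrightarrow> \<epsilon> > 0 \<Longrightarrow>
      \<exists>\<delta>>0. \<forall>y\<in>mspace m1. mdist m1 x y < \<delta> \<longrightarrow> mdist m2 (f x) (f y) < \<epsilon>"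
  shows "continuous_map (mtopology_of m1) (mtopology_of m2) f"
proof -
  interpret Metric_space12 "mspace m1" "mdist m1" "mspace m2" "mdist m2"
    by (simp add: Metric_space12_def)
  have "continuous_map M1.mtopology M2.mtopology f"
    unfolding M1.metric_continuous_map[OF M2.Metric_space_axioms]
  proof (intro conjI ballI allI impI)
    fix x \<epsilon> assume "x \<in> mspace m1" "0 < (\<epsilon> :: real)"
    from lim[OF this] show "\<exists>\<delta>>0. \<forall>y. y \<in> mspace m1 \<and> mdist m1 x y < \<delta> \<longrightarrow> mdist m2 (f x) (f y) < \<epsilon>"
      by blast
  qed (use mem in blast)
  then show ?thesis by (simp add: mtopology_of_def)
qed

lemma compact_metric_homeomorphic_spaceI:
  assumes m: "compact_metric m1" and cont: "continuous_map (mtopology_of m1) (mtopology_of m2) f"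
    and bij: "bij_betw f (mspace m1) (mspace m2)"
  shows "mtopology_of m1 homeomorphic_space mtopology_of m2"
proof -
  have "Hausdorff_space (mtopology_of m2)"
    by (simp add: mtopology_of_def Metric_space.Hausdorff_space_mtopology)
  then have "homeomorphic_map (mtopology_of m1) (mtopology_of m2) f"
    using m cont bij by (intro continuous_imp_homeomorphic_map) (auto simp: compact_metric_def bij_betw_def)
  then show ?thesis by (rule homeomorphic_map_imp_homeomorphic_space)
qed

section \<open>Ultrametric spaces of sequences\<close>

definition seqs :: "(nat \<Rightarrow> nat) \<Rightarrow> (nat \<Rightarrow> real) set" where
  "seqs k = {x. \<forall>n. x n \<in> real ` {..<k n}}"

definition seq_dist :: "real \<Rightarrow> (nat \<Rightarrow> real) \<Rightarrow> (nat \<Rightarrow> real) \<Rightarrow> real" where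
  "seq_dist s x y = (if x = y then 0 else s / 2 ^ (LEAST n. x n \<noteq> y n))"

text \<open>The entries are reals so that sequence spaces and intervals, the latter as constant
  sequences, have one type and can be mixed as pieces of a blow-up.\<close>

definition seq_metric :: "real \<Rightarrow> (nat \<Rightarrow> nat) \<Rightarrow> (nat \<Rightarrow> real) metric" where
  "seq_metric s k = metric (seqs k, seq_dist s)"

text \<open>The balls of radius \<open>s / 2 ^ n\<close> are cylinders; this reduces metric
  statements to statements on common prefixes.\<close>

lemma seq_dist_le_iff:
  assumes s: "s > 0"
  shows "seq_dist s x y \<le> s / 2 ^ n \<longleftrightarrow> (\<forall>i<n. x i = y i)"
proof (cases "x = y")
  case False
  define m where "m = (LEAST n. x n \<noteq> y n)"
  have "\<exists>n. x n \<noteq> y n" using False by auto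
  then have m: "x m \<noteq> y m" unfolding m_def by (rule LeastI_ex)
  have m': "x i = y i" if "i < m" for i using not_less_Least[OF that[unfolded m_def]] by blast
  have "seq_dist s x y \<le> s / 2 ^ n \<longleftrightarrow> n \<le> m"
    using s False by (simp add: seq_dist_def m_def divide_le_cancel field_simps)
  also have "\<dots> \<longleftrightarrow> (\<forall>i<n. x i = y i)" using m m' by (meson leI less_le_trans)
  finally show ?thesis .
qed (use s in \<open>simp add: seq_dist_def\<close>)

lemma seq_dist_cases:
  obtains "x = y" "seq_dist s x y = 0" | n where "x \<noteq> y" "seq_dist s x y = s / 2 ^ n"
  by (cases "x = y") (auto simp: seq_dist_def)

lemma seq_dist_nonneg: "s > 0 \<Longrightarrow> 0 \<le> seq_dist s x y"
  by (simp add: seq_dist_def)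

lemma seq_dist_le: "s > 0 \<Longrightarrow> seq_dist s x y \<le> s"
  using seq_dist_le_iff[of s x y 0] by simp

lemma seq_dist_ultrametric:
  assumes s: "s > 0"
  shows "seq_dist s x z \<le> max (seq_dist s x y) (seq_dist s y z)"
proof -
  \<comment> \<open>Reversing the path exchanges the two distances on the right, so the larger one
    may be taken to come first.\<close>
  have *: "seq_dist s x z \<le> max (seq_dist s x y) (seq_dist s y z)" if le: "seq_dist s y z \<le> seq_dist s x y" for x y z
  proof (cases rule: seq_dist_cases[of x y s])
    case 1
    then show ?thesis by simp
  next
    case (2 n)
    then have "\<forall>i<n. x i = y i" "\<forall>i<n. y i = z i"
      using le seq_dist_le_iff[OF s, of x y n] seq_dist_le_iff[OF s, of y z n] by auto
    then have "seq_dist s x z \<le> s / 2 ^ n" using seq_dist_le_iff[OF s, of x z n] by auto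
    then show ?thesis using 2 by simp
  qed
  have sym: "seq_dist s x y = seq_dist s y x" for x y by (auto simp: seq_dist_def eq_commute)
  show ?thesis using *[of y z x] *[of y x z] sym by (metis linear max.commute)
qed

lemma Metric_space_seqs:
  assumes s: "s > 0"
  shows "Metric_space (seqs k) (seq_dist s)"
proof
  fix x y z :: "nat \<Rightarrow> real"
  show "0 \<le> seq_dist s x y" by (rule seq_dist_nonneg[OF s])
  show "seq_dist s x y = seq_dist s y x" by (auto simp: seq_dist_def eq_commute)
  show "seq_dist s x y = 0 \<longleftrightarrow> x = y" using s by (simp add: seq_dist_def)
  show "seq_dist s x z \<le> seq_dist s x y + seq_dist s y z"
    using seq_dist_ultrametric[OF s, of x z y] seq_dist_nonneg[OF s, of x y] seq_dist_nonneg[OF s, of y z] by linarith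
qed

lemma mspace_seq_metric [simp]: "s > 0 \<Longrightarrow> mspace (seq_metric s k) = seqs k"
  and mdist_seq_metric [simp]: "s > 0 \<Longrightarrow> mdist (seq_metric s k) = seq_dist s"
  unfolding seq_metric_def using Metric_space.mspace_metric[OF Metric_space_seqs]
    Metric_space.mdist_metric[OF Metric_space_seqs] by auto

lemma seqs_update: "x \<in> seqs k \<Longrightarrow> j < k n \<Longrightarrow> x(n := real j) \<in> seqs k"
  by (simp add: seqs_def)

text \<open>A product of finite sets is compact, and the identity carries this over to the metric
  topology because cylinders are open in the product topology.\<close>

lemma compact_metric_seq_metric:
  assumes s: "s > 0" and k: "\<And>n. 0 < k n"
  shows "compact_metric (seq_metric s k)"
proof -
  interpret Metric_space "seqs k" "seq_dist s" by (rule Metric_space_seqs[OF s])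
  have seqs: "seqs k = (\<Pi>\<^sub>E n\<in>UNIV. real ` {..<k n})" by (auto simp: seqs_def)
  have "compact (seqs k)"
  proof -
    have "compactin (product_topology (\<lambda>i. euclidean) UNIV) (\<Pi>\<^sub>E n\<in>UNIV. real ` {..<k n})"
      by (simp add: compactin_PiE finite_imp_compact)
    then show ?thesis unfolding seqs by (simp add: euclidean_product_topology)
  qed
  moreover have "continuous_map (top_of_set (seqs k)) mtopology id"
    unfolding continuous_map_to_metric
  proof (intro ballI allI impI)
    fix x and \<epsilon> :: real assume x: "x \<in> topspace (top_of_set (seqs k))" and e: "\<epsilon> > 0"
    obtain n where "(1 / 2) ^ n < \<epsilon> / s" using real_arch_pow_inv[of "\<epsilon> / s" "1 / 2"] e s by auto
    then have n: "s / 2 ^ n < \<epsilon>" using s by (simp add: field_simps)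
    \<comment> \<open>The entries are natural numbers, so a difference below 1 forces equality at
      the first \<open>n\<close> places.\<close>
    let ?U = "\<Inter>i\<in>{..<n}. {y :: nat \<Rightarrow> real. \<bar>y i - x i\<bar> < 1}"
    have "open ?U"
      by (intro open_INT finite_lessThan ballI open_Collect_less continuous_intros
          continuous_on_subset[OF continuous_on_product_coordinates]) auto
    then have "openin (top_of_set (seqs k)) (seqs k \<inter> ?U)" by (rule openin_open_Int)
    moreover have "y \<in> mball x \<epsilon>" if y: "y \<in> seqs k \<inter> ?U" for y
    proof -
      have "x i = y i" if "i < n" for i
      proof -
        have "x i \<in> real ` {..<k i}" "y i \<in> real ` {..<k i}" "\<bar>y i - x i\<bar> < 1"
          using x y that by (auto simp: seqs_def)
        then obtain p q where pq: "x i = real p" "y i = real q" "\<bar>real q - real p\<bar> < 1" by auto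
        then have "p = q" by linarith
        then show ?thesis using pq by simp
      qed
      then have "seq_dist s x y \<le> s / 2 ^ n" using seq_dist_le_iff[OF s] by blast
      then show ?thesis using n x y by simp
    qed
    ultimately show "\<exists>U. openin (top_of_set (seqs k)) U \<and> x \<in> U \<and> (\<forall>y\<in>U. id y \<in> mball (id x) \<epsilon>)"
      using x by (intro exI[of _ "seqs k \<inter> ?U"]) auto
  qed
  ultimately have "compactin mtopology (id ` seqs k)"
    by (intro image_compactin) (auto simp: compactin_subtopology)
  moreover have "(\<lambda>n. 0) \<in> seqs k" using k by (auto simp: seqs_def intro!: image_eqI[of _ _ 0])
  ultimately show ?thesis using s by (auto simp: compact_metric_def mtopology_of_def compact_space_def)
qed

text \<open>Distances take only the values 0 and \<open>s / 2 ^ i\<close>, so a radius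
  \<open>r\<close> acts like the largest \<open>s / 2 ^ i\<close> not exceeding it. For
  \<open>r < s\<close> the exponent is positive, and the preceding value, twice as large, exceeds
  \<open>r\<close>.\<close>

lemma seq_dist_scale:
  assumes s: "s > 0" and r: "r > 0"
  obtains n where "s / 2 ^ n \<le> r" "\<And>x y. seq_dist s x y \<le> r \<Longrightarrow> \<forall>i<n. x i = y i" "r < s \<Longrightarrow> r / 2 < s / 2 ^ n"
proof -
  obtain n0 where "(1 / 2) ^ n0 < r / s" using real_arch_pow_inv[of "r / s" "1 / 2"] r s by auto
  then have n0: "s / 2 ^ n0 \<le> r" using s by (simp add: field_simps)
  define n where "n = (LEAST n. s / 2 ^ n \<le> r)"
  have n: "s / 2 ^ n \<le> r" unfolding n_def by (rule LeastI[of "\<lambda>n. s / 2 ^ n \<le> r", OF n0])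
  have least: "n \<le> i" if "s / 2 ^ i \<le> r" for i unfolding n_def using that by (rule Least_le)
  have agree: "\<forall>i<n. x i = y i" if le: "seq_dist s x y \<le> r" for x y
  proof (cases rule: seq_dist_cases[of x y s])
    case (2 i)
    then have "n \<le> i" using least le by simp
    moreover have "\<forall>j<i. x j = y j" using seq_dist_le_iff[OF s, of x y i] 2 by simp
    ultimately show ?thesis by auto
  qed simp
  have "r / 2 < s / 2 ^ n" if rs: "r < s"
  proof -
    obtain i where i: "n = Suc i" using n rs by (cases n) auto
    then have "r < s / 2 ^ i" using least[of i] by (auto simp: not_le[symmetric])
    then show ?thesis by (simp add: i field_simps)
  qed
  with n agree show thesis by (rule that)
qed

lemma doubling_seq_metric:
  assumes s: "s > 0" and k: "\<And>n. k n \<le> K"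
  shows "doubling (seq_metric s k)"
proof -
  have "\<exists>F. F \<subseteq> seqs k \<and> finite F \<and> card F \<le> K \<and>
      mcball_of (seq_metric s k) x r \<subseteq> (\<Union>y\<in>F. mcball_of (seq_metric s k) y (r / 2))"
    if x: "x \<in> seqs k" and r: "r > 0" for x r
  proof -
    obtain n where n: "s / 2 ^ n \<le> r" "\<And>x y. seq_dist s x y \<le> r \<Longrightarrow> \<forall>i<n. x i = y i"
      using seq_dist_scale[OF s r] by metis
    \<comment> \<open>The points of the ball share their first \<open>n\<close> entries with
      \<open>x\<close>; prescribing entry \<open>n\<close> as well halves the radius.\<close>
    let ?F = "(\<lambda>j. x(n := real j)) ` {..<k n}"
    have sub: "?F \<subseteq> seqs k" using seqs_update[OF x] by auto
    have "mcball_of (seq_metric s k) x r \<subseteq> (\<Union>y\<in>?F. mcball_of (seq_metric s k) y (r / 2))"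
    proof
      fix y assume y: "y \<in> mcball_of (seq_metric s k) x r"
      then have y': "y \<in> seqs k" "\<forall>i<n. x i = y i" using s n(2)[of x y] by auto
      obtain j where j: "j < k n" "y n = real j" using y'(1) by (auto simp: seqs_def)
      have "seq_dist s (x(n := real j)) y \<le> s / 2 ^ Suc n"
        unfolding seq_dist_le_iff[OF s] using y' j by (auto simp: less_Suc_eq)
      also have "\<dots> \<le> r / 2" using n(1) by (simp add: field_simps)
      finally have "y \<in> mcball_of (seq_metric s k) (x(n := real j)) (r / 2)"
        using s y' seqs_update[OF x j(1)] by simp
      then show "y \<in> (\<Union>y\<in>?F. mcball_of (seq_metric s k) y (r / 2))" using j by blast
    qed
    moreover have "card ?F \<le> K" using card_image_le[of "{..<k n}" "\<lambda>j. x(n := real j)"] k[of n] by simp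
    ultimately show ?thesis using sub by blast
  qed
  then have "N_doubling K (seq_metric s k)" using s by (simp add: N_doubling_def)
  then show ?thesis unfolding doubling_def by blast
qed

lemma seq_metric_perfect:
  assumes s: "s > 0" and k: "\<And>n. 2 \<le> k n" and x: "x \<in> seqs k" and r: "0 < r" "r < s"
  shows "\<exists>y\<in>seqs k. 1 / 2 * r \<le> seq_dist s x y \<and> seq_dist s x y \<le> r"
proof -
  obtain n where n: "s / 2 ^ n \<le> r" "r / 2 < s / 2 ^ n" using seq_dist_scale[OF s r(1)] r(2) by metis
  \<comment> \<open>Changing just the entry at place \<open>n\<close> gives distance exactly
    \<open>s / 2 ^ n\<close>, which lies between \<open>r / 2\<close> and \<open>r\<close>.\<close>
  define y where "y = x(n := real (if x n = 0 then 1 else 0))"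
  have "y \<in> seqs k" unfolding y_def using k[of n] by (intro seqs_update[OF x]) auto
  moreover have "seq_dist s x y = s / 2 ^ n"
  proof -
    have ne: "x n \<noteq> y n" by (simp add: y_def)
    have "(LEAST i. x i \<noteq> y i) = n"
      by (rule Least_equality) (use ne in \<open>auto simp: y_def split: if_splits\<close>)
    then show ?thesis using ne by (auto simp: seq_dist_def)
  qed
  ultimately show ?thesis using n by (intro bexI[of _ y]) auto
qed

text \<open>The branching at place \<open>N\<close> grows with \<open>N\<close>: the sequences that
  vanish except at place \<open>N\<close> lie in one ball of radius \<open>s / 2 ^ N\<close>, while
  a ball of half that radius fixes the entry there. Half the radius is below \<open>h\<close>, so
  only centres in the same piece can reach these points.\<close>

lemma not_doubling_space:
  fixes B :: "nat \<Rightarrow> (nat \<Rightarrow> real) metric"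
  assumes bl: "blowup A d B h"
    and a: "a \<in> A" "B a = seq_metric s (\<lambda>n. n + 2)" and s: "s > 0" "s < h"
  shows "\<not> doubling (blowup.space A d B)"
proof -
  interpret blowup A d B h by (fact bl)
  show ?thesis
  proof (rule not_doublingI)
    fix N :: nat
    let ?u = "\<lambda>j. (\<lambda>n. 0)(N := real j)"
    let ?r = "s / 2 ^ N" and ?S = "(\<lambda>j. (a, ?u j)) ` {..<N + 2}"
    have zero: "(\<lambda>n. 0) \<in> seqs (\<lambda>n. n + 2)" by (auto simp: seqs_def intro!: image_eqI[of _ _ 0])
    have u: "?u j \<in> seqs (\<lambda>n. n + 2)" if "j < N + 2" for j using seqs_update[of "\<lambda>n. 0" "\<lambda>n. n + 2" j N] zero that by simp
    have mem: "(a, y) \<in> pts \<longleftrightarrow> y \<in> seqs (\<lambda>n. n + 2)" for y using a s by (simp add: mem_pts)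
    have bd [simp]: "mdist (B a) = seq_dist s" using a s by simp
    have "?r \<le> s" using s by (simp add: field_simps)
    then have r: "0 < ?r" "?r / 2 < h" using s by auto
    have "inj_on (\<lambda>j. (a, ?u j)) {..<N + 2}" by (auto simp: inj_on_def dest: fun_cong[of _ _ N])
    then have card: "card ?S = N + 2" by (simp add: card_image)
    have "seq_dist s (\<lambda>n. 0) (?u j) \<le> ?r" for j unfolding seq_dist_le_iff[OF s(1)] by simp
    then have ball: "?S \<subseteq> mcball_of space (a, \<lambda>n. 0) ?r" using u zero by (auto simp: mem)
    have sep: "u = v" if y: "y \<in> mspace space" and uv: "u \<in> ?S" "v \<in> ?S"
      and le: "mdist space y u \<le> ?r / 2" "mdist space y v \<le> ?r / 2" for y u v
    proof -
      obtain i j where ij: "u = (a, ?u i)" "v = (a, ?u j)" "i < N + 2" "j < N + 2" using uv by auto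
      obtain b w where bw: "y = (b, w)" by (metis surj_pair)
      have "bdist (b, w) (a, ?u i) < h" using le(1) r by (simp add: ij bw)
      moreover have "(a, ?u i) \<in> pts" using u[OF ij(3)] mem by blast
      ultimately have b: "b = a" using y bdist_less_iff[of b w a "?u i"] by (simp add: bw)
      have "seq_dist s w (?u i) \<le> s / 2 ^ Suc N" "seq_dist s w (?u j) \<le> s / 2 ^ Suc N"
        using le by (simp_all add: ij bw b mult.commute)
      then have "?u i N = ?u j N" unfolding seq_dist_le_iff[OF s(1)] by (metis lessI)
      then show ?thesis by (simp add: ij)
    qed
    show "\<exists>x\<in>mspace space. \<exists>r>0. \<exists>S. finite S \<and> N < card S \<and> S \<subseteq> mcball_of space x r \<and>
        (\<forall>y\<in>mspace space. \<forall>u\<in>S. \<forall>v\<in>S. mdist space y u \<le> r / 2 \<longrightarrow> mdist space y v \<le> r / 2 \<longrightarrow> u = v)"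
      using zero r card ball sep mem
      by (intro bexI[of _ "(a, \<lambda>n. 0)"] exI[of _ ?r] exI[of _ ?S] conjI ballI impI) auto
  qed
qed

section \<open>Intervals, as spaces of constant sequences\<close>

definition interval_metric :: "real \<Rightarrow> (nat \<Rightarrow> real) metric" where
  "interval_metric l = metric ((\<lambda>t n. t) ` {0..l}, \<lambda>x y. \<bar>x 0 - y 0\<bar>)"

lemma mspace_interval_metric [simp]: "mspace (interval_metric l) = (\<lambda>t n. t) ` {0..l}"
  and mdist_interval_metric [simp]: "mdist (interval_metric l) x y = \<bar>x 0 - y 0\<bar>"
proof -
  interpret Metric_space "(\<lambda>t n. t) ` {0..l}" "\<lambda>x y :: nat \<Rightarrow> real. \<bar>x 0 - y 0\<bar>"
    by unfold_locales (auto simp: fun_eq_iff)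
  show "mspace (interval_metric l) = (\<lambda>t n. t) ` {0..l}" "mdist (interval_metric l) x y = \<bar>x 0 - y 0\<bar>"
    by (simp_all add: interval_metric_def)
qed

lemma compact_metric_submetric_euclidean:
  fixes S :: "'a :: metric_space set"
  assumes "compact S" "S \<noteq> {}"
  shows "compact_metric (submetric euclidean_metric S)"
  using assms by (simp add: compact_metric_def mtopology_of_submetric compact_space_subtopology)

lemma isometric_interval_metric: "isometric (submetric euclidean_metric {0..l}) (interval_metric l)"
  unfolding isometric_def isometric_embedding_def by (intro exI[of _ "\<lambda>t n. t"]) (auto simp: dist_real_def)

lemma compact_metric_interval_metric: "0 \<le> l \<Longrightarrow> compact_metric (interval_metric l)"
  by (rule compact_metric_isometric[OF isometric_interval_metric]) (simp add: compact_metric_submetric_euclidean)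

lemma doubling_interval_metric: "doubling (interval_metric l)"
proof (rule doubling_isometric[OF isometric_interval_metric])
  let ?m = "submetric euclidean_metric {0..l}"
  have "\<exists>F. F \<subseteq> mspace ?m \<and> finite F \<and> card F \<le> 2 \<and> mcball_of ?m x r \<subseteq> (\<Union>y\<in>F. mcball_of ?m y (r / 2))"
    if x: "x \<in> mspace ?m" and r: "r > 0" for x r
  proof -
    \<comment> \<open>Retraction onto the interval. It does not increase distances to points of the
      interval, so the centres \<open>x - r / 2\<close> and \<open>x + r / 2\<close> of the two half
      balls may be moved inside.\<close>
    define p where "p t = max 0 (min l t)" for t
    let ?F = "{p (x - r / 2), p (x + r / 2)}"
    have "mcball_of ?m x r \<subseteq> (\<Union>y\<in>?F. mcball_of ?m y (r / 2))"
    proof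
      fix y assume "y \<in> mcball_of ?m x r"
      then have y: "0 \<le> y" "y \<le> l" "\<bar>x - y\<bar> \<le> r" by (auto simp: dist_real_def)
      have p: "\<bar>p t - y\<bar> \<le> \<bar>t - y\<bar>" for t using y(1,2) unfolding p_def by linarith
      have "\<bar>p (x - r / 2) - y\<bar> \<le> r / 2 \<or> \<bar>p (x + r / 2) - y\<bar> \<le> r / 2"
        using p[of "x - r / 2"] p[of "x + r / 2"] y(3) by linarith
      moreover have "p t \<in> {0..l}" for t using y(1,2) by (auto simp: p_def)
      ultimately show "y \<in> (\<Union>y\<in>?F. mcball_of ?m y (r / 2))" using y(1,2) by (auto simp: dist_real_def)
    qed
    moreover have "?F \<subseteq> mspace ?m" using x by (auto simp: p_def)
    moreover have "card ?F \<le> 2" by (simp add: card_insert_if)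
    ultimately show ?thesis by blast
  qed
  then have "N_doubling 2 ?m" unfolding N_doubling_def by blast
  then show "doubling ?m" unfolding doubling_def by blast
qed

lemma interval_metric_perfect:
  assumes "x \<in> mspace (interval_metric l)" "0 < r" "r < l / 2"
  shows "\<exists>y\<in>mspace (interval_metric l). 1 / 2 * r \<le> mdist (interval_metric l) x y \<and> mdist (interval_metric l) x y \<le> r"
proof -
  obtain t where t: "x = (\<lambda>n. t)" "0 \<le> t" "t \<le> l" using assms(1) by auto
  \<comment> \<open>On one side of \<open>t\<close> the interval has length at least
    \<open>l / 2\<close>, so a point at distance exactly \<open>r\<close> exists there.\<close>
  then show ?thesis using assms(2,3)
    by (intro bexI[of _ "\<lambda>n. if t \<le> l / 2 then t + r else t - r"]) auto
qed

lemma not_uniformly_disconnected_space: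
  fixes B :: "nat \<Rightarrow> (nat \<Rightarrow> real) metric"
  assumes bl: "blowup A d B h"
    and a: "a \<in> A" "B a = interval_metric l" and l: "l > 0"
  shows "\<not> uniformly_disconnected (blowup.space A d B)"
proof -
  interpret blowup A d B h by (fact bl)
  show ?thesis
    by (rule not_uniformly_disconnectedI[OF l, of "\<lambda>t. (a, \<lambda>n. t)"]) (use a in \<open>auto simp: mem_pts\<close>)
qed

section \<open>Binary sequences and the Cantor set\<close>

lemma seqs_2: "seqs (\<lambda>n. 2) = {x. \<forall>n. x n \<in> {0, 1}}"
proof -
  have "{..<2::nat} = {0, 1}" by auto
  then show ?thesis by (simp add: seqs_def)
qed

definition ternary :: "(nat \<Rightarrow> real) \<Rightarrow> real" where
  "ternary x = (\<Sum>n. 2 * x n / 3 ^ Suc n)"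

text \<open>The coefficients may be any reals between -1 and 1, because the estimate is applied to
  differences of binary sequences. A geometric series with sum \<open>1 / 3 ^ n\<close> dominates
  the tail.\<close>

lemma ternary_tail:
  fixes z :: "nat \<Rightarrow> real"
  assumes "\<And>n. \<bar>z n\<bar> \<le> 1"
  shows "summable (\<lambda>i. 2 * z i / 3 ^ Suc i)" and "\<bar>\<Sum>i. 2 * z (i + n) / 3 ^ Suc (i + n)\<bar> \<le> 1 / 3 ^ n"
proof -
  have s: "(\<lambda>i. 2 / 3 ^ Suc (i + n)) sums (1 / 3 ^ n :: real)" for n
    using sums_mult[OF geometric_sums[of "1 / 3 :: real"], of "2 / 3 ^ Suc n"]
    by (simp add: power_add power_divide field_simps)
  have le: "norm (2 * z (i + n) / 3 ^ Suc (i + n)) \<le> 2 / 3 ^ Suc (i + n)" for i n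
    using assms[of "i + n"] by (simp add: abs_mult divide_right_mono)
  show "summable (\<lambda>i. 2 * z i / 3 ^ Suc i)"
    using summable_comparison_test'[OF sums_summable[OF s[of 0]], of 0 "\<lambda>i. 2 * z i / 3 ^ Suc i"] le[of _ 0] by simp
  have "summable (\<lambda>i. norm (2 * z (i + n) / 3 ^ Suc (i + n)))"
    by (rule summable_comparison_test'[OF sums_summable[OF s[of n]], of 0]) (use le[of _ n] in simp)
  then have "\<bar>\<Sum>i. 2 * z (i + n) / 3 ^ Suc (i + n)\<bar> \<le> (\<Sum>i. norm (2 * z (i + n) / 3 ^ Suc (i + n)))"
    using summable_norm by fastforce
  also have "\<dots> \<le> (\<Sum>i. 2 / 3 ^ Suc (i + n))"
    by (rule suminf_le[OF le \<open>summable (\<lambda>i. norm _)\<close> sums_summable[OF s]])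
  also have "\<dots> = 1 / 3 ^ n" using s by (rule sums_unique[symmetric])
  finally show "\<bar>\<Sum>i. 2 * z (i + n) / 3 ^ Suc (i + n)\<bar> \<le> 1 / 3 ^ n" .
qed

lemma ternary_diff:
  assumes x: "x \<in> seqs (\<lambda>n. 2)" and y: "y \<in> seqs (\<lambda>n. 2)" and eq: "\<And>i. i < n \<Longrightarrow> x i = y i"
  shows "ternary x - ternary y = (\<Sum>i. 2 * (x (i + n) - y (i + n)) / 3 ^ Suc (i + n))"
    and "\<bar>ternary x - ternary y\<bar> \<le> 1 / 3 ^ n"
proof -
  have b: "\<bar>x i\<bar> \<le> 1" "\<bar>y i\<bar> \<le> 1" "\<bar>x i - y i\<bar> \<le> 1" for i
  proof -
    have "x i \<in> {0, 1}" "y i \<in> {0, 1}" using x y unfolding seqs_2 by blast+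
    then show "\<bar>x i\<bar> \<le> 1" "\<bar>y i\<bar> \<le> 1" "\<bar>x i - y i\<bar> \<le> 1" by auto
  qed
  have "ternary x - ternary y = (\<Sum>i. 2 * x i / 3 ^ Suc i - 2 * y i / 3 ^ Suc i)"
    unfolding ternary_def by (rule suminf_diff) (rule ternary_tail(1)[OF b(1)] ternary_tail(1)[OF b(2)])+
  also have "\<dots> = (\<Sum>i. 2 * (x i - y i) / 3 ^ Suc i)" by (simp add: diff_divide_distrib right_diff_distrib)
  also have "\<dots> = (\<Sum>i. 2 * (x (i + n) - y (i + n)) / 3 ^ Suc (i + n)) + (\<Sum>i<n. 2 * (x i - y i) / 3 ^ Suc i)"
    using suminf_split_initial_segment[OF ternary_tail(1)[of "\<lambda>i. x i - y i", OF b(3)], of n] by simp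
  also have "(\<Sum>i<n. 2 * (x i - y i) / 3 ^ Suc i) = 0" using eq by (intro sum.neutral) simp
  finally show *: "ternary x - ternary y = (\<Sum>i. 2 * (x (i + n) - y (i + n)) / 3 ^ Suc (i + n))" by simp
  show "\<bar>ternary x - ternary y\<bar> \<le> 1 / 3 ^ n"
    unfolding * using ternary_tail(2)[of "\<lambda>i. x i - y i", OF b(3)] by simp
qed

text \<open>At the first place \<open>n\<close> where two sequences differ, the digits contribute
  \<open>2 / 3 ^ Suc n\<close> in absolute value, while the rest of the series can cancel at most
  \<open>1 / 3 ^ Suc n\<close>.\<close>

lemma inj_on_ternary: "inj_on ternary (seqs (\<lambda>n. 2))"
proof (rule inj_onI, rule ccontr)
  fix x y assume x: "x \<in> seqs (\<lambda>n. 2)" and y: "y \<in> seqs (\<lambda>n. 2)" and eq: "ternary x = ternary y" and ne: "x \<noteq> y"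
  define n where "n = (LEAST n. x n \<noteq> y n)"
  have "\<exists>n. x n \<noteq> y n" using ne by auto
  then have n: "x n \<noteq> y n" unfolding n_def by (rule LeastI_ex)
  have n': "x i = y i" if "i < n" for i using not_less_Least[OF that[unfolded n_def]] by blast
  let ?D = "\<lambda>i. 2 * (x i - y i) / 3 ^ Suc i"
  have xy: "x i \<in> {0, 1}" "y i \<in> {0, 1}" for i using x y unfolding seqs_2 by blast+
  have b: "\<bar>x i - y i\<bar> \<le> 1" for i using xy[of i] by auto
  have "(\<Sum>i. ?D (i + n)) = 0" using ternary_diff(1)[OF x y n'] eq by simp
  moreover have "summable (\<lambda>i. ?D (i + n))"
    using ternary_tail(1)[of "\<lambda>i. x i - y i", OF b] by (rule summable_ignore_initial_segment)
  then have "(\<Sum>i. ?D (Suc i + n)) = (\<Sum>i. ?D (i + n)) - ?D (0 + n)" by (rule suminf_split_head)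
  ultimately have "(\<Sum>i. ?D (i + Suc n)) = - ?D n" by (simp only: add_Suc add_Suc_right add_0 diff_0)
  then have "\<bar>?D n\<bar> = \<bar>\<Sum>i. ?D (i + Suc n)\<bar>" by (simp only: abs_minus_cancel)
  also have "\<dots> \<le> 1 / 3 ^ Suc n" by (rule ternary_tail(2)[of "\<lambda>i. x i - y i", OF b])
  finally have "\<bar>?D n\<bar> \<le> 1 / 3 ^ Suc n" .
  moreover have "\<bar>x n - y n\<bar> = 1" using xy[of n] n by auto
  then have "\<bar>?D n\<bar> = 2 / 3 ^ Suc n" by (simp add: abs_mult)
  ultimately show False by (simp add: divide_le_cancel)
qed

lemma ternary_image: "ternary ` seqs (\<lambda>n. 2) = cantor_set"
proof (intro equalityI subsetI)
  fix t assume "t \<in> ternary ` seqs (\<lambda>n. 2)"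
  then obtain x where x: "x \<in> seqs (\<lambda>n. 2)" "t = ternary x" by blast
  then have x01: "x n \<in> {0, 1}" for n unfolding seqs_2 by blast
  have "\<bar>x n\<bar> \<le> 1" for n using x01[of n] by auto
  then have "(\<lambda>n. 2 * x n / 3 ^ Suc n) sums t"
    unfolding x(2) ternary_def by (intro summable_sums ternary_tail(1))
  moreover have "2 * x n \<in> {0, 2}" for n using x01[of n] by auto
  ultimately show "t \<in> cantor_set"
    unfolding cantor_set_def by (intro CollectI exI[of _ "\<lambda>n. 2 * x n"] conjI allI)
next
  fix t assume "t \<in> cantor_set"
  then obtain a where a: "\<forall>n. a n \<in> {0, 2}" "(\<lambda>n. a n / 3 ^ Suc n) sums t"
    unfolding cantor_set_def mem_Collect_eq by (elim exE conjE) (rule that)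
  have "a n / 2 \<in> {0, 1}" for n using spec[OF a(1), of n] by auto
  then have "(\<lambda>n. a n / 2) \<in> seqs (\<lambda>n. 2)" unfolding seqs_2 by blast
  moreover have "t = ternary (\<lambda>n. a n / 2)" using sums_unique[OF a(2)] by (simp add: ternary_def)
  ultimately show "t \<in> ternary ` seqs (\<lambda>n. 2)" by blast
qed

text \<open>Only the continuity of \<open>ternary\<close> has to be estimated; compactness takes
  care of the inverse.\<close>

lemma cantor_metric_seq_metric:
  assumes s: "s > 0"
  shows "cantor_metric (seq_metric s (\<lambda>n. 2))"
proof -
  have "continuous_map (mtopology_of (seq_metric s (\<lambda>n. 2))) (mtopology_of (submetric euclidean_metric cantor_set)) ternary"
  proof (rule continuous_map_mtopology_ofI)
    fix x and \<epsilon> :: real assume x: "x \<in> mspace (seq_metric s (\<lambda>n. 2))" and e: "\<epsilon> > 0"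
    obtain n where n: "(1 / 3) ^ n < \<epsilon>" using real_arch_pow_inv[OF e, of "1 / 3"] by auto
    have "dist (ternary x) (ternary y) < \<epsilon>" if "y \<in> seqs (\<lambda>n. 2)" "seq_dist s x y < s / 2 ^ n" for y
    proof -
      have "\<forall>i<n. x i = y i" using that(2) seq_dist_le_iff[OF s, of x y n] by simp
      then show ?thesis using ternary_diff(2)[of x y n] x s that n by (simp add: dist_real_def power_divide)
    qed
    then show "\<exists>\<delta>>0. \<forall>y\<in>mspace (seq_metric s (\<lambda>n. 2)). mdist (seq_metric s (\<lambda>n. 2)) x y < \<delta> \<longrightarrow>
        mdist (submetric euclidean_metric cantor_set) (ternary x) (ternary y) < \<epsilon>"
      using s by (intro exI[of _ "s / 2 ^ n"]) simp
  qed (use s ternary_image in auto)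
  moreover have "bij_betw ternary (mspace (seq_metric s (\<lambda>n. 2))) (mspace (submetric euclidean_metric cantor_set))"
    using s inj_on_ternary ternary_image by (simp add: bij_betw_def)
  ultimately have "mtopology_of (seq_metric s (\<lambda>n. 2)) homeomorphic_space
      mtopology_of (submetric euclidean_metric cantor_set)"
    by (rule compact_metric_homeomorphic_spaceI[rotated]) (simp add: compact_metric_seq_metric s)
  then show ?thesis by (simp add: cantor_metric_def mtopology_of_submetric)
qed

text \<open>
  Prefixing the binary expansion of the index of the piece turns a point of the blow-up into a single
  binary sequence.
\<close>

lemma cantor_metric_space:
  fixes B :: "nat \<Rightarrow> (nat \<Rightarrow> real) metric"
  assumes bl: "blowup A d B h"
    and card: "card A = 2 ^ K" and s: "s > 0" and BA: "\<And>a. a \<in> A \<Longrightarrow> B a = seq_metric s (\<lambda>n. 2)"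
  shows "cantor_metric (blowup.space A d B)"
proof -
  interpret blowup A d B h by (fact bl)
  let ?P = "{..<K} \<rightarrow>\<^sub>E {0, 1 :: real}" and ?C = "seqs (\<lambda>n. 2)"
  have "card ?P = 2 ^ K" by (simp add: card_PiE numeral_2_eq_2)
  then obtain e where e: "bij_betw e A ?P"
    using finite_same_card_bij[OF A(1), of ?P] card by (auto simp: finite_PiE)
  define code where "code p n = (if n < K then e (fst p) n else snd p (n - K))" for p n
  have mem: "(a, x) \<in> pts \<longleftrightarrow> a \<in> A \<and> x \<in> ?C" for a x using BA s by (auto simp: mem_pts)
  have eP: "e a \<in> ?P" if "a \<in> A" for a using e that by (rule bij_betw_apply)
  have code_mem: "code p \<in> ?C" if "p \<in> pts" for p
  proof -
    obtain a x where "p = (a, x)" by (metis surj_pair)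
    moreover from this that have "a \<in> A" "x \<in> ?C" using mem by auto
    ultimately show ?thesis using eP[of a] unfolding seqs_2 by (auto simp: code_def PiE_iff)
  qed
  have inj: "inj_on code pts"
  proof (rule inj_onI)
    fix p q assume pq: "p \<in> pts" "q \<in> pts" and eq: "code p = code q"
    obtain a x b y where ab: "p = (a, x)" "q = (b, y)" by (metis surj_pair)
    have ab': "a \<in> A" "b \<in> A" using pq mem by (auto simp: ab)
    have "e a i = e b i" for i
    proof (cases "i < K")
      case True
      then show ?thesis using fun_cong[OF eq, of i] by (simp add: code_def ab)
    next
      case False
      then show ?thesis using eP ab' by (simp add: PiE_iff extensional_def)
    qed
    then have "e a = e b" by blast
    then have "a = b" using e ab' by (auto simp: bij_betw_def dest: inj_onD)
    moreover have "x i = y i" for i using fun_cong[OF eq, of "i + K"] by (simp add: code_def ab)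
    then have "x = y" by blast
    ultimately show "p = q" by (simp add: ab)
  qed
  have surj: "code ` pts = ?C"
  proof (intro equalityI subsetI)
    fix z assume z: "z \<in> ?C"
    have "restrict z {..<K} \<in> ?P" using z unfolding seqs_2 by auto
    then have "restrict z {..<K} \<in> e ` A" using e by (simp add: bij_betw_def)
    then obtain a where a: "a \<in> A" "e a = restrict z {..<K}" by (metis imageE)
    have "(a, \<lambda>n. z (n + K)) \<in> pts" using a(1) z unfolding mem seqs_2 by simp
    moreover have "code (a, \<lambda>n. z (n + K)) = z" by (auto simp: code_def a(2))
    ultimately show "z \<in> code ` pts" by (metis image_eqI)
  qed (use code_mem in auto)
  have "continuous_map (mtopology_of space) (mtopology_of (seq_metric s (\<lambda>n. 2))) code"
  proof (rule continuous_map_mtopology_ofI)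
    fix p and \<epsilon> :: real assume p: "p \<in> mspace space" and \<epsilon>: "\<epsilon> > 0"
    obtain n where "(1 / 2) ^ n < \<epsilon> / s" using real_arch_pow_inv[of "\<epsilon> / s" "1 / 2"] \<epsilon> s by auto
    then have n: "s / 2 ^ n < \<epsilon>" using s by (simp add: field_simps)
    \<comment> \<open>Below \<open>h\<close> both points are in the same piece, so their codes share
      the first \<open>K\<close> digits; the shift by \<open>K\<close> can only lengthen the common
      prefix of the second components.\<close>
    have "seq_dist s (code p) (code q) < \<epsilon>" if q: "q \<in> pts" "bdist p q < min h (s / 2 ^ n)" for q
    proof -
      obtain a x b y where ab: "p = (a, x)" "q = (b, y)" by (metis surj_pair)
      have b: "b = a" "a \<in> A" using p q bdist_less_iff[of a x b y] mem by (auto simp: ab)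
      then have "seq_dist s x y < s / 2 ^ n" using q s BA by (simp add: ab)
      then have "\<forall>i<n. x i = y i" using seq_dist_le_iff[OF s, of x y n] by simp
      then have "\<forall>i<n. code p i = code q i" by (auto simp: code_def ab b)
      then show ?thesis using seq_dist_le_iff[OF s, of "code p" "code q" n] n by simp
    qed
    then show "\<exists>\<delta>>0. \<forall>q\<in>mspace space. mdist space p q < \<delta> \<longrightarrow> mdist (seq_metric s (\<lambda>n. 2)) (code p) (code q) < \<epsilon>"
      using s h by (intro exI[of _ "min h (s / 2 ^ n)"]) simp
  qed (use s code_mem in simp)
  moreover have "bij_betw code (mspace space) (mspace (seq_metric s (\<lambda>n. 2)))"
    using s inj surj by (simp add: bij_betw_def)
  ultimately have "mtopology_of space homeomorphic_space mtopology_of (seq_metric s (\<lambda>n. 2))"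
    by (rule compact_metric_homeomorphic_spaceI[OF compact_metric_space])
  then show ?thesis
    using cantor_metric_seq_metric[OF s] homeomorphic_space_trans unfolding cantor_metric_def by blast
qed

section \<open>Families with prescribed pieces\<close>

text \<open>The indices from \<open>k\<close> on are the points added around \<open>e 0\<close>.
  Their heights will be at most \<open>2 * N * h\<close>, so \<open>sep\<close> makes the cluster
  smaller than every distance between the points \<open>e i\<close>.\<close>

locale cluster_family =
  fixes m :: "'a metric" and e :: "nat \<Rightarrow> 'a" and k N :: nat and h :: real and B :: "nat \<Rightarrow> 'b metric"
  assumes m: "compact_metric m" and k: "k > 0" and h: "h > 0"
    and e: "\<And>i. i < k \<Longrightarrow> e i \<in> mspace m"
    and sep: "\<And>i j. i < k \<Longrightarrow> j < k \<Longrightarrow> i \<noteq> j \<Longrightarrow> (2 * N + 2) * h < mdist m (e i) (e j)"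
    and B: "\<And>a. a < k + N \<Longrightarrow> compact_metric (B a)"
    and B_small: "\<And>a x y. a < k + N \<Longrightarrow> x \<in> mspace (B a) \<Longrightarrow> y \<in> mspace (B a) \<Longrightarrow> mdist (B a) x y < h"
begin

definition base :: "nat \<Rightarrow> nat" where
  "base a = (if a < k then a else 0)"

text \<open>Heights of different cluster points range over intervals separated by gaps of length
  \<open>h\<close>, and none is below \<open>h\<close>, as a blow-up demands. The value 0 at the
  points \<open>e i\<close> makes the \<open>max\<close> in \<open>cdist\<close> return the height
  of a cluster point as its distance from \<open>e 0\<close>.\<close>

definition height :: "(nat \<Rightarrow> real) \<Rightarrow> nat \<Rightarrow> real" where
  "height q a = (if a < k then 0 else h * (2 * real (a - k) + 1 + q (a - k)))"

definition cdist :: "(nat \<Rightarrow> real) \<Rightarrow> nat \<Rightarrow> nat \<Rightarrow> real" where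
  "cdist q a b = (if a = b then 0 else if base a = base b then max (height q a) (height q b)
     else mdist m (e (base a)) (e (base b)))"

abbreviation cspace :: "(nat \<Rightarrow> real) \<Rightarrow> (nat \<times> 'b) metric" where
  "cspace q \<equiv> blowup.space {..<k + N} (cdist q) B"

lemma base_less: "base a < k"
  using k by (simp add: base_def)

lemma height_nonneg: "q \<in> hilbert_cube \<Longrightarrow> 0 \<le> height q a"
  using h by (simp add: height_def mem_hilbert_cube)

lemma height_ge:
  assumes "q \<in> hilbert_cube" "k \<le> a"
  shows "h \<le> height q a"
proof -
  have "0 \<le> q (a - k)" using assms(1) by (simp add: mem_hilbert_cube)
  then have "h * 1 \<le> h * (2 * real (a - k) + 1 + q (a - k))" using h by (intro mult_left_mono) auto
  then show ?thesis using assms(2) by (simp add: height_def)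
qed

lemma height_le:
  assumes "q \<in> hilbert_cube" "a < k + N"
  shows "height q a \<le> 2 * N * h"
proof (cases "a < k")
  case False
  have "2 * real (a - k) + 1 + q (a - k) \<le> 2 * N"
    using assms False unfolding mem_hilbert_cube by (auto intro: order_trans[OF add_left_mono[of _ 1]])
  then have "h * (2 * real (a - k) + 1 + q (a - k)) \<le> h * (2 * N)" using h by (intro mult_left_mono) auto
  then show ?thesis using False by (simp add: height_def mult_ac)
qed (use h in \<open>simp add: height_def\<close>)

lemma sep_base: "base a \<noteq> base b \<Longrightarrow> (2 * N + 2) * h < mdist m (e (base a)) (e (base b))"
  by (rule sep[OF base_less base_less])

lemma sep_base': "base a \<noteq> base b \<Longrightarrow> 2 * N * h < mdist m (e (base a)) (e (base b))"
  using sep_base[of a b] h by (simp add: algebra_simps)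

lemma same_base: "base a = base b \<Longrightarrow> a \<noteq> b \<Longrightarrow> k \<le> a \<or> k \<le> b"
  by (auto simp: base_def split: if_splits)

lemma blowup_cdist:
  assumes q: "q \<in> hilbert_cube"
  shows "blowup {..<k + N} (cdist q) B h"
proof
  show "finite {..<k + N}" "{..<k + N} \<noteq> {}" "h > 0" using k h by auto
  fix a b c
  show "cdist q a b = cdist q b a" by (simp add: cdist_def max.commute mdist_commute eq_commute)
  show "0 \<le> cdist q a b" using height_nonneg[OF q, of a] by (simp add: cdist_def le_max_iff_disj)
  show "h \<le> cdist q a b" if "a \<noteq> b"
  proof (cases "base a = base b")
    case True
    then show ?thesis
      using that same_base[OF True that] height_ge[OF q, of a] height_ge[OF q, of b] by (auto simp: cdist_def le_max_iff_disj)
  next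
    case False
    have "1 * h \<le> (2 * N + 2) * h" using h by (intro mult_right_mono) auto
    then show ?thesis using that False sep_base[OF False] by (simp add: cdist_def)
  qed
  show "cdist q a c \<le> cdist q a b + cdist q b c"
    if abc: "a \<in> {..<k + N}" "b \<in> {..<k + N}" "c \<in> {..<k + N}" "a \<noteq> b" "b \<noteq> c" "a \<noteq> c"
  proof -
    have nn: "0 \<le> height q x" for x by (rule height_nonneg[OF q])
    have le: "height q a \<le> 2 * N * h" "height q c \<le> 2 * N * h" using abc height_le[OF q] by auto
    consider "base a = base b" "base b = base c" | "base a = base b" "base b \<noteq> base c"
      | "base a \<noteq> base b" "base b = base c" | "base a = base c" "base a \<noteq> base b"
      | "base a \<noteq> base b" "base b \<noteq> base c" "base a \<noteq> base c" by metis
    then show ?thesis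
    proof cases
      case 1
      then show ?thesis using abc nn[of a] nn[of b] nn[of c] by (simp add: cdist_def max_def)
    next
      case 2
      then show ?thesis using abc nn[of a] nn[of b] by (simp add: cdist_def)
    next
      case 3
      then show ?thesis using abc nn[of b] nn[of c] by (simp add: cdist_def)
    next
      \<comment> \<open>The end points lie in the cluster and the middle one does not: the cluster
        has diameter at most \<open>2 * N * h\<close>, less than its distance from any other
        point.\<close>
      case 4
      have "cdist q a c \<le> 2 * N * h" using abc 4 le by (simp add: cdist_def)
      moreover have "2 * N * h \<le> cdist q a b" using abc 4 sep_base'[of a b] by (simp add: cdist_def)
      moreover have "0 \<le> cdist q b c" using nn[of b] by (simp add: cdist_def le_max_iff_disj)
      ultimately show ?thesis by simp
    next
      case 5
      then show ?thesis using abc mdist_triangle[of "e (base a)" m "e (base b)" "e (base c)"] e base_less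
        by (simp add: cdist_def)
    qed
  qed
qed (use B B_small in auto)

lemma
  assumes q: "q \<in> hilbert_cube"
  shows compact_metric_space: "compact_metric (cspace q)"
    and mspace_space: "mspace (cspace q) = (SIGMA a:{..<k + N}. mspace (B a))"
    and mdist_space: "mdist (cspace q) (a, x) (b, y) = (if a = b then mdist (B a) x y else cdist q a b)"
proof -
  interpret blowup "{..<k + N}" "cdist q" B h by (rule blowup_cdist[OF q])
  show "compact_metric (cspace q)" by (rule compact_metric_space)
  show "mspace (cspace q) = (SIGMA a:{..<k + N}. mspace (B a))" by (simp add: pts_def)
  show "mdist (cspace q) (a, x) (b, y) = (if a = b then mdist (B a) x y else cdist q a b)" by (simp add: bdist_def)
qed

text \<open>For comparable parameters the two spaces have the same points and comparable distances,
  as \<open>gh_dist_le_of_mdist_le\<close> requires.\<close>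

lemma gh_dist_space_mono:
  assumes q: "q \<in> hilbert_cube" "q' \<in> hilbert_cube" and le: "\<And>i. q i \<le> q' i"
  shows "gh_dist (cspace q) (cspace q') \<le> h * (\<Sum>i<N. \<bar>q i - q' i\<bar>)"
proof (rule gh_dist_le_of_mdist_le)
  let ?s = "h * (\<Sum>i<N. \<bar>q i - q' i\<bar>)"
  show s: "0 \<le> ?s" using h by (simp add: sum_nonneg)
  have h1: "height q a \<le> height q' a" for a using le h by (simp add: height_def)
  have h2: "height q' a \<le> height q a + ?s" if "a < k + N" for a
  proof (cases "a < k")
    case True
    then show ?thesis using s by (simp add: height_def)
  next
    case False
    have "\<bar>q (a - k) - q' (a - k)\<bar> \<le> (\<Sum>i<N. \<bar>q i - q' i\<bar>)"
      using False that by (intro member_le_sum) auto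
    then have "h * (q' (a - k) - q (a - k)) \<le> ?s" using h by (intro mult_left_mono) auto
    then show ?thesis using False by (simp add: height_def algebra_simps)
  qed
  have c: "cdist q a b \<le> cdist q' a b" "a < k + N \<Longrightarrow> b < k + N \<Longrightarrow> cdist q' a b \<le> cdist q a b + 2 * ?s" for a b
    using h1[of a] h1[of b] h2[of a] h2[of b] s by (auto simp: cdist_def)
  fix p p' assume "p \<in> mspace (cspace q)" "p' \<in> mspace (cspace q)"
  then obtain a x b y where p: "p = (a, x)" "p' = (b, y)" "a < k + N" "b < k + N"
    unfolding mspace_space[OF q(1)] by auto
  show "mdist (cspace q) p p' \<le> mdist (cspace q') p p'" "mdist (cspace q') p p' \<le> mdist (cspace q) p p' + 2 * ?s"
    using c[of a b] p(3,4) s unfolding p(1,2) mdist_space[OF q(1)] mdist_space[OF q(2)] by auto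
qed (use q in \<open>simp_all add: compact_metric_space mspace_space\<close>)

lemma dist_gh_class_space_le:
  assumes q: "q \<in> hilbert_cube" "q' \<in> hilbert_cube"
  shows "dist (gh_class (cspace q)) (gh_class (cspace q')) \<le> h * (\<Sum>i<N. \<bar>q i - q' i\<bar>)"
proof -
  \<comment> \<open>The pointwise maximum is comparable with both parameters, and the detour through
    it costs nothing: \<open>\<bar>q i - p i\<bar> + \<bar>q' i - p i\<bar> = \<bar>q i - q'
    i\<bar>\<close>.\<close>
  define p where "p i = max (q i) (q' i)" for i
  have p: "p \<in> hilbert_cube" using q by (auto simp: p_def mem_hilbert_cube le_max_iff_disj)
  have "dist (gh_class (cspace q)) (gh_class (cspace q')) \<le>
      dist (gh_class (cspace q)) (gh_class (cspace p)) + dist (gh_class (cspace q')) (gh_class (cspace p))"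
    by (rule dist_triangle2)
  also have "\<dots> \<le> h * (\<Sum>i<N. \<bar>q i - p i\<bar>) + h * (\<Sum>i<N. \<bar>q' i - p i\<bar>)"
    using gh_dist_space_mono[OF q(1) p] gh_dist_space_mono[OF q(2) p] compact_metric_space q p
    by (intro add_mono) (auto simp: dist_gh_class p_def)
  also have "\<dots> = h * (\<Sum>i<N. \<bar>q i - p i\<bar> + \<bar>q' i - p i\<bar>)" by (simp add: sum.distrib distrib_left)
  also have "(\<Sum>i<N. \<bar>q i - p i\<bar> + \<bar>q' i - p i\<bar>) = (\<Sum>i<N. \<bar>q i - q' i\<bar>)"
    by (intro sum.cong) (auto simp: p_def max_def)
  finally show ?thesis .
qed

lemma piece_nonempty: "a < k + N \<Longrightarrow> \<exists>x. x \<in> mspace (B a)"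
  using B[of a] by (auto simp: compact_metric_def)

text \<open>
  The only distance of \<open>cspace q\<close> in the interval \<open>[(2 i + 1) h, (2 i + 2) h]\<close> is \<open>(2 i + 1 + q i) h\<close>.
\<close>

lemma isometric_space_imp_eq:
  assumes q: "q \<in> hilbert_cube" "q' \<in> hilbert_cube" and iso: "isometric (cspace q) (cspace q')" and i: "i < N"
  shows "q i = q' i"
proof -
  obtain x y where x: "x \<in> mspace (B 0)" and y: "y \<in> mspace (B (k + i))"
    using piece_nonempty[of 0] piece_nonempty[of "k + i"] k i by auto
  let ?t = "h * (2 * real i + 1 + q i)"
  have q01: "0 \<le> q i" "q i \<le> 1" "0 \<le> q' j" "q' j \<le> 1" for j using q by (auto simp: mem_hilbert_cube)
  have "0 \<le> ?t" using h q01 by simp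
  then have "mdist (cspace q) (0, x) (k + i, y) = ?t"
    unfolding mdist_space[OF q(1)] using k by (auto simp: cdist_def base_def height_def max_def)
  moreover have "(0, x) \<in> mspace (cspace q)" "(k + i, y) \<in> mspace (cspace q)"
    unfolding mspace_space[OF q(1)] using x y i k by auto
  ultimately have "?t \<in> {mdist (cspace q) x y | x y. x \<in> mspace (cspace q) \<and> y \<in> mspace (cspace q)}" by force
  then have "?t \<in> {mdist (cspace q') x y | x y. x \<in> mspace (cspace q') \<and> y \<in> mspace (cspace q')}"
    unfolding isometric_imp_mdist_image_eq[OF iso] .
  then obtain p p' where "?t = mdist (cspace q') p p'" "p \<in> mspace (cspace q')" "p' \<in> mspace (cspace q')" by blast
  moreover obtain a x b y where p: "p = (a, x)" "p' = (b, y)" by (metis surj_pair)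
  ultimately have t: "?t = (if a = b then mdist (B a) x y else cdist q' a b)"
    and ab: "a < k + N" "b < k + N" "x \<in> mspace (B a)" "y \<in> mspace (B b)"
    unfolding p mdist_space[OF q(2)] mspace_space[OF q(2)] by auto
  \<comment> \<open>\<open>?t\<close> is at least \<open>h\<close>, too large for a distance inside
    a piece, and at most \<open>h * (2 * N + 2)\<close>, too small for points with different bases;
    so it is a height.\<close>
  have "h * 1 \<le> ?t" using h q01 by (intro mult_left_mono) auto
  then have ne: "a \<noteq> b" using t B_small[of a x y] ab by auto
  have "?t \<le> h * (2 * N + 2)" using h q01 i by (intro mult_left_mono) auto
  then have "base a = base b" using t ne sep_base[of a b] by (cases "base a = base b") (simp_all add: cdist_def mult.commute)
  then have "?t = max (height q' a) (height q' b)" using t ne by (simp add: cdist_def)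
  then obtain c where c: "?t = height q' c" by (metis max_def)
  then have "height q' c \<noteq> 0" using \<open>h * 1 \<le> ?t\<close> h by linarith
  then have "k \<le> c" by (simp add: height_def split: if_splits)
  then have "?t = h * (2 * real (c - k) + 1 + q' (c - k))" using c by (simp add: height_def)
  then have eq: "2 * real i + q i = 2 * real (c - k) + q' (c - k)" using h by simp
  \<comment> \<open>Twice an integer plus a number between 0 and 1 determines the integer.\<close>
  then have "\<bar>real i - real (c - k)\<bar> < 1" using q01(1,2) q01(3,4)[of "c - k"] by linarith
  then have "i = c - k" by linarith
  then show ?thesis using eq by simp
qed

text \<open>The points \<open>e i\<close> form a net in \<open>m\<close>, and one point from each of
  the first \<open>k\<close> pieces forms an isometric net in \<open>cspace q\<close>. Each space is
  within \<open>r\<close> of its net.\<close>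

lemma dist_gh_class_space:
  assumes q: "q \<in> hilbert_cube" and r: "(2 * N + 2) * h < r"
    and net: "\<And>x. x \<in> mspace m \<Longrightarrow> \<exists>i<k. mdist m x (e i) < r"
  shows "dist (gh_class m) (gh_class (cspace q)) \<le> 2 * r"
proof -
  obtain w where w: "\<And>a. a < k + N \<Longrightarrow> w a \<in> mspace (B a)" using piece_nonempty by metis
  let ?E = "e ` {..<k}" and ?F = "(\<lambda>i. (i, w i)) ` {..<k}"
  have finite_closed: "closedin (mtopology_of m') S" if "finite S" "S \<subseteq> mspace m'" for m' :: "'x metric" and S
  proof -
    interpret Metric_space "mspace m'" "mdist m'" by simp
    show ?thesis using that unfolding mtopology_of_def
      by (intro compactin_imp_closedin Hausdorff_space_mtopology finite_imp_compactin) auto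
  qed
  have E: "closedin (mtopology_of m) ?E" "?E \<noteq> {}" using finite_closed[of ?E m] e k by auto
  have Fsub: "?F \<subseteq> mspace (cspace q)" unfolding mspace_space[OF q] using w by auto
  then have F: "closedin (mtopology_of (cspace q)) ?F" "?F \<noteq> {}" using finite_closed[of ?F "cspace q"] k by auto
  have r2: "2 * N * h < r" "h < r"
  proof -
    have "1 * h \<le> (2 * N + 2) * h" "2 * N * h \<le> (2 * N + 2) * h" using h by (intro mult_right_mono; simp)+
    then show "2 * N * h < r" "h < r" using r by linarith+
  qed
  have "isometric (submetric (cspace q) ?F) (submetric m ?E)"
    unfolding isometric_def
  proof (intro exI[of _ "\<lambda>p. e (fst p)"] conjI)
    have "mdist (cspace q) (i, w i) (j, w j) = mdist m (e i) (e j)" if "i < k" "j < k" for i j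
      unfolding mdist_space[OF q] using that e[of i] w[of i] by (auto simp: cdist_def base_def)
    then show "isometric_embedding (submetric (cspace q) ?F) (submetric m ?E) (\<lambda>p. e (fst p))"
      using e by (auto simp: isometric_embedding_def)
    show "(\<lambda>p. e (fst p)) ` mspace (submetric (cspace q) ?F) = mspace (submetric m ?E)"
      using Fsub e by (force simp: image_iff Int_absorb2)
  qed
  then have eq: "gh_class (submetric (cspace q) ?F) = gh_class (submetric m ?E)"
    by (rule gh_class_eqI[OF compact_metric_submetric[OF compact_metric_space[OF q] F]])
  have 1: "dist (gh_class m) (gh_class (submetric m ?E)) \<le> r"
    unfolding dist_gh_class[OF m compact_metric_submetric[OF m E]]
    using net by (intro gh_dist_submetric_le[OF m E]) auto
  have 2: "dist (gh_class (cspace q)) (gh_class (submetric (cspace q) ?F)) \<le> r"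
    unfolding dist_gh_class[OF compact_metric_space[OF q] compact_metric_submetric[OF compact_metric_space[OF q] F]]
  proof (rule gh_dist_submetric_le[OF compact_metric_space[OF q] F])
    fix p assume "p \<in> mspace (cspace q)"
    then obtain a x where p: "p = (a, x)" "a < k + N" "x \<in> mspace (B a)" unfolding mspace_space[OF q] by auto
    have "mdist (cspace q) p (base a, w (base a)) < r"
    proof (cases "a < k")
      case True
      then show ?thesis
        unfolding p(1) mdist_space[OF q] using B_small[OF p(2,3) w[OF p(2)]] r2 by (simp add: base_def)
    next
      case False
      then have "mdist (cspace q) p (base a, w (base a)) = max (height q a) 0"
        unfolding p(1) mdist_space[OF q] using k by (simp add: base_def cdist_def height_def)
      then show ?thesis using height_le[OF q p(2)] height_nonneg[OF q, of a] r2 by simp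
    qed
    then show "\<exists>y\<in>?F. mdist (cspace q) p y < r" using base_less by blast
  qed
  show ?thesis
    using dist_triangle2[of "gh_class m" "gh_class (cspace q)" "gh_class (submetric m ?E)"] 1 2 eq by simp
qed

end

text \<open>
  The indices \<open>k, k + 1, \<dots>\<close> of the cluster make room for the bad pieces, and a number \<open>2 ^ K\<close> of
  pieces allows for indexing them by binary words.
\<close>

lemma infinite_dimensional_of_pieces:
  fixes S U :: "ghspace set"
  assumes pieces: "\<And>k N K h. k > 0 \<Longrightarrow> 4 \<le> N \<Longrightarrow> k + N = 2 ^ K \<Longrightarrow> h > 0 \<Longrightarrow>
      \<exists>B :: nat \<Rightarrow> 'b metric. (\<forall>a<k + N. compact_metric (B a) \<and>
          (\<forall>x\<in>mspace (B a). \<forall>y\<in>mspace (B a). mdist (B a) x y < h)) \<and>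
        (\<forall>d. blowup {..<k + N} d B h \<longrightarrow> gh_class (blowup.space {..<k + N} d B) \<in> S)"
    and U: "open U" "U \<noteq> {}"
  shows "infinite_dimensional (top_of_set (S \<inter> U))"
  unfolding infinite_dimensional_def
proof
  fix n
  obtain X where "X \<in> U" using U(2) by blast
  then obtain \<epsilon> where \<epsilon>: "\<epsilon> > 0" "ball X \<epsilon> \<subseteq> U" using U(1) open_contains_ball by blast
  obtain m :: "real metric" where X: "compact_metric m" "X = gh_class m" by (rule gh_class_surj)
  define r where "r = \<epsilon> / 3"
  have r: "r > 0" "2 * r < \<epsilon>" using \<epsilon> by (auto simp: r_def)
  obtain E where E: "finite E" "E \<subseteq> mspace m" "E \<noteq> {}" "\<And>x. x \<in> mspace m \<Longrightarrow> \<exists>y\<in>E. mdist m x y < r"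
    using compact_metric_finite_net[OF X(1) r(1)] by blast
  define k where "k = card E"
  have k: "k > 0" using E by (simp add: k_def card_gt_0_iff)
  obtain e where bij: "bij_betw e {..<k} E" using ex_bij_betw_nat_finite[OF E(1)] unfolding k_def atLeast0LessThan by blast
  \<comment> \<open>\<open>K < 2 ^ K\<close> gives \<open>N \<ge> n + 6\<close>: more parameters
    than \<open>n\<close>, and room for the bad pieces.\<close>
  define K where "K = k + n + 5"
  define N where "N = 2 ^ K - k"
  have "K < 2 ^ K" by (rule less_exp)
  then have N: "k + N = 2 ^ K" "4 \<le> N" "n < N" using K_def N_def by linarith+
  \<comment> \<open>Everything that \<open>(2 * N + 2) * h\<close> has to stay below: the distances
    between points of \<open>E\<close>, and \<open>r\<close>, which bounds the displacement. With
    \<open>r\<close> the set is nonempty even if \<open>E\<close> is a single point.\<close>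
  define D where "D = insert r ((\<lambda>(x, y). mdist m x y) ` {(x, y) \<in> E \<times> E. x \<noteq> y})"
  have finD: "finite D" unfolding D_def using E(1) by (auto intro: finite_subset[of _ "E \<times> E"])
  have posD: "t > 0" if "t \<in> D" for t using that r E(2) by (auto simp: D_def intro!: Metric_space.mdist_pos_less[OF Metric_space_mspace_mdist])
  define h where "h = Min D / (2 * N + 3)"
  have Min: "Min D > 0" using posD Min_in[OF finD] by (auto simp: D_def)
  then have h: "h > 0" by (simp add: h_def)
  have hD: "(2 * N + 2) * h < t" if "t \<in> D" for t
  proof -
    have "(2 * N + 2) * h < (2 * N + 3) * h" using h by simp
    also have "\<dots> = Min D" by (simp add: h_def)
    also have "\<dots> \<le> t" using finD that by simp
    finally show ?thesis .
  qed
  obtain B :: "nat \<Rightarrow> 'b metric" where pieces_ok: "\<And>a. a < k + N \<Longrightarrow> compact_metric (B a)"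
      "\<And>a x y. a < k + N \<Longrightarrow> x \<in> mspace (B a) \<Longrightarrow> y \<in> mspace (B a) \<Longrightarrow> mdist (B a) x y < h"
      "\<And>d. blowup {..<k + N} d B h \<Longrightarrow> gh_class (blowup.space {..<k + N} d B) \<in> S"
    using pieces[OF k N(2,1) h] by blast
  interpret cluster_family m e k N h B
  proof
    show "(2 * N + 2) * h < mdist m (e i) (e j)" if "i < k" "j < k" "i \<noteq> j" for i j
    proof (rule hD)
      have "e i \<in> E" "e j \<in> E" "e i \<noteq> e j"
        using bij that by (auto simp: bij_betw_def inj_on_eq_iff)
      then show "mdist m (e i) (e j) \<in> D" by (force simp: D_def)
    qed
  qed (use X k h E bij pieces_ok in \<open>auto simp: bij_betw_def\<close>)
  let ?f = "\<lambda>q. gh_class (cspace q)"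
  show "\<not> covering_dim_le (top_of_set (S \<inter> U)) n"
  proof (rule cube_image_not_covering_dim_le[of ?f h N])
    show "?f ` hilbert_cube \<subseteq> S \<inter> U"
    proof (intro subsetI, elim imageE)
      fix Y q assume Y: "Y = ?f q" and q: "q \<in> hilbert_cube"
      have "\<exists>i<k. mdist m x (e i) < r" if "x \<in> mspace m" for x
        using E(4)[OF that] bij_betw_imp_surj_on[OF bij] by blast
      then have "dist X Y \<le> 2 * r"
        unfolding X(2) Y using hD[of r] by (intro dist_gh_class_space[OF q]) (auto simp: D_def)
      then show "Y \<in> S \<inter> U" using r \<epsilon> pieces_ok(3)[OF blowup_cdist[OF q]] Y by auto
    qed
    show "x i = y i" if "x \<in> hilbert_cube" "y \<in> hilbert_cube" "?f x = ?f y" "i < N" for x y i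
      using that isometric_space_imp_eq gh_class_eq_iff compact_metric_space by blast
  qed (use dist_gh_class_space_le N in auto)
qed

section \<open>The three kinds of classes\<close>

lemma gh_class_mem_X_class:
  assumes "compact_metric m" "u \<noteq> 0 \<longrightarrow> doubling m" "u = 0 \<longrightarrow> \<not> doubling m"
    "v \<noteq> 0 \<longrightarrow> uniformly_disconnected m" "v = 0 \<longrightarrow> \<not> uniformly_disconnected m"
    "w \<noteq> 0 \<longrightarrow> uniformly_perfect m" "w = 0 \<longrightarrow> \<not> uniformly_perfect m"
  shows "gh_class m \<in> X_class u v w"
  using assms gh_class_properties[OF assms(1)] by (auto simp: X_class_def E_class_def)

text \<open>Each bad piece spoils one property and respects the other two: a sequence space with
  growing branching is ultrametric and uniformly perfect, an interval is doubling and uniformly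
  perfect, a single point is doubling and ultrametric. So the three conditions can be met
  independently.\<close>

lemma infinite_dimensional_X_class:
  assumes U: "open U" "U \<noteq> {}"
  shows "infinite_dimensional (top_of_set (X_class u v w \<inter> U))"
proof (rule infinite_dimensional_of_pieces[OF _ U])
  fix k N K :: nat and h :: real
  assume kN: "k > 0" "4 \<le> N" and h: "h > 0"
  define s where "s = h / 2"
  have s: "s > 0" "s < h" using h by (auto simp: s_def)
  define B where "B a = (if a = k \<and> u = 0 then seq_metric s (\<lambda>n. n + 2)
      else if a = k + 1 \<and> v = 0 then interval_metric s
      else if a = k + 2 \<and> w = 0 then interval_metric 0 \<comment> \<open>an isolated point\<close>
      else seq_metric s (\<lambda>n. 2))" for a
  have B1: "compact_metric (B a)" for a
    using s by (auto simp: B_def intro!: compact_metric_seq_metric compact_metric_interval_metric)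
  have B2: "mdist (B a) x y < h" if "x \<in> mspace (B a)" "y \<in> mspace (B a)" for a x y
    using that s seq_dist_le[OF s(1), of x y] h by (auto simp: B_def split: if_splits)
  have "gh_class (blowup.space {..<k + N} d B) \<in> X_class u v w" if "blowup {..<k + N} d B h" for d
  proof -
    interpret blowup "{..<k + N}" d B h by (fact that)
    have mem: "k < k + N" "k + 1 < k + N" "k + 2 < k + N" using kN by auto
    \<comment> \<open>The value 2 imposes no condition and is treated like 1, so a bad piece is used
      only for the value 0.\<close>
    show ?thesis
    proof (rule gh_class_mem_X_class[OF compact_metric_space]; intro impI)
      assume "u \<noteq> 0"
      then show "doubling space"
        using s doubling_seq_metric[of s "\<lambda>n. 2" 2] doubling_interval_metric
        by (intro doubling_space) (simp add: B_def)
    next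
      assume "u = 0"
      then show "\<not> doubling space"
        using mem s by (intro not_doubling_space[OF that, of k s]) (auto simp: B_def)
    next
      assume "v \<noteq> 0"
      then show "uniformly_disconnected space"
        using s seq_dist_ultrametric[OF s(1)] by (intro uniformly_disconnected_space) (auto simp: B_def split: if_splits)
    next
      assume "v = 0"
      then show "\<not> uniformly_disconnected space"
        using mem s by (intro not_uniformly_disconnected_space[OF that, of "k + 1" s]) (auto simp: B_def)
    next
      assume w: "w \<noteq> 0"
      \<comment> \<open>Sequence spaces provide witnesses for radii below \<open>s\<close>, the
        interval of length \<open>s\<close> only below half its length; hence the bound
        \<open>s / 2\<close>.\<close>
      show "uniformly_perfect space"
      proof (rule uniformly_perfect_space[of "1 / 2" "s / 2"])
        fix a x r assume x: "x \<in> mspace (B a)" and r: "0 < r" "r < s / 2"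
        have "B a = seq_metric s (\<lambda>n. n + 2) \<or> B a = seq_metric s (\<lambda>n. 2) \<or> B a = interval_metric s"
          using w by (simp add: B_def)
        then consider "B a = seq_metric s (\<lambda>n. n + 2)" | "B a = seq_metric s (\<lambda>n. 2)" | "B a = interval_metric s"
          by blast
        then show "\<exists>y\<in>mspace (B a). 1 / 2 * r \<le> mdist (B a) x y \<and> mdist (B a) x y \<le> r"
        proof cases
          case 1
          show ?thesis using seq_metric_perfect[OF s(1), of "\<lambda>n. n + 2" x r] x r s by (simp add: 1)
        next
          case 2
          show ?thesis using seq_metric_perfect[OF s(1), of "\<lambda>n. 2" x r] x r s by (simp add: 2)
        next
          case 3
          show ?thesis using interval_metric_perfect[of x s r] x r unfolding 3 by blast
        qed
      qed (use s in auto)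
    next
      assume "w = 0"
      then show "\<not> uniformly_perfect space"
        using mem kN by (intro not_uniformly_perfect_space[of "k + 2" "\<lambda>n. 0" 0]) (auto simp: B_def)
    qed
  qed
  then show "\<exists>B :: nat \<Rightarrow> (nat \<Rightarrow> real) metric. (\<forall>a<k + N. compact_metric (B a) \<and>
          (\<forall>x\<in>mspace (B a). \<forall>y\<in>mspace (B a). mdist (B a) x y < h)) \<and>
        (\<forall>d. blowup {..<k + N} d B h \<longrightarrow> gh_class (blowup.space {..<k + N} d B) \<in> X_class u v w)"
    using B1 B2 by blast
qed

lemma infinite_dimensional_CA_class:
  assumes U: "open U" "U \<noteq> {}"
  shows "infinite_dimensional (top_of_set (CA_class \<inter> U))"
proof (rule infinite_dimensional_of_pieces[OF _ U])
  fix k N K :: nat and h :: real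
  assume K: "k + N = 2 ^ K" and h: "h > 0"
  define s where "s = h / 2"
  have s: "s > 0" "s < h" using h by (auto simp: s_def)
  let ?B = "\<lambda>a :: nat. seq_metric s (\<lambda>n. 2)"
  have "gh_class (blowup.space {..<k + N} d ?B) \<in> CA_class" if "blowup {..<k + N} d ?B h" for d
  proof -
    interpret blowup "{..<k + N}" d ?B h by (fact that)
    have "cantor_metric space" using K s by (intro cantor_metric_space[OF that, of K s]) auto
    then show ?thesis using gh_class_properties(4)[OF compact_metric_space] by (simp add: CA_class_def)
  qed
  moreover have "seq_dist s x y < h" for x y using seq_dist_le[OF s(1), of x y] s by simp
  ultimately show "\<exists>B :: nat \<Rightarrow> (nat \<Rightarrow> real) metric. (\<forall>a<k + N. compact_metric (B a) \<and>
          (\<forall>x\<in>mspace (B a). \<forall>y\<in>mspace (B a). mdist (B a) x y < h)) \<and>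
        (\<forall>d. blowup {..<k + N} d B h \<longrightarrow> gh_class (blowup.space {..<k + N} d B) \<in> CA_class)"
    using s compact_metric_seq_metric[of s "\<lambda>n. 2"] by (intro exI[of _ ?B]) simp
qed

text \<open>All pieces are copies of one small space \<open>Y\<close> on which \<open>D\<close> is
  infinite. A piece is compact, hence closed in the blow-up, and monotonicity makes \<open>D\<close>
  infinite there as well.\<close>

lemma infinite_dimensional_I_class:
  assumes D: "dimensional_function D" and U: "open U" "U \<noteq> {}"
  shows "infinite_dimensional (top_of_set (I_class D \<inter> U))"
proof (rule infinite_dimensional_of_pieces[OF _ U])
  fix k N K :: nat and h :: real
  assume k: "k > 0" and h: "h > 0"
  have "h / 2 > 0" using h by simp
  then obtain Y :: "real metric" where Y: "compact_metric Y" "D (abs_ghspace Y) = \<infinity>" "mdiameter Y \<le> h / 2"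
    using D unfolding dimensional_function_def by blast
  let ?B = "\<lambda>a :: nat. Y"
  have "gh_class (blowup.space {..<k + N} d ?B) \<in> I_class D" if "blowup {..<k + N} d ?B h" for d
  proof -
    interpret blowup "{..<k + N}" d ?B h by (fact that)
    \<comment> \<open>The monotonicity of \<open>D\<close> is stated for metrics on sets of reals,
      so the blow-up is replaced by a real copy.\<close>
    obtain M :: "real metric" where M: "isometric space M" "compact_metric M" "gh_class space = abs_ghspace M"
      using gh_class_rep[OF compact_metric_space] by blast
    obtain g where g: "isometric_embedding space M g" using M(1) by (auto simp: isometric_def)
    define f where "f = g \<circ> Pair 0"
    have f: "isometric_embedding Y M f"
      unfolding f_def using isometric_embedding_compose[OF isometric_embedding_Pair g] k by simp
    let ?A = "f ` mspace Y"
    have sub: "?A \<subseteq> mspace M" using f by (auto simp: isometric_embedding_def)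
    have "compactin (mtopology_of M) ?A"
      using Y(1) isometric_embedding_continuous_map[OF f]
      by (intro image_compactin) (auto simp: compact_metric_def compact_space_def)
    then have closed: "closedin (mtopology_of M) ?A"
      unfolding mtopology_of_def
      by (intro compactin_imp_closedin Metric_space.Hausdorff_space_mtopology) auto
    have ne: "?A \<noteq> {}" using Y(1) by (auto simp: compact_metric_def)
    have "isometric Y (submetric M ?A)"
      unfolding isometric_def using f sub
      by (intro exI[of _ f]) (auto simp: isometric_embedding_def)
    then have "abs_ghspace (submetric M ?A) = abs_ghspace Y"
      using abs_ghspace_eq_iff[OF Y(1) compact_metric_submetric[OF M(2) closed ne]] by simp
    moreover have "D (abs_ghspace (submetric M ?A)) \<le> D (abs_ghspace M)"
      using conjunct1[OF D[unfolded dimensional_function_def], rule_format, of M ?A] M(2) closed ne by simp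
    ultimately show ?thesis using Y(2) M(3) by (simp add: I_class_def top.extremum_unique)
  qed
  moreover have "mdist Y x y < h" if "x \<in> mspace Y" "y \<in> mspace Y" for x y
    using mdist_le_mdiameter[OF Y(1) that] Y(3) h by simp
  ultimately show "\<exists>B :: nat \<Rightarrow> real metric. (\<forall>a<k + N. compact_metric (B a) \<and>
          (\<forall>x\<in>mspace (B a). \<forall>y\<in>mspace (B a). mdist (B a) x y < h)) \<and>
        (\<forall>d. blowup {..<k + N} d B h \<longrightarrow> gh_class (blowup.space {..<k + N} d B) \<in> I_class D)"
    using Y(1) by (intro exI[of _ ?B]) simp
qed

theorem theorem1p8:
  fixes S U :: "ghspace set"
  assumes "(\<exists>u\<in>{0, 1, 2}. \<exists>v\<in>{0, 1, 2}. \<exists>w\<in>{0, 1, 2}. S = X_class u v w) \<or>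
           (\<exists>D. dimensional_function D \<and> S = I_class D) \<or>
           S = CA_class"
    and "open U" and "U \<noteq> {}"
  shows "infinite_dimensional (top_of_set (S \<inter> U))"
  using assms infinite_dimensional_X_class infinite_dimensional_I_class infinite_dimensional_CA_class by blast

end
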